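(* Let $(Q,L_d,f_d)$ be a forced discrete mechanical system of Routh type with potential $\beta\in\Omega^2(Q)$. The system is regular if and only if the 2-forms $$\omega^+:=(\mathbb F^+_{f_d}L_d)^*(\omega_Q-\pi_Q^*\beta),\qquad \omega^-:=(\mathbb F^-_{f_d}L_d)^*(\omega_Q-\pi_Q^*\beta)$$ are symplectic structures on $Q\times Q$.
   Context: $Q$ is a smooth $n$-dimensional manifold; $\mathrm{pr}_1,\mathrm{pr}_2:Q\times Q\to Q$ are the projections. For a smooth $H$ on $Q\times Q$, $D_1H(q_0,q_1)(\delta q_0):=TH(\delta q_0,0)$ and $D_2H(q_0,q_1)(\delta q_1):=TH(0,\delta q_1)$. A forced discrete mechanical system is a triple $(Q,L_d,f_d)$ with $L_d:Q\times Q\to\mathbb R$ smooth and $f_d$ a (smooth) 1-form on $Q\times Q$, written $f_d(q_0,q_1)(\delta q_0,\delta q_1)=f_d^-(q_0,q_1)(\delta q_0)+f_d^+(q_0,q_1)(\delta q_1)$ with $f_d^-(q_0,q_1)\in T^*_{q_0}Q$, $f_d^+(q_0,q_1)\in T^*_{q_1}Q$. The forced discrete Legendre transforms $Q\times Q\to T^*Q$ are $\mathbb F^+_{f_d}L_d(q_0,q_1):=(q_1,D_2L_d(q_0,q_1)+f_d^+(q_0,q_1))$ and $\mathbb F^-_{f_d}L_d(q_0,q_1):=(q_0,-D_1L_d(q_0,q_1)-f_d^-(q_0,q_1))$. The system is regular if both are local diffeomorphisms. $\pi_Q:T^*Q\to Q$ is the projection, $\theta_Q$ the canonical 1-form and $\omega_Q=-d\theta_Q$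 the canonical symplectic form. The system is of Routh type with (Routh) potential $\beta\in\Omega^2(Q)$ if $-df_d=\mathrm{pr}_2^*\beta-\mathrm{pr}_1^*\beta$. *)

theory Defs
  imports "HOL-Analysis.Analysis"
begin

section \<open>Smooth maps between open subsets of normed spaces\<close>

text \<open>These two notions are meant for open \<open>S\<close> and a finite-dimensional domain, where continuity
  of all iterated directional derivatives is the usual class \<open>C\<^sup>k\<close>.\<close>

primrec Ck_on :: "nat \<Rightarrow> 'a::real_normed_vector set \<Rightarrow> ('a \<Rightarrow> 'b::real_normed_vector) \<Rightarrow> bool" where
  "Ck_on 0 S f \<longleftrightarrow> continuous_on S f"
| "Ck_on (Suc k) S f \<longleftrightarrow> (\<forall>x\<in>S. f differentiable (at x)) \<and>
     (\<forall>a. Ck_on k S (\<lambda>x. frechet_derivative f (at x) a))"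

definition smooth_on :: "'a::real_normed_vector set \<Rightarrow> ('a \<Rightarrow> 'b::real_normed_vector) \<Rightarrow> bool" where
  "smooth_on S f \<longleftrightarrow> (\<forall>k. Ck_on k S f)"


section \<open>Smooth manifolds\<close>

text \<open>A chart is a domain together with a coordinate map, whose values off the domain are
  irrelevant.  A manifold is given by an atlas modelled on a Euclidean space \<open>'e\<close> (so its dimension
  is \<open>DIM('e)\<close>); the underlying set and the topology are those determined by the atlas.\<close>

type_synonym ('a, 'e) chart = "'a set \<times> ('a \<Rightarrow> 'e)"

definition chart_inv :: "('a, 'e) chart \<Rightarrow> 'e \<Rightarrow> 'a" where
  "chart_inv c = inv_into (fst c) (snd c)"

definition carrier :: "('a, 'e) chart set \<Rightarrow> 'a set" where
  "carrier M = (\<Union>c\<in>M. fst c)"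

definition charts_at :: "('a, 'e) chart set \<Rightarrow> 'a \<Rightarrow> ('a, 'e) chart set" where
  "charts_at M p = {c \<in> M. p \<in> fst c}"

definition chart_at :: "('a, 'e) chart set \<Rightarrow> 'a \<Rightarrow> ('a, 'e) chart" where
  "chart_at M p = (SOME c. c \<in> charts_at M p)"

definition smooth_atlas :: "('a, 'e::euclidean_space) chart set \<Rightarrow> bool" where
  "smooth_atlas M \<longleftrightarrow>
     (\<forall>c\<in>M. inj_on (snd c) (fst c) \<and> open (snd c ` fst c)) \<and>
     (\<forall>c\<in>M. \<forall>d\<in>M. open (snd c ` (fst c \<inter> fst d)) \<and>
        smooth_on (snd c ` (fst c \<inter> fst d)) (snd d \<circ> chart_inv c))"

definition atlas_topology :: "('a, 'e::euclidean_space) chart set \<Rightarrow> 'a topology" where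
  "atlas_topology M = topology (\<lambda>W. W \<subseteq> carrier M \<and> (\<forall>c\<in>M. open (snd c ` (W \<inter> fst c))))"

lemma openin_atlas_topology:
  assumes "smooth_atlas M"
  shows "openin (atlas_topology M) W \<longleftrightarrow>
           W \<subseteq> carrier M \<and> (\<forall>c\<in>M. open (snd c ` (W \<inter> fst c)))"
proof -
  have "istopology (\<lambda>W. W \<subseteq> carrier M \<and> (\<forall>c\<in>M. open (snd c ` (W \<inter> fst c))))"
    unfolding istopology_def
  proof (intro conjI allI impI ballI)
    fix S T c
    assume S: "S \<subseteq> carrier M \<and> (\<forall>c\<in>M. open (snd c ` (S \<inter> fst c)))"
      and T: "T \<subseteq> carrier M \<and> (\<forall>c\<in>M. open (snd c ` (T \<inter> fst c)))" and c: "c \<in> M"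
    have "inj_on (snd c) (fst c)"
      using assms c by (auto simp: smooth_atlas_def)
    then have "snd c ` (S \<inter> T \<inter> fst c) = snd c ` (S \<inter> fst c) \<inter> snd c ` (T \<inter> fst c)"
      by (auto simp: inj_on_def image_iff)
    then show "open (snd c ` (S \<inter> T \<inter> fst c))"
      using S T c by (auto intro: open_Int)
  next
    fix \<K> c
    assume "\<forall>K\<in>\<K>. K \<subseteq> carrier M \<and> (\<forall>c\<in>M. open (snd c ` (K \<inter> fst c)))" and "c \<in> M"
    moreover have "snd c ` (\<Union>\<K> \<inter> fst c) = (\<Union>K\<in>\<K>. snd c ` (K \<inter> fst c))"
      by auto
    ultimately show "open (snd c ` (\<Union>\<K> \<inter> fst c))"
      by auto
  qed auto
  then show ?thesis
    by (simp add: atlas_topology_def)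
qed

lemma topspace_atlas_topology:
  assumes "smooth_atlas M"
  shows "topspace (atlas_topology M) = carrier M"
proof
  show "topspace (atlas_topology M) \<subseteq> carrier M"
    using openin_atlas_topology[OF assms] openin_topspace by blast
  have "open (snd c ` (carrier M \<inter> fst c))" if "c \<in> M" for c
  proof -
    have "carrier M \<inter> fst c = fst c"
      using that by (auto simp: carrier_def)
    then show ?thesis
      using assms that by (simp add: smooth_atlas_def)
  qed
  then have "openin (atlas_topology M) (carrier M)"
    by (simp add: openin_atlas_topology[OF assms])
  then show "carrier M \<subseteq> topspace (atlas_topology M)"
    by (rule openin_subset)
qed

definition smooth_manifold :: "('a, 'e::euclidean_space) chart set \<Rightarrow> bool" where
  "smooth_manifold M \<longleftrightarrow> smooth_atlas M \<and>
     Hausdorff_space (atlas_topology M) \<and> second_countable (atlas_topology M)"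

text \<open>Openness of the coordinate domains of the local representatives expresses that \<open>W\<close> is open
  and \<open>f\<close> is continuous on it.\<close>

definition smooth_map_on ::
  "('a, 'e::euclidean_space) chart set \<Rightarrow> ('b, 'f::euclidean_space) chart set \<Rightarrow> 'a set \<Rightarrow>
   ('a \<Rightarrow> 'b) \<Rightarrow> bool" where
  "smooth_map_on M N W f \<longleftrightarrow> W \<subseteq> carrier M \<and> f ` W \<subseteq> carrier N \<and>
     (\<forall>c\<in>M. \<forall>d\<in>N. let V = snd c ` {p \<in> fst c \<inter> W. f p \<in> fst d} in
        open V \<and> smooth_on V (snd d \<circ> f \<circ> chart_inv c))"

abbreviation smooth_map ::
  "('a, 'e::euclidean_space) chart set \<Rightarrow> ('b, 'f::euclidean_space) chart set \<Rightarrow>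
   ('a \<Rightarrow> 'b) \<Rightarrow> bool" where
  "smooth_map M N f \<equiv> smooth_map_on M N (carrier M) f"

definition local_diffeo ::
  "('a, 'e::euclidean_space) chart set \<Rightarrow> ('b, 'f::euclidean_space) chart set \<Rightarrow>
   ('a \<Rightarrow> 'b) \<Rightarrow> bool" where
  "local_diffeo M N f \<longleftrightarrow>
     (\<forall>p\<in>carrier M. \<exists>W. p \<in> W \<and> openin (atlas_topology M) W \<and> openin (atlas_topology N) (f ` W) \<and>
        inj_on f W \<and> smooth_map_on M N W f \<and> smooth_map_on N M (f ` W) (inv_into W f))"

definition real_line :: "(real, real) chart set" where
  "real_line = {(UNIV, id)}"

definition prod_manifold ::
  "('a, 'e) chart set \<Rightarrow> ('b, 'f) chart set \<Rightarrow> ('a \<times> 'b, 'e \<times> 'f) chart set"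
  (infixr "\<times>\<^sub>M" 80) where
  "M \<times>\<^sub>M N = {(fst c \<times> fst d, map_prod (snd c) (snd d)) | c d. c \<in> M \<and> d \<in> N}"


section \<open>Tangent vectors and tangent maps\<close>

text \<open>A tangent vector at \<open>p\<close> is the family of its coordinate representatives in all charts around
  \<open>p\<close>, related by the derivatives of the chart transitions (and \<open>0\<close> at all other charts, so that
  equality of tangent vectors is equality of functions).  The vector space operations are
  pointwise.\<close>

type_synonym ('a, 'e) tvec = "('a, 'e) chart \<Rightarrow> 'e"

definition tangent_space ::
  "('a, 'e::euclidean_space) chart set \<Rightarrow> 'a \<Rightarrow> ('a, 'e) tvec set" where
  "tangent_space M p = {v.
     (\<forall>c\<in>charts_at M p. \<forall>d\<in>charts_at M p.
        v d = frechet_derivative (snd d \<circ> chart_inv c) (at (snd c p)) (v c)) \<and>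
     (\<forall>c. c \<notin> charts_at M p \<longrightarrow> v c = 0)}"

text \<open>The tangent vector at \<open>p\<close> represented by \<open>a\<close> in the chart \<open>c\<close>.\<close>

definition coord_vector ::
  "('a, 'e::euclidean_space) chart set \<Rightarrow> ('a, 'e) chart \<Rightarrow> 'a \<Rightarrow> 'e \<Rightarrow> ('a, 'e) tvec" where
  "coord_vector M c p a = (\<lambda>d. if d \<in> charts_at M p
     then frechet_derivative (snd d \<circ> chart_inv c) (at (snd c p)) a else 0)"

text \<open>Differential of a vector-valued function; on tangent vectors the chart does not matter.\<close>

definition differential ::
  "('a, 'e::euclidean_space) chart set \<Rightarrow> ('a \<Rightarrow> 'b::real_normed_vector) \<Rightarrow> 'a \<Rightarrow>
   ('a, 'e) tvec \<Rightarrow> 'b" where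
  "differential M g p v = (let c = chart_at M p in
     frechet_derivative (g \<circ> chart_inv c) (at (snd c p)) (v c))"

definition tangent_map ::
  "('a, 'e::euclidean_space) chart set \<Rightarrow> ('b, 'f::euclidean_space) chart set \<Rightarrow> ('a \<Rightarrow> 'b) \<Rightarrow>
   'a \<Rightarrow> ('a, 'e) tvec \<Rightarrow> ('b, 'f) tvec" where
  "tangent_map M N f p v =
     (\<lambda>d. if d \<in> charts_at N (f p) then differential M (snd d \<circ> f) p v else 0)"

text \<open>The vector \<open>(v, w)\<close> under the identification of the tangent space of a product with the
  product of the tangent spaces, i.e. the sum of the images of \<open>v\<close> and \<open>w\<close> under the inclusions of
  the two slices through \<open>p\<close>.\<close>

definition tangent_pair ::
  "('a, 'e::euclidean_space) chart set \<Rightarrow> ('b, 'f::euclidean_space) chart set \<Rightarrow> 'a \<times> 'b \<Rightarrow>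
   ('a, 'e) tvec \<Rightarrow> ('b, 'f) tvec \<Rightarrow> ('a \<times> 'b, 'e \<times> 'f) tvec" where
  "tangent_pair M N p v w = (\<lambda>c.
     tangent_map M (M \<times>\<^sub>M N) (\<lambda>x. (x, snd p)) (fst p) v c +
     tangent_map N (M \<times>\<^sub>M N) (\<lambda>y. (fst p, y)) (snd p) w c)"


section \<open>Differential forms\<close>

text \<open>Values of forms at points off the manifold or at families that are not tangent vectors are
  irrelevant.\<close>

type_synonym ('a, 'e) form1 = "'a \<Rightarrow> ('a, 'e) tvec \<Rightarrow> real"
type_synonym ('a, 'e) form2 = "'a \<Rightarrow> ('a, 'e) tvec \<Rightarrow> ('a, 'e) tvec \<Rightarrow> real"

definition linear_at ::
  "('a, 'e::euclidean_space) chart set \<Rightarrow> 'a \<Rightarrow> (('a, 'e) tvec \<Rightarrow> real) \<Rightarrow> bool" where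
  "linear_at M p \<alpha> \<longleftrightarrow>
     (\<forall>v\<in>tangent_space M p. \<forall>w\<in>tangent_space M p. \<alpha> (\<lambda>c. v c + w c) = \<alpha> v + \<alpha> w) \<and>
     (\<forall>r. \<forall>v\<in>tangent_space M p. \<alpha> (\<lambda>c. r *\<^sub>R v c) = r * \<alpha> v)"

text \<open>Coordinate expressions of forms in a chart.\<close>

definition coord_form1 ::
  "('a, 'e::euclidean_space) chart set \<Rightarrow> ('a, 'e) chart \<Rightarrow> ('a, 'e) form1 \<Rightarrow> 'e \<Rightarrow> 'e \<Rightarrow> real"
  where
  "coord_form1 M c \<alpha> a x = \<alpha> (chart_inv c x) (coord_vector M c (chart_inv c x) a)"

definition coord_form2 ::
  "('a, 'e::euclidean_space) chart set \<Rightarrow> ('a, 'e) chart \<Rightarrow> ('a, 'e) form2 \<Rightarrow> 'e \<Rightarrow> 'e \<Rightarrow> 'e \<Rightarrow> real"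
  where
  "coord_form2 M c \<beta> a b x =
     \<beta> (chart_inv c x) (coord_vector M c (chart_inv c x) a) (coord_vector M c (chart_inv c x) b)"

definition one_form :: "('a, 'e::euclidean_space) chart set \<Rightarrow> ('a, 'e) form1 \<Rightarrow> bool" where
  "one_form M \<alpha> \<longleftrightarrow>
     (\<forall>p\<in>carrier M. linear_at M p (\<alpha> p)) \<and>
     (\<forall>c\<in>M. \<forall>a. smooth_on (snd c ` fst c) (coord_form1 M c \<alpha> a))"

definition two_form :: "('a, 'e::euclidean_space) chart set \<Rightarrow> ('a, 'e) form2 \<Rightarrow> bool" where
  "two_form M \<beta> \<longleftrightarrow>
     (\<forall>p\<in>carrier M. \<forall>u\<in>tangent_space M p.
        linear_at M p (\<beta> p u) \<and> linear_at M p (\<lambda>v. \<beta> p v u) \<and> \<beta> p u u = 0) \<and>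
     (\<forall>c\<in>M. \<forall>a b. smooth_on (snd c ` fst c) (coord_form2 M c \<beta> a b))"

definition pullback2 ::
  "('a, 'e::euclidean_space) chart set \<Rightarrow> ('b, 'f::euclidean_space) chart set \<Rightarrow> ('a \<Rightarrow> 'b) \<Rightarrow>
   ('b, 'f) form2 \<Rightarrow> ('a, 'e) form2" where
  "pullback2 M N f \<beta> p v w = \<beta> (f p) (tangent_map M N f p v) (tangent_map M N f p w)"

text \<open>Exterior derivatives of 1-forms and 2-forms, by the usual coordinate formula
  \<open>d\<alpha>(v\<^sub>0,\<dots>,v\<^sub>k) = \<Sum>i. (-1)\<^sup>i (D\<alpha> v\<^sub>i)(v\<^sub>0,\<dots>,v\<^sub>k without v\<^sub>i)\<close>, which does not depend on the chart.\<close>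

definition ext_deriv1 ::
  "('a, 'e::euclidean_space) chart set \<Rightarrow> ('a, 'e) form1 \<Rightarrow> ('a, 'e) form2" where
  "ext_deriv1 M \<alpha> p v w = (let c = chart_at M p;
       D = \<lambda>a b. frechet_derivative (coord_form1 M c \<alpha> b) (at (snd c p)) a
     in D (v c) (w c) - D (w c) (v c))"

definition ext_deriv2 ::
  "('a, 'e::euclidean_space) chart set \<Rightarrow> ('a, 'e) form2 \<Rightarrow>
   'a \<Rightarrow> ('a, 'e) tvec \<Rightarrow> ('a, 'e) tvec \<Rightarrow> ('a, 'e) tvec \<Rightarrow> real" where
  "ext_deriv2 M \<beta> p u v w = (let c = chart_at M p;
       D = \<lambda>a b b'. frechet_derivative (coord_form2 M c \<beta> b b') (at (snd c p)) a
     in D (u c) (v c) (w c) - D (v c) (u c) (w c) + D (w c) (u c) (v c))"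

definition symplectic :: "('a, 'e::euclidean_space) chart set \<Rightarrow> ('a, 'e) form2 \<Rightarrow> bool" where
  "symplectic M \<omega> \<longleftrightarrow> two_form M \<omega> \<and>
     (\<forall>p\<in>carrier M. \<forall>u\<in>tangent_space M p. \<forall>v\<in>tangent_space M p. \<forall>w\<in>tangent_space M p.
        ext_deriv2 M \<omega> p u v w = 0) \<and>
     (\<forall>p\<in>carrier M. \<forall>v\<in>tangent_space M p.
        (\<forall>w\<in>tangent_space M p. \<omega> p v w = 0) \<longrightarrow> v = (\<lambda>_. 0))"


section \<open>The cotangent bundle\<close>

text \<open>Covectors are normalised to \<open>0\<close> off the tangent space, so that they are determined by their
  values on it.\<close>

type_synonym ('a, 'e) covec = "('a, 'e) tvec \<Rightarrow> real"

definition restrict_covec ::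
  "('a, 'e::euclidean_space) chart set \<Rightarrow> 'a \<Rightarrow> ('a, 'e) covec \<Rightarrow> ('a, 'e) covec" where
  "restrict_covec M p \<alpha> = (\<lambda>v. if v \<in> tangent_space M p then \<alpha> v else 0)"

definition cotangent_space ::
  "('a, 'e::euclidean_space) chart set \<Rightarrow> 'a \<Rightarrow> ('a, 'e) covec set" where
  "cotangent_space M p = {\<alpha>. linear_at M p \<alpha> \<and> (\<forall>v. v \<notin> tangent_space M p \<longrightarrow> \<alpha> v = 0)}"

text \<open>The bundle chart over \<open>c\<close> has coordinates \<open>(x, y)\<close> with \<open>y \<bullet> a\<close> the value of the covector on
  the tangent vector with coordinate representative \<open>a\<close>.\<close>

definition cotangent_chart ::
  "('a, 'e::euclidean_space) chart set \<Rightarrow> ('a, 'e) chart \<Rightarrow>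
   ('a \<times> ('a, 'e) covec, 'e \<times> 'e) chart" where
  "cotangent_chart M c =
     (SIGMA p:fst c. cotangent_space M p,
      \<lambda>(p, \<alpha>). (snd c p, \<Sum>b\<in>Basis. \<alpha> (coord_vector M c p b) *\<^sub>R b))"

definition cotangent_bundle ::
  "('a, 'e::euclidean_space) chart set \<Rightarrow> ('a \<times> ('a, 'e) covec, 'e \<times> 'e) chart set" where
  "cotangent_bundle M = cotangent_chart M ` M"

definition canonical_one_form ::
  "('a, 'e::euclidean_space) chart set \<Rightarrow> ('a \<times> ('a, 'e) covec, 'e \<times> 'e) form1" where
  "canonical_one_form M z v = snd z (tangent_map (cotangent_bundle M) M fst z v)"

definition canonical_symplectic_form ::
  "('a, 'e::euclidean_space) chart set \<Rightarrow> ('a \<times> ('a, 'e) covec, 'e \<times> 'e) form2" where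
  "canonical_symplectic_form M z v w =
     - ext_deriv1 (cotangent_bundle M) (canonical_one_form M) z v w"


section \<open>Forced discrete mechanical systems\<close>

definition forced_discrete_system ::
  "('q, 'e::euclidean_space) chart set \<Rightarrow> ('q \<times> 'q \<Rightarrow> real) \<Rightarrow> ('q \<times> 'q, 'e \<times> 'e) form1 \<Rightarrow> bool"
  where
  "forced_discrete_system Q L f \<longleftrightarrow>
     smooth_manifold Q \<and> smooth_map (Q \<times>\<^sub>M Q) real_line L \<and> one_form (Q \<times>\<^sub>M Q) f"

definition D1 ::
  "('q, 'e::euclidean_space) chart set \<Rightarrow> ('q \<times> 'q \<Rightarrow> real) \<Rightarrow> 'q \<times> 'q \<Rightarrow> ('q, 'e) covec" where
  "D1 Q L p v = differential (Q \<times>\<^sub>M Q) L p (tangent_pair Q Q p v (\<lambda>_. 0))"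

definition D2 ::
  "('q, 'e::euclidean_space) chart set \<Rightarrow> ('q \<times> 'q \<Rightarrow> real) \<Rightarrow> 'q \<times> 'q \<Rightarrow> ('q, 'e) covec" where
  "D2 Q L p w = differential (Q \<times>\<^sub>M Q) L p (tangent_pair Q Q p (\<lambda>_. 0) w)"

definition force_minus ::
  "('q, 'e::euclidean_space) chart set \<Rightarrow> ('q \<times> 'q, 'e \<times> 'e) form1 \<Rightarrow> 'q \<times> 'q \<Rightarrow> ('q, 'e) covec"
  where
  "force_minus Q f p v = f p (tangent_pair Q Q p v (\<lambda>_. 0))"

definition force_plus ::
  "('q, 'e::euclidean_space) chart set \<Rightarrow> ('q \<times> 'q, 'e \<times> 'e) form1 \<Rightarrow> 'q \<times> 'q \<Rightarrow> ('q, 'e) covec"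
  where
  "force_plus Q f p w = f p (tangent_pair Q Q p (\<lambda>_. 0) w)"

definition Legendre_plus ::
  "('q, 'e::euclidean_space) chart set \<Rightarrow> ('q \<times> 'q \<Rightarrow> real) \<Rightarrow> ('q \<times> 'q, 'e \<times> 'e) form1 \<Rightarrow>
   'q \<times> 'q \<Rightarrow> 'q \<times> ('q, 'e) covec" where
  "Legendre_plus Q L f p =
     (snd p, restrict_covec Q (snd p) (\<lambda>w. D2 Q L p w + force_plus Q f p w))"

definition Legendre_minus ::
  "('q, 'e::euclidean_space) chart set \<Rightarrow> ('q \<times> 'q \<Rightarrow> real) \<Rightarrow> ('q \<times> 'q, 'e \<times> 'e) form1 \<Rightarrow>
   'q \<times> 'q \<Rightarrow> 'q \<times> ('q, 'e) covec" where
  "Legendre_minus Q L f p =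
     (fst p, restrict_covec Q (fst p) (\<lambda>v. - D1 Q L p v - force_minus Q f p v))"

definition regular ::
  "('q, 'e::euclidean_space) chart set \<Rightarrow> ('q \<times> 'q \<Rightarrow> real) \<Rightarrow> ('q \<times> 'q, 'e \<times> 'e) form1 \<Rightarrow> bool"
  where
  "regular Q L f \<longleftrightarrow>
     local_diffeo (Q \<times>\<^sub>M Q) (cotangent_bundle Q) (Legendre_plus Q L f) \<and>
     local_diffeo (Q \<times>\<^sub>M Q) (cotangent_bundle Q) (Legendre_minus Q L f)"

definition Routh_type ::
  "('q, 'e::euclidean_space) chart set \<Rightarrow> ('q \<times> 'q, 'e \<times> 'e) form1 \<Rightarrow> ('q, 'e) form2 \<Rightarrow> bool"
  where
  "Routh_type Q f \<beta> \<longleftrightarrow> two_form Q \<beta> \<and>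
     (\<forall>p\<in>carrier (Q \<times>\<^sub>M Q). \<forall>v\<in>tangent_space (Q \<times>\<^sub>M Q) p. \<forall>w\<in>tangent_space (Q \<times>\<^sub>M Q) p.
        - ext_deriv1 (Q \<times>\<^sub>M Q) f p v w =
          pullback2 (Q \<times>\<^sub>M Q) Q snd \<beta> p v w - pullback2 (Q \<times>\<^sub>M Q) Q fst \<beta> p v w)"

definition magnetic_form ::
  "('q, 'e::euclidean_space) chart set \<Rightarrow> ('q, 'e) form2 \<Rightarrow>
   ('q \<times> ('q, 'e) covec, 'e \<times> 'e) form2" where
  "magnetic_form Q \<beta> z v w =
     canonical_symplectic_form Q z v w - pullback2 (cotangent_bundle Q) Q fst \<beta> z v w"

definition omega_plus ::
  "('q, 'e::euclidean_space) chart set \<Rightarrow> ('q \<times> 'q \<Rightarrow> real) \<Rightarrow> ('q \<times> 'q, 'e \<times> 'e) form1 \<Rightarrow>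
   ('q, 'e) form2 \<Rightarrow> ('q \<times> 'q, 'e \<times> 'e) form2" where
  "omega_plus Q L f \<beta> =
     pullback2 (Q \<times>\<^sub>M Q) (cotangent_bundle Q) (Legendre_plus Q L f) (magnetic_form Q \<beta>)"

definition omega_minus ::
  "('q, 'e::euclidean_space) chart set \<Rightarrow> ('q \<times> 'q \<Rightarrow> real) \<Rightarrow> ('q \<times> 'q, 'e \<times> 'e) form1 \<Rightarrow>
   ('q, 'e) form2 \<Rightarrow> ('q \<times> 'q, 'e \<times> 'e) form2" where
  "omega_minus Q L f \<beta> =
     pullback2 (Q \<times>\<^sub>M Q) (cotangent_bundle Q) (Legendre_minus Q L f) (magnetic_form Q \<beta>)"

end

theory Submission
  imports Defs
begin

text \<open>The form \<open>\<omega>\<^sub>Q - \<pi>\<^sub>Q\<^sup>*\<beta>\<close> on the cotangent bundle is nondegenerate for every 2-form \<open>\<beta>\<close>,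
  because \<open>\<omega>\<^sub>Q\<close> pairs base directions with fibre directions while \<open>\<pi>\<^sub>Q\<^sup>*\<beta>\<close> sees base directions only,
  and it is closed when \<open>\<beta>\<close> is; so for closed \<open>\<beta>\<close> it is symplectic (\<open>symplectic_magnetic_form\<close>).
  The Routh condition makes \<open>\<beta>\<close> closed: applying \<open>d\<close> to it gives \<open>pr\<^sub>2\<^sup>*d\<beta> = pr\<^sub>1\<^sup>*d\<beta>\<close>, and on vectors
  of the form \<open>(0, u)\<close> the left side is \<open>d\<beta>\<close> and the right side vanishes (\<open>closed_Routh_potential\<close>).

  Let \<open>F\<close> be a smooth map into a symplectic manifold from a manifold of the same dimension.  The
  pullback of the symplectic form is closed, and it is nondegenerate at \<open>p\<close> exactly when the tangent
  map of \<open>F\<close> at \<open>p\<close> is injective, hence bijective.  By the inverse function theorem this holds at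
  every point exactly when \<open>F\<close> is a local diffeomorphism (\<open>symplectic_pullback_iff\<close>).  The theorem
  is this equivalence for the two Legendre transforms, which are smooth maps between manifolds of
  dimension \<open>2 n\<close> (\<open>smooth_Legendre_plus\<close>, \<open>smooth_Legendre_minus\<close>).

  All computations are carried out in charts.  A tangent vector is determined by its representative
  in one chart, and maps and forms become smooth maps and families of smooth functions on open sets.
  The exterior derivative commutes with pullbacks because the second derivatives that appear are
  symmetric (\<open>second_derivative_symmetric\<close>); taking a chart transition as the map, the same
  computation shows that the exterior derivative of a 1-form does not depend on the chart
  (\<open>ext_deriv1_chart\<close>), and so, computed in a fixed chart near a point, it can be differentiated
  again.\<close>

section \<open>Calculus of smooth maps between open sets\<close>

abbreviation FD :: "('a::real_normed_vector \<Rightarrow> 'b::real_normed_vector) \<Rightarrow> 'a \<Rightarrow> 'a \<Rightarrow> 'b" where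
  "FD f x \<equiv> frechet_derivative f (at x)"

lemma FD_works: "f differentiable at x \<Longrightarrow> (f has_derivative FD f x) (at x)"
  by (simp add: frechet_derivative_works)

lemma FD_eqI: "(f has_derivative f') (at x) \<Longrightarrow> FD f x = f'"
  using frechet_derivative_at by metis

lemma has_derivative_cong_open:
  assumes "open S" "x \<in> S" "\<And>y. y \<in> S \<Longrightarrow> f y = g y"
  shows "(f has_derivative f') (at x) \<longleftrightarrow> (g has_derivative f') (at x)"
  using has_derivative_transform_within_open[of f f' x UNIV S g]
    has_derivative_transform_within_open[of g f' x UNIV S f] assms
  by auto

lemma FD_cong_open:
  assumes "open S" "x \<in> S" "\<And>y. y \<in> S \<Longrightarrow> f y = g y"
  shows "FD f x = FD g x"
  unfolding frechet_derivative_def using has_derivative_cong_open[OF assms] by simp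

lemma differentiable_cong_open:
  assumes "open S" "x \<in> S" "\<And>y. y \<in> S \<Longrightarrow> f y = g y"
  shows "f differentiable at x \<longleftrightarrow> g differentiable at x"
  unfolding differentiable_def using has_derivative_cong_open[OF assms] by simp

lemma linear_basis_sum:
  fixes g :: "'a::euclidean_space \<Rightarrow> 'b::real_vector"
  assumes "linear g"
  shows "g v = (\<Sum>b\<in>Basis. (v \<bullet> b) *\<^sub>R g b)"
proof -
  have "g v = g (\<Sum>b\<in>Basis. (v \<bullet> b) *\<^sub>R b)"
    by (simp add: euclidean_representation)
  then show ?thesis
    by (simp add: linear_sum[OF assms] linear_cmul[OF assms])
qed

lemma Ck_on_imp_continuous_on: "Ck_on k S f \<Longrightarrow> continuous_on S f"
  by (cases k) (auto simp: continuous_on_eq_continuous_within continuous_at_imp_continuous_at_within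
      differentiable_imp_continuous_within)

lemma Ck_on_SucD: "Ck_on (Suc k) S f \<Longrightarrow> Ck_on k S f"
proof (induction k arbitrary: f)
  case 0
  then show ?case
    using Ck_on_imp_continuous_on[OF 0] by simp
qed auto

lemma Ck_on_subset: "Ck_on k S f \<Longrightarrow> T \<subseteq> S \<Longrightarrow> Ck_on k T f"
  by (induction k arbitrary: f) (auto intro: continuous_on_subset)

lemma Ck_on_cong:
  assumes "open S" "\<And>x. x \<in> S \<Longrightarrow> f x = g x"
  shows "Ck_on k S f \<longleftrightarrow> Ck_on k S g"
  using assms(2)
proof (induction k arbitrary: f g)
  case 0
  then show ?case by (simp cong: continuous_on_cong)
next
  case (Suc k)
  have "Ck_on k S (\<lambda>x. FD f x a) \<longleftrightarrow> Ck_on k S (\<lambda>x. FD g x a)" for a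
    by (rule Suc.IH) (use FD_cong_open[OF assms(1) _ Suc.prems] in auto)
  then show ?case
    using differentiable_cong_open[OF assms(1) _ Suc.prems] by auto
qed

text \<open>The order of differentiability is tested pointwise on neighbourhoods because \<open>frechet_derivative\<close>
  at a point only sees the germ of the function there.\<close>

lemma Ck_on_local:
  assumes "\<And>x. x \<in> S \<Longrightarrow> \<exists>T. open T \<and> x \<in> T \<and> Ck_on k T f"
  shows "Ck_on k S f"
  using assms
proof (induction k arbitrary: f)
  case 0
  have "continuous (at x within S) f" if "x \<in> S" for x
  proof -
    from 0[OF that] obtain T where "open T" "x \<in> T" "continuous_on T f" by auto
    then show ?thesis
      by (simp add: continuous_at_imp_continuous_at_within continuous_on_eq_continuous_at)
  qed
  then show ?case
    by (simp add: continuous_on_eq_continuous_within)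
next
  case (Suc k)
  have "f differentiable at x" if "x \<in> S" for x
    using Suc.prems[OF that] by auto
  moreover have "Ck_on k S (\<lambda>x. FD f x a)" for a
  proof (rule Suc.IH)
    show "\<exists>T. open T \<and> x \<in> T \<and> Ck_on k T (\<lambda>x. FD f x a)" if "x \<in> S" for x
      using Suc.prems[OF that] by auto
  qed
  ultimately show ?case by simp
qed

lemma Ck_on_const: "Ck_on k S (\<lambda>x. c)"
  by (induction k arbitrary: c) (auto simp: frechet_derivative_const)

lemma Ck_on_linear:
  assumes "bounded_linear h"
  shows "Ck_on k S h"
proof (cases k)
  case 0
  then show ?thesis
    using assms by (simp add: linear_continuous_on)
next
  case (Suc j)
  have "FD h x = h" for x
    by (rule FD_eqI) (rule bounded_linear_imp_has_derivative[OF assms])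
  then show ?thesis
    using Suc assms by (auto simp: Ck_on_const bounded_linear_imp_differentiable)
qed

lemma Ck_on_linear_compose:
  assumes "open S" "bounded_linear h" "Ck_on k S f"
  shows "Ck_on k S (\<lambda>x. h (f x))"
  using assms(3)
proof (induction k arbitrary: f)
  case 0
  then show ?case
    using assms(2) by (simp add: bounded_linear.continuous_on)
next
  case (Suc k)
  have D: "((\<lambda>x. h (f x)) has_derivative (\<lambda>a. h (FD f x a))) (at x)" if "x \<in> S" for x
    using Suc.prems that by (auto intro!: bounded_linear.has_derivative[OF assms(2)] FD_works)
  have "Ck_on k S (\<lambda>x. FD (\<lambda>x. h (f x)) x a)" for a
    using Suc.IH[of "\<lambda>x. FD f x a"] Suc.prems
    by (subst Ck_on_cong[OF assms(1), where g = "\<lambda>x. h (FD f x a)"]) (simp_all add: FD_eqI[OF D])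
  then show ?case
    using D by (auto simp: differentiable_def)
qed

lemma Ck_on_add:
  assumes "open S" "Ck_on k S f" "Ck_on k S g"
  shows "Ck_on k S (\<lambda>x. f x + g x)"
  using assms(2,3)
proof (induction k arbitrary: f g)
  case 0
  then show ?case
    by (simp add: continuous_on_add)
next
  case (Suc k)
  have D: "((\<lambda>x. f x + g x) has_derivative (\<lambda>a. FD f x a + FD g x a)) (at x)" if "x \<in> S" for x
    using Suc.prems that by (auto intro!: has_derivative_add FD_works)
  have "Ck_on k S (\<lambda>x. FD (\<lambda>x. f x + g x) x a)" for a
    using Suc.IH[of "\<lambda>x. FD f x a" "\<lambda>x. FD g x a"] Suc.prems
    by (subst Ck_on_cong[OF assms(1), where g = "\<lambda>x. FD f x a + FD g x a"])
       (simp_all add: FD_eqI[OF D])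
  then show ?case
    using D by (auto simp: differentiable_def)
qed

lemma Ck_on_sum:
  assumes "open S" "\<And>i. i \<in> I \<Longrightarrow> Ck_on k S (f i)"
  shows "Ck_on k S (\<lambda>x. \<Sum>i\<in>I. f i x)"
  using assms(2) by (induction I rule: infinite_finite_induct)
    (auto intro: Ck_on_const Ck_on_add[OF assms(1)])

lemma Ck_on_bilinear:
  assumes "open S" "bounded_bilinear h" "Ck_on k S f" "Ck_on k S g"
  shows "Ck_on k S (\<lambda>x. h (f x) (g x))"
  using assms(3,4)
proof (induction k arbitrary: f g)
  case 0
  then show ?case
    using assms(2) by (simp add: bounded_bilinear.continuous_on)
next
  case (Suc k)
  have D: "((\<lambda>x. h (f x) (g x)) has_derivative (\<lambda>a. h (f x) (FD g x a) + h (FD f x a) (g x))) (at x)"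
    if "x \<in> S" for x
    using Suc.prems that by (auto intro!: bounded_bilinear.FDERIV[OF assms(2)] FD_works)
  have "Ck_on k S (\<lambda>x. FD (\<lambda>x. h (f x) (g x)) x a)" for a
    using Suc.IH[of f "\<lambda>x. FD g x a"] Suc.IH[of "\<lambda>x. FD f x a" g] Suc.prems
      Ck_on_SucD[OF Suc.prems(1)] Ck_on_SucD[OF Suc.prems(2)]
    by (subst Ck_on_cong[OF assms(1), where g = "\<lambda>x. h (f x) (FD g x a) + h (FD f x a) (g x)"])
       (auto simp: FD_eqI[OF D] intro!: Ck_on_add[OF assms(1)])
  then show ?case
    using D by (auto simp: differentiable_def)
qed

text \<open>By the chain rule the derivative of \<open>g \<circ> f\<close> in direction \<open>a\<close> is the directional derivative of \<open>g\<close>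
  along the varying vector \<open>FD f x a\<close>.  Expanding that vector in the standard basis turns it into a
  sum of products of functions to which the induction hypothesis applies.\<close>

lemma Ck_on_compose:
  fixes f :: "'a::euclidean_space \<Rightarrow> 'b::euclidean_space" and g :: "'b \<Rightarrow> 'c::real_normed_vector"
  assumes "open S" "open T" "f ` S \<subseteq> T" "Ck_on k S f" "Ck_on k T g"
  shows "Ck_on k S (\<lambda>x. g (f x))"
  using assms(4,5)
proof (induction k arbitrary: g)
  case 0
  then show ?case
    using assms(3) by (auto intro: continuous_on_compose2)
next
  case (Suc k)
  have D: "((\<lambda>x. g (f x)) has_derivative (\<lambda>a. FD g (f x) (FD f x a))) (at x)" if "x \<in> S" for x
    using Suc.prems that assms(3)
    by (intro has_derivative_compose[where f = f and g = g]) (auto intro!: FD_works)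
  have eq: "FD g (f x) (FD f x a) = (\<Sum>b\<in>Basis. (FD f x a \<bullet> b) *\<^sub>R FD g (f x) b)" if "x \<in> S" for x a
    using Suc.prems that assms(3)
    by (intro linear_basis_sum linear_frechet_derivative) auto
  have "Ck_on k S (\<lambda>x. FD g (f x) b)" for b
    by (rule Suc.IH[of "\<lambda>y. FD g y b"]) (use Suc.prems Ck_on_SucD[OF Suc.prems(1)] in auto)
  moreover have "Ck_on k S (\<lambda>x. FD f x a \<bullet> b)" for a b
    using Suc.prems by (auto intro!: Ck_on_linear_compose[OF assms(1) bounded_linear_inner_left])
  ultimately have "Ck_on k S (\<lambda>x. FD (\<lambda>x. g (f x)) x a)" for a
    by (subst Ck_on_cong[OF assms(1), where g = "\<lambda>x. \<Sum>b\<in>Basis. (FD f x a \<bullet> b) *\<^sub>R FD g (f x) b"])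
       (auto simp: FD_eqI[OF D] eq intro!: Ck_on_sum[OF assms(1)]
          Ck_on_bilinear[OF assms(1) bounded_bilinear_scaleR])
  then show ?case
    using D by (auto simp: differentiable_def)
qed

subsection \<open>Smooth maps\<close>

lemma smooth_on_has_derivative:
  assumes "smooth_on S f" "x \<in> S"
  shows "(f has_derivative FD f x) (at x)"
proof -
  have "Ck_on (Suc 0) S f" using assms by (simp only: smooth_on_def)
  then show ?thesis using assms(2) by (auto intro: FD_works)
qed

lemma smooth_on_differentiable: "smooth_on S f \<Longrightarrow> x \<in> S \<Longrightarrow> f differentiable at x"
  using smooth_on_has_derivative differentiable_def by blast

lemma smooth_on_linear_FD: "smooth_on S f \<Longrightarrow> x \<in> S \<Longrightarrow> linear (FD f x)"
  using smooth_on_differentiable linear_frechet_derivative by blast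

lemma smooth_on_FD: "smooth_on S f \<Longrightarrow> smooth_on S (\<lambda>x. FD f x a)"
  unfolding smooth_on_def by (metis Ck_on.simps(2))

lemma smooth_on_continuous_on: "smooth_on S f \<Longrightarrow> continuous_on S f"
  unfolding smooth_on_def using Ck_on.simps(1) by blast

lemma smooth_on_subset: "smooth_on S f \<Longrightarrow> T \<subseteq> S \<Longrightarrow> smooth_on T f"
  unfolding smooth_on_def using Ck_on_subset by blast

lemma smooth_on_cong: "open S \<Longrightarrow> (\<And>x. x \<in> S \<Longrightarrow> f x = g x) \<Longrightarrow> smooth_on S f \<longleftrightarrow> smooth_on S g"
  unfolding smooth_on_def using Ck_on_cong by blast

lemma smooth_on_local: "(\<And>x. x \<in> S \<Longrightarrow> \<exists>T. open T \<and> x \<in> T \<and> smooth_on T f) \<Longrightarrow> smooth_on S f"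
  unfolding smooth_on_def using Ck_on_local by metis

lemma smooth_on_const: "smooth_on S (\<lambda>x. c)"
  unfolding smooth_on_def using Ck_on_const by blast

lemma smooth_on_linear: "bounded_linear h \<Longrightarrow> smooth_on S h"
  unfolding smooth_on_def using Ck_on_linear by blast

lemma smooth_on_linear_compose:
  "open S \<Longrightarrow> bounded_linear h \<Longrightarrow> smooth_on S f \<Longrightarrow> smooth_on S (\<lambda>x. h (f x))"
  unfolding smooth_on_def using Ck_on_linear_compose by blast

lemma smooth_on_add: "open S \<Longrightarrow> smooth_on S f \<Longrightarrow> smooth_on S g \<Longrightarrow> smooth_on S (\<lambda>x. f x + g x)"
  unfolding smooth_on_def using Ck_on_add by blast

lemma smooth_on_minus: "open S \<Longrightarrow> smooth_on S f \<Longrightarrow> smooth_on S (\<lambda>x. - f x)"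
  using smooth_on_linear_compose[of S uminus f] bounded_linear_minus[OF bounded_linear_ident] by blast

lemma smooth_on_diff: "open S \<Longrightarrow> smooth_on S f \<Longrightarrow> smooth_on S g \<Longrightarrow> smooth_on S (\<lambda>x. f x - g x)"
  using smooth_on_add[of S f "\<lambda>x. - g x"] smooth_on_minus by auto

lemma smooth_on_sum:
  "open S \<Longrightarrow> (\<And>i. i \<in> I \<Longrightarrow> smooth_on S (f i)) \<Longrightarrow> smooth_on S (\<lambda>x. \<Sum>i\<in>I. f i x)"
  unfolding smooth_on_def by (intro allI Ck_on_sum) auto

lemma smooth_on_bilinear:
  "open S \<Longrightarrow> bounded_bilinear h \<Longrightarrow> smooth_on S f \<Longrightarrow> smooth_on S g \<Longrightarrow>
     smooth_on S (\<lambda>x. h (f x) (g x))"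
  unfolding smooth_on_def using Ck_on_bilinear by blast

lemmas smooth_on_scaleR = smooth_on_bilinear[OF _ bounded_bilinear_scaleR]
lemmas smooth_on_inner = smooth_on_bilinear[OF _ bounded_bilinear_inner]

lemma smooth_on_compose:
  fixes f :: "'a::euclidean_space \<Rightarrow> 'b::euclidean_space" and g :: "'b \<Rightarrow> 'c::real_normed_vector"
  assumes "open S" "open T" "f ` S \<subseteq> T" "smooth_on S f" "smooth_on T g"
  shows "smooth_on S (\<lambda>x. g (f x))"
  using assms Ck_on_compose[OF assms(1-3)] unfolding smooth_on_def by blast

lemma smooth_on_Pair:
  assumes "open S" "smooth_on S f" "smooth_on S g"
  shows "smooth_on S (\<lambda>x. (f x, g x))"
proof -
  have "bounded_linear (\<lambda>u::'b. (u, 0::'c))" "bounded_linear (\<lambda>u::'c. (0::'b, u))"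
    by (intro bounded_linear_Pair bounded_linear_ident bounded_linear_zero)+
  then have "smooth_on S (\<lambda>x. (f x, 0) + (0, g x))"
    using assms by (intro smooth_on_add) (auto intro: smooth_on_linear_compose)
  then show ?thesis by simp
qed

text \<open>In finite dimension, smoothness of \<open>A x b\<close> for each constant \<open>b\<close> is enough to insert a moving
  argument.\<close>

lemma smooth_on_linear_family:
  fixes A :: "'a::euclidean_space \<Rightarrow> 'b::euclidean_space \<Rightarrow> 'c::real_normed_vector"
  assumes "open S" "\<And>x. x \<in> S \<Longrightarrow> linear (A x)" "\<And>b. smooth_on S (\<lambda>x. A x b)" "smooth_on S v"
  shows "smooth_on S (\<lambda>x. A x (v x))"
proof -
  have "smooth_on S (\<lambda>x. \<Sum>b\<in>Basis. (v x \<bullet> b) *\<^sub>R A x b)"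
    using assms by (intro smooth_on_sum smooth_on_scaleR smooth_on_inner smooth_on_const) auto
  moreover have "A x (v x) = (\<Sum>b\<in>Basis. (v x \<bullet> b) *\<^sub>R A x b)" if "x \<in> S" for x
    by (rule linear_basis_sum[OF assms(2)[OF that]])
  ultimately show ?thesis
    by (subst smooth_on_cong[OF assms(1)]) auto
qed

lemma FD_compose:
  assumes "f differentiable at x" "g differentiable at (f x)"
  shows "FD (\<lambda>x. g (f x)) x a = FD g (f x) (FD f x a)"
  using FD_eqI[OF has_derivative_compose[OF FD_works[OF assms(1)] FD_works[OF assms(2)]]] by simp

subsection \<open>Symmetry of second derivatives\<close>

text \<open>The second difference of \<open>f\<close> over the parallelogram spanned by \<open>t a\<close> and \<open>t b\<close> is, by two
  applications of the mean value theorem, \<open>t\<^sup>2\<close> times a mixed second derivative at a nearby point.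
  Since it is symmetric in \<open>a\<close> and \<open>b\<close>, both orders of differentiation arise from it.\<close>

lemma second_difference:
  fixes f :: "'a::euclidean_space \<Rightarrow> real"
  assumes t: "0 < t" and sm: "smooth_on S f"
    and seg: "\<And>\<xi> \<eta>. \<xi> \<in> {0..t} \<Longrightarrow> \<eta> \<in> {0..t} \<Longrightarrow> x + \<xi> *\<^sub>R a + \<eta> *\<^sub>R b \<in> S"
  shows "\<exists>\<xi>\<in>{0..t}. \<exists>\<eta>\<in>{0..t}.
    f (x + t *\<^sub>R a + t *\<^sub>R b) - f (x + t *\<^sub>R a) - f (x + t *\<^sub>R b) + f x =
      t * t * FD (\<lambda>y. FD f y a) (x + \<xi> *\<^sub>R a + \<eta> *\<^sub>R b) b"
proof -
  let ?g = "\<lambda>s. f (x + s *\<^sub>R a + t *\<^sub>R b) - f (x + s *\<^sub>R a)"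
  have pa: "((\<lambda>s. x + s *\<^sub>R a + r *\<^sub>R b) has_derivative (\<lambda>h. h *\<^sub>R a)) (at s)" for s r :: real
    by (auto intro!: derivative_eq_intros)
  have Df: "((\<lambda>s. f (x + s *\<^sub>R a + r *\<^sub>R b)) has_real_derivative FD f (x + s *\<^sub>R a + r *\<^sub>R b) a) (at s)"
    if "s \<in> {0..t}" "r \<in> {0..t}" for s r
  proof -
    let ?y = "x + s *\<^sub>R a + r *\<^sub>R b"
    have y: "?y \<in> S" by (rule seg[OF that])
    have "((\<lambda>s. f (x + s *\<^sub>R a + r *\<^sub>R b)) has_derivative (\<lambda>h. FD f ?y (h *\<^sub>R a))) (at s)"
      by (rule has_derivative_compose[OF pa smooth_on_has_derivative[OF sm y]])
    moreover have "(\<lambda>h. FD f ?y (h *\<^sub>R a)) = (*) (FD f ?y a)"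
      using linear_cmul[OF smooth_on_linear_FD[OF sm y]] by auto
    ultimately show ?thesis by (simp add: has_field_derivative_def)
  qed
  \<comment> \<open>First in the direction \<open>a\<close>, for the difference of \<open>f\<close> between two parallel sides.\<close>
  have "\<exists>\<xi>>0. \<xi> < t \<and> ?g t - ?g 0 =
      (t - 0) * (FD f (x + \<xi> *\<^sub>R a + t *\<^sub>R b) a - FD f (x + \<xi> *\<^sub>R a) a)"
    using t Df[of _ t] Df[of _ 0] by (intro MVT2) (auto intro!: DERIV_diff)
  then obtain \<xi> where \<xi>: "0 < \<xi>" "\<xi> < t"
    "?g t - ?g 0 = t * (FD f (x + \<xi> *\<^sub>R a + t *\<^sub>R b) a - FD f (x + \<xi> *\<^sub>R a) a)" by auto
  let ?k = "\<lambda>y. FD f y a"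
  have smk: "smooth_on S ?k" using sm by (rule smooth_on_FD)
  have Dk: "((\<lambda>r. ?k (x + \<xi> *\<^sub>R a + r *\<^sub>R b)) has_real_derivative FD ?k (x + \<xi> *\<^sub>R a + r *\<^sub>R b) b) (at r)"
    if "r \<in> {0..t}" for r
  proof -
    let ?y = "x + \<xi> *\<^sub>R a + r *\<^sub>R b"
    have y: "?y \<in> S" using \<xi> by (intro seg) (use that in auto)
    have "((\<lambda>r. x + \<xi> *\<^sub>R a + r *\<^sub>R b) has_derivative (\<lambda>h. h *\<^sub>R b)) (at r)"
      by (auto intro!: derivative_eq_intros)
    from has_derivative_compose[OF this smooth_on_has_derivative[OF smk y]]
    have "((\<lambda>r. ?k (x + \<xi> *\<^sub>R a + r *\<^sub>R b)) has_derivative (\<lambda>h. FD ?k ?y (h *\<^sub>R b))) (at r)" .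
    moreover have "(\<lambda>h. FD ?k ?y (h *\<^sub>R b)) = (*) (FD ?k ?y b)"
      using linear_cmul[OF smooth_on_linear_FD[OF smk y]] by auto
    ultimately show ?thesis by (simp add: has_field_derivative_def)
  qed
  \<comment> \<open>Then in the direction \<open>b\<close>, for the derivative of \<open>f\<close> along \<open>a\<close>.\<close>
  have "\<exists>\<eta>>0. \<eta> < t \<and> ?k (x + \<xi> *\<^sub>R a + t *\<^sub>R b) - ?k (x + \<xi> *\<^sub>R a + 0 *\<^sub>R b) =
      (t - 0) * FD ?k (x + \<xi> *\<^sub>R a + \<eta> *\<^sub>R b) b"
    using t Dk by (intro MVT2[where f = "\<lambda>r. ?k (x + \<xi> *\<^sub>R a + r *\<^sub>R b)"]) auto
  then obtain \<eta> where \<eta>: "0 < \<eta>" "\<eta> < t"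
    "?k (x + \<xi> *\<^sub>R a + t *\<^sub>R b) - ?k (x + \<xi> *\<^sub>R a) = t * FD ?k (x + \<xi> *\<^sub>R a + \<eta> *\<^sub>R b) b" by auto
  show ?thesis
    using \<xi> \<eta> by (intro bexI[of _ \<xi>] bexI[of _ \<eta>]) (auto simp: algebra_simps)
qed

text \<open>If the two mixed derivatives differed at \<open>x\<close>, then by continuity no value of the one on a small ball
  around \<open>x\<close> would equal a value of the other, whereas a small second difference produces such a pair
  of points.\<close>

lemma second_derivative_symmetric_real:
  fixes f :: "'a::euclidean_space \<Rightarrow> real"
  assumes "open S" "x \<in> S" "smooth_on S f"
  shows "FD (\<lambda>y. FD f y a) x b = FD (\<lambda>y. FD f y b) x a"
proof (rule ccontr)
  let ?p = "\<lambda>y. FD (\<lambda>z. FD f z a) y b" and ?q = "\<lambda>y. FD (\<lambda>z. FD f z b) y a"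
  assume ne: "?p x \<noteq> ?q x"
  define e where "e = \<bar>?p x - ?q x\<bar> / 2"
  have e: "e > 0" using ne by (simp add: e_def)
  have "continuous_on S ?p" "continuous_on S ?q"
    using assms(3) by (auto intro!: smooth_on_continuous_on smooth_on_FD)
  then have "isCont ?p x" "isCont ?q x"
    using assms by (auto simp: continuous_on_eq_continuous_at)
  then have "\<exists>d>0. \<forall>y. dist y x < d \<longrightarrow> dist (?p y) (?p x) < e"
    "\<exists>d>0. \<forall>y. dist y x < d \<longrightarrow> dist (?q y) (?q x) < e"
    using e by (auto simp: continuous_at_eps_delta)
  then obtain d1 d2 where d1: "d1 > 0" "\<And>y. dist y x < d1 \<Longrightarrow> dist (?p y) (?p x) < e"
    and d2: "d2 > 0" "\<And>y. dist y x < d2 \<Longrightarrow> dist (?q y) (?q x) < e"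
    by blast
  obtain d3 where d3: "d3 > 0" "ball x d3 \<subseteq> S"
    using assms openE by blast
  define d where "d = min d1 (min d2 d3)"
  have d: "d > 0" using d1 d2 d3 by (simp add: d_def)
  \<comment> \<open>The parallelogram with sides \<open>t a\<close> and \<open>t b\<close> stays within distance \<open>d\<close> of \<open>x\<close>; the summand 1
    avoids a division by zero.\<close>
  define t where "t = d / (norm a + norm b + 1) / 2"
  have t: "t > 0" using d by (auto simp: t_def intro!: divide_pos_pos add_nonneg_pos)
  have near: "dist (x + \<xi> *\<^sub>R u + \<eta> *\<^sub>R v) x < d"
    if "\<xi> \<in> {0..t}" "\<eta> \<in> {0..t}" "norm u + norm v = norm a + norm b" for \<xi> \<eta> and u v :: 'a
  proof -
    have "norm (\<xi> *\<^sub>R u + \<eta> *\<^sub>R v) \<le> t * norm u + t * norm v"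
      using that t by (intro norm_triangle_le add_mono) (auto intro: mult_right_mono)
    also have "\<dots> = t * (norm a + norm b)"
      using that(3) by (simp add: distrib_left[symmetric])
    also have "\<dots> \<le> t * (norm a + norm b + 1)"
      using t by (auto simp: mult_left_mono)
    also have "\<dots> = d / 2"
    proof -
      have "norm a + norm b + 1 > 0" by (auto intro: add_nonneg_pos)
      then show ?thesis by (simp only: t_def) (simp add: field_simps)
    qed
    also have "\<dots> < d" using d by simp
    finally show ?thesis by (simp add: dist_norm add.assoc)
  qed
  then have seg: "x + \<xi> *\<^sub>R u + \<eta> *\<^sub>R v \<in> S"
    if "\<xi> \<in> {0..t}" "\<eta> \<in> {0..t}" "norm u + norm v = norm a + norm b" for \<xi> \<eta> u v
    using that d3(2) by (force simp: d_def dist_commute)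
  obtain \<xi> \<eta> where 1: "\<xi> \<in> {0..t}" "\<eta> \<in> {0..t}"
    "f (x + t *\<^sub>R a + t *\<^sub>R b) - f (x + t *\<^sub>R a) - f (x + t *\<^sub>R b) + f x
       = t * t * ?p (x + \<xi> *\<^sub>R a + \<eta> *\<^sub>R b)"
    using second_difference[OF t assms(3) seg, of a b] by auto
  obtain \<xi>' \<eta>' where 2: "\<xi>' \<in> {0..t}" "\<eta>' \<in> {0..t}"
    "f (x + t *\<^sub>R b + t *\<^sub>R a) - f (x + t *\<^sub>R b) - f (x + t *\<^sub>R a) + f x
       = t * t * ?q (x + \<xi>' *\<^sub>R b + \<eta>' *\<^sub>R a)"
    using second_difference[OF t assms(3) seg, of b a] by auto
  have swap: "x + t *\<^sub>R b + t *\<^sub>R a = x + t *\<^sub>R a + t *\<^sub>R b"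
    by (simp add: algebra_simps)
  have "t * t * ?p (x + \<xi> *\<^sub>R a + \<eta> *\<^sub>R b) = t * t * ?q (x + \<xi>' *\<^sub>R b + \<eta>' *\<^sub>R a)"
    using 1(3) 2(3) unfolding swap by linarith
  then have "?p (x + \<xi> *\<^sub>R a + \<eta> *\<^sub>R b) = ?q (x + \<xi>' *\<^sub>R b + \<eta>' *\<^sub>R a)"
    using t by simp
  moreover have "dist (?p (x + \<xi> *\<^sub>R a + \<eta> *\<^sub>R b)) (?p x) < e"
    using near[OF 1(1,2)] by (intro d1(2)) (auto simp: d_def)
  moreover have "dist (?q (x + \<xi>' *\<^sub>R b + \<eta>' *\<^sub>R a)) (?q x) < e"
    using near[OF 2(1,2)] by (intro d2(2)) (auto simp: d_def)
  ultimately show False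
    by (simp add: dist_real_def e_def) argo
qed

lemma second_derivative_symmetric:
  fixes f :: "'a::euclidean_space \<Rightarrow> 'b::euclidean_space"
  assumes "open S" "x \<in> S" "smooth_on S f"
  shows "FD (\<lambda>y. FD f y a) x b = FD (\<lambda>y. FD f y b) x a"
proof (rule euclidean_eqI)
  fix i :: 'b assume "i \<in> Basis"
  have lin: "FD (\<lambda>y. g y \<bullet> i) y a = FD g y a \<bullet> i" if "smooth_on S g" "y \<in> S" for g :: "'a \<Rightarrow> 'b" and y a
    using FD_eqI[OF bounded_linear.has_derivative[OF bounded_linear_inner_left
          smooth_on_has_derivative[OF that]]] by metis
  have "FD (\<lambda>y. FD f y a) x b \<bullet> i = FD (\<lambda>y. FD (\<lambda>y. f y \<bullet> i) y a) x b" for a b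
    using lin[OF smooth_on_FD[OF assms(3)] assms(2), of a b, symmetric]
      lin[OF assms(3)] FD_cong_open[OF assms(1,2), of "\<lambda>y. FD f y a \<bullet> i" "\<lambda>y. FD (\<lambda>y. f y \<bullet> i) y a"]
    by simp
  moreover have "smooth_on S (\<lambda>y. f y \<bullet> i)"
    using assms by (intro smooth_on_linear_compose[OF _ bounded_linear_inner_left])
  ultimately show "FD (\<lambda>y. FD f y a) x b \<bullet> i = FD (\<lambda>y. FD f y b) x a \<bullet> i"
    using second_derivative_symmetric_real[OF assms(1,2)] by simp
qed

subsection \<open>Smoothness of local inverses\<close>

text \<open>In the product rule the derivative of \<open>g\<close> is multiplied by \<open>f x\<close>; when that factor is 0, continuity
  of \<open>g\<close> suffices.\<close>

lemma has_derivative_mult_vanishing: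
  fixes f :: "'a::real_normed_vector \<Rightarrow> real" and g :: "'a \<Rightarrow> 'b::real_normed_vector"
  assumes f: "(f has_derivative f') (at x)" and "f x = 0" and g: "isCont g x"
  shows "((\<lambda>y. f y *\<^sub>R g y) has_derivative (\<lambda>h. f' h *\<^sub>R g x)) (at x)"
proof -
  have lin: "bounded_linear f'" using f by (rule has_derivative_bounded_linear)
  have q: "((\<lambda>h. (f (x + h) - f x - f' h) /\<^sub>R norm h) \<longlongrightarrow> 0) (at 0)"
  proof -
    have "((\<lambda>h. norm ((f (x + h) - f x - f' h) /\<^sub>R norm h)) \<longlongrightarrow> 0) (at 0)"
      using f by (simp add: has_derivative_at divide_inverse mult.commute abs_mult)
    then show ?thesis by (rule tendsto_norm_zero_cancel)
  qed
  have g0: "((\<lambda>h. g (x + h)) \<longlongrightarrow> g x) (at 0)"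
    using g by (simp add: isCont_def LIM_offset_zero_iff[of x])
  \<comment> \<open>The difference quotient of the product splits into the remainder of \<open>f\<close> times \<open>g\<close>, and a bounded
    factor times the increment of \<open>g\<close>.\<close>
  have "((\<lambda>h. ((f (x + h) - f x - f' h) /\<^sub>R norm h) *\<^sub>R g (x + h)) \<longlongrightarrow> 0 *\<^sub>R g x) (at 0)"
    by (intro tendsto_scaleR q g0)
  moreover have "((\<lambda>h. (f' h / norm h) *\<^sub>R (g (x + h) - g x)) \<longlongrightarrow> 0) (at 0)"
  proof -
    obtain K where K: "\<And>h. norm (f' h) \<le> norm h * K" and "K \<ge> 0"
      using bounded_linear.nonneg_bounded[OF lin] by blast
    have "((\<lambda>h. K * norm (g (x + h) - g x)) \<longlongrightarrow> K * norm (g x - g x)) (at 0)"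
      by (intro tendsto_intros g0)
    then have lim: "((\<lambda>h. K * norm (g (x + h) - g x)) \<longlongrightarrow> 0) (at 0)" by simp
    have "norm ((f' h / norm h) *\<^sub>R (g (x + h) - g x)) \<le> K * norm (g (x + h) - g x)" for h
    proof -
      have "\<bar>f' h / norm h\<bar> \<le> K"
      proof (cases "h = 0")
        case False
        then show ?thesis
          using K[of h] by (simp add: divide_le_eq mult.commute)
      qed (use \<open>K \<ge> 0\<close> in simp)
      from mult_right_mono[OF this norm_ge_zero[of "g (x + h) - g x"]] show ?thesis
        by simp
    qed
    then show ?thesis
      by (intro Lim_null_comparison[OF _ lim] always_eventually) auto
  qed
  ultimately have "((\<lambda>h. ((f (x + h) - f x - f' h) /\<^sub>R norm h) *\<^sub>R g (x + h) +
      (f' h / norm h) *\<^sub>R (g (x + h) - g x)) \<longlongrightarrow> 0 *\<^sub>R g x + 0) (at 0)"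
    by (rule tendsto_add)
  moreover have "((f (x + h) - f x - f' h) /\<^sub>R norm h) *\<^sub>R g (x + h) +
      (f' h / norm h) *\<^sub>R (g (x + h) - g x) =
      (f (x + h) *\<^sub>R g (x + h) - f x *\<^sub>R g x - f' h *\<^sub>R g x) /\<^sub>R norm h" for h
    using assms(2) by (simp add: algebra_simps divide_inverse)
  ultimately have "((\<lambda>h. (f (x + h) *\<^sub>R g (x + h) - f x *\<^sub>R g x - f' h *\<^sub>R g x) /\<^sub>R norm h) \<longlongrightarrow> 0) (at 0)"
    by simp
  then have "((\<lambda>h. norm (f (x + h) *\<^sub>R g (x + h) - f x *\<^sub>R g x - f' h *\<^sub>R g x) / norm h) \<longlongrightarrow> 0) (at 0)"
    by (rule tendsto_norm_zero[THEN back_subst[where P = "\<lambda>F. (F \<longlongrightarrow> 0) (at 0)"]])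
      (simp add: fun_eq_iff divide_inverse mult.commute)
  then show ?thesis
    unfolding has_derivative_at
    using lin by (auto intro: bounded_linear_compose[OF bounded_linear_scaleR_left])
qed

text \<open>Near \<open>y0\<close> the maps \<open>A y\<close> stay bounded below by half the lower bound of \<open>A y0\<close>, so their
  inverses are uniformly bounded there.\<close>

lemma inverse_family_continuous:
  fixes A :: "'c::euclidean_space \<Rightarrow> 'a::euclidean_space \<Rightarrow> 'a"
  assumes "open V" "\<And>y. y \<in> V \<Longrightarrow> linear (A y)" "\<And>y. y \<in> V \<Longrightarrow> bij (A y)"
    and cont: "\<And>a. continuous_on V (\<lambda>y. A y a)" and y0: "y0 \<in> V"
  shows "isCont (\<lambda>y. inv (A y) a) y0"
proof -
  obtain m where m: "m > 0" "\<And>v. m * norm v \<le> norm (A y0 v)"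
    using linear_inj_bounded_below_pos[OF assms(2)[OF y0]] assms(3)[OF y0]
    by (metis bij_is_inj mult.commute)
  let ?s = "\<lambda>y. \<Sum>i\<in>Basis. norm (A y i - A y0 i)"
  have c: "isCont (\<lambda>y. A y b) y0" for b
    using cont[of b] assms(1) y0 by (simp add: continuous_on_eq_continuous_at)
  have "isCont ?s y0" by (intro continuous_intros c)
  then have "(?s \<longlongrightarrow> ?s y0) (at y0)" by (simp add: isCont_def)
  then have "\<forall>\<^sub>F y in at y0. ?s y < m / 2"
    by (rule order_tendstoD) (use m in simp)
  moreover have "\<forall>\<^sub>F y in at y0. y \<in> V"
    using assms(1) y0 by (auto simp: eventually_at_topological)
  ultimately have "\<forall>\<^sub>F y in at y0.
      norm (inv (A y) a - inv (A y0) a) \<le> (2 / m) * norm (A y (inv (A y0) a) - A y0 (inv (A y0) a))"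
  proof eventually_elim
    case (elim y)
    have low: "m / 2 * norm v \<le> norm (A y v)" for v
    proof -
      have "linear (\<lambda>v. A y v - A y0 v)"
        using assms(2) elim y0 by (intro linear_compose_sub) auto
      then have "A y v - A y0 v = (\<Sum>i\<in>Basis. (v \<bullet> i) *\<^sub>R (A y i - A y0 i))"
        by (rule linear_basis_sum)
      also have "norm \<dots> \<le> (\<Sum>i\<in>Basis. norm v * norm (A y i - A y0 i))"
        by (intro sum_norm_le) (auto intro!: mult_right_mono simp: Basis_le_norm)
      also have "\<dots> = norm v * ?s y" by (simp add: sum_distrib_left)
      also have "\<dots> \<le> norm v * (m / 2)" using elim by (intro mult_left_mono) auto
      finally have "norm (A y v - A y0 v) \<le> norm v * (m / 2)" .
      moreover have "norm (A y0 v) \<le> norm (A y v) + norm (A y v - A y0 v)"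
        using norm_triangle_sub norm_minus_commute by metis
      ultimately show ?thesis using m(2)[of v] by (simp add: algebra_simps)
    qed
    let ?v = "inv (A y0) a"
    have eq: "A y (inv (A y) a - ?v) = A y0 ?v - A y ?v"
      using assms(2,3) elim y0 by (simp add: linear_diff bij_is_surj surj_f_inv_f)
    have "m / 2 * norm (inv (A y) a - ?v) \<le> norm (A y0 ?v - A y ?v)"
      using low[of "inv (A y) a - ?v"] unfolding eq .
    then show ?case
      using m(1) by (simp add: field_simps norm_minus_commute)
  qed
  moreover have "((\<lambda>y. (2 / m) * norm (A y (inv (A y0) a) - A y0 (inv (A y0) a))) \<longlongrightarrow> 0) (at y0)"
  proof -
    have "((\<lambda>y. (2 / m) * norm (A y (inv (A y0) a) - A y0 (inv (A y0) a))) \<longlongrightarrow>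
      (2 / m) * norm (A y0 (inv (A y0) a) - A y0 (inv (A y0) a))) (at y0)"
      using c unfolding isCont_def by (intro tendsto_intros)
    then show ?thesis by simp
  qed
  ultimately have "((\<lambda>y. inv (A y) a - inv (A y0) a) \<longlongrightarrow> 0) (at y0)"
    by (rule Lim_null_comparison)
  then show ?thesis
    by (simp add: isCont_def LIM_zero_iff)
qed

text \<open>From \<open>inv (A y) a - inv (A y0) a = - inv (A y) ((A y - A y0) (inv (A y0) a))\<close>, where the
  argument of \<open>inv (A y)\<close> vanishes at \<open>y0\<close>: continuity of the inverses suffices for
  differentiability.\<close>

lemma inverse_family_has_derivative:
  fixes A :: "'c::euclidean_space \<Rightarrow> 'a::euclidean_space \<Rightarrow> 'a"
  assumes "open V" "\<And>y. y \<in> V \<Longrightarrow> linear (A y)" "\<And>y. y \<in> V \<Longrightarrow> bij (A y)"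
    and diff: "\<And>a y. y \<in> V \<Longrightarrow> (\<lambda>y. A y a) differentiable at y" and y0: "y0 \<in> V"
  shows "((\<lambda>y. inv (A y) a) has_derivative
     (\<lambda>h. - (\<Sum>j\<in>Basis. (FD (\<lambda>y. A y (inv (A y0) a)) y0 h \<bullet> j) *\<^sub>R inv (A y0) j))) (at y0)"
proof -
  let ?v = "inv (A y0) a"
  let ?\<phi> = "\<lambda>y. A y ?v"
  have cont: "continuous_on V (\<lambda>y. A y b)" for b
    using diff by (simp add: continuous_on_eq_continuous_within continuous_at_imp_continuous_at_within
        differentiable_imp_continuous_within)
  have eq: "inv (A y) a = ?v - (\<Sum>j\<in>Basis. ((?\<phi> y - ?\<phi> y0) \<bullet> j) *\<^sub>R inv (A y) j)" if "y \<in> V" for y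
  proof -
    have lin: "linear (A y)" and lin_inv: "linear (inv (A y))"
      using assms(2,3)[OF that] by (auto intro: inj_linear_imp_inv_linear bij_is_inj)
    have "inv (A y) (?\<phi> y - ?\<phi> y0) = (\<Sum>j\<in>Basis. ((?\<phi> y - ?\<phi> y0) \<bullet> j) *\<^sub>R inv (A y) j)"
      by (rule linear_basis_sum[OF lin_inv])
    moreover have "inv (A y) (?\<phi> y - ?\<phi> y0) = ?v - inv (A y) a"
      using assms(3)[OF that] assms(3)[OF y0]
      by (simp add: linear_diff[OF lin_inv] bij_is_inj bij_is_surj surj_f_inv_f inv_f_f)
    ultimately show ?thesis by (simp add: algebra_simps)
  qed
  have "((\<lambda>y. (?\<phi> y - ?\<phi> y0) \<bullet> j) has_derivative (\<lambda>h. FD ?\<phi> y0 h \<bullet> j)) (at y0)" for j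
  proof -
    have "((\<lambda>y. ?\<phi> y - ?\<phi> y0) has_derivative (\<lambda>h. FD ?\<phi> y0 h - 0)) (at y0)"
      by (intro has_derivative_diff has_derivative_const FD_works diff y0)
    then show ?thesis
      using bounded_linear.has_derivative[OF bounded_linear_inner_left] by fastforce
  qed
  then have "((\<lambda>y. ((?\<phi> y - ?\<phi> y0) \<bullet> j) *\<^sub>R inv (A y) j) has_derivative
      (\<lambda>h. (FD ?\<phi> y0 h \<bullet> j) *\<^sub>R inv (A y0) j)) (at y0)" for j
    by (rule has_derivative_mult_vanishing)
      (auto intro: inverse_family_continuous[OF assms(1-3) cont y0])
  then have "((\<lambda>y. ?v - (\<Sum>j\<in>Basis. ((?\<phi> y - ?\<phi> y0) \<bullet> j) *\<^sub>R inv (A y) j)) has_derivative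
      (\<lambda>h. 0 - (\<Sum>j\<in>Basis. (FD ?\<phi> y0 h \<bullet> j) *\<^sub>R inv (A y0) j))) (at y0)"
    by (intro has_derivative_diff has_derivative_sum has_derivative_const)
  then show ?thesis
    using has_derivative_cong_open[OF assms(1) y0 eq] by simp
qed

text \<open>The derivative of the inverses is a polynomial in the inverses and the derivative of \<open>A\<close>, so each
  order of differentiability of \<open>A\<close> passes to the inverses by induction.\<close>

lemma Ck_on_inverse_family:
  fixes A :: "'c::euclidean_space \<Rightarrow> 'a::euclidean_space \<Rightarrow> 'a"
  assumes "open V" "\<And>y. y \<in> V \<Longrightarrow> linear (A y)" "\<And>y. y \<in> V \<Longrightarrow> bij (A y)"
    and "\<And>a. Ck_on k V (\<lambda>y. A y a)"
  shows "Ck_on k V (\<lambda>y. inv (A y) a)"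
  using assms(4)
proof (induction k arbitrary: a)
  case 0
  then show ?case
    using inverse_family_continuous[OF assms(1-3)] assms(1)
    by (simp add: continuous_on_eq_continuous_at)
next
  case (Suc k)
  have diff: "(\<lambda>y. A y b) differentiable at y" if "y \<in> V" for b y
    using Suc.prems that by auto
  note D = inverse_family_has_derivative[OF assms(1-3) diff, simplified]
  have IH: "Ck_on k V (\<lambda>y. inv (A y) b)" for b
    by (rule Suc.IH) (use Suc.prems Ck_on_SucD in blast)
  have lin: "FD (\<lambda>y. A y v) y h = (\<Sum>i\<in>Basis. (v \<bullet> i) *\<^sub>R FD (\<lambda>y. A y i) y h)" if "y \<in> V" for v y h
  proof -
    have "((\<lambda>y. \<Sum>i\<in>Basis. (v \<bullet> i) *\<^sub>R A y i) has_derivative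
        (\<lambda>h. \<Sum>i\<in>Basis. (v \<bullet> i) *\<^sub>R FD (\<lambda>y. A y i) y h)) (at y)"
      using diff[OF that]
      by (intro has_derivative_sum bounded_linear.has_derivative[OF bounded_linear_scaleR_right] FD_works)
    then have "((\<lambda>y. A y v) has_derivative (\<lambda>h. \<Sum>i\<in>Basis. (v \<bullet> i) *\<^sub>R FD (\<lambda>y. A y i) y h)) (at y)"
      by (subst has_derivative_cong_open[OF assms(1) that linear_basis_sum[OF assms(2)]])
    then show ?thesis by (simp add: FD_eqI)
  qed
  have "Ck_on k V (\<lambda>y. (-1) *\<^sub>R (\<Sum>j\<in>Basis.
      ((\<Sum>i\<in>Basis. (inv (A y) a \<bullet> i) *\<^sub>R FD (\<lambda>y. A y i) y h) \<bullet> j) *\<^sub>R inv (A y) j))" for h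
    using Suc.prems
    by (intro Ck_on_linear_compose[OF assms(1) bounded_linear_scaleR_right] Ck_on_sum
        Ck_on_bilinear[OF assms(1) bounded_bilinear_scaleR]
        Ck_on_linear_compose[OF assms(1) bounded_linear_inner_left] IH assms(1)) auto
  then have "Ck_on k V (\<lambda>y. FD (\<lambda>y. inv (A y) a) y h)" for h
  proof (subst Ck_on_cong[OF assms(1)])
    show "FD (\<lambda>y. inv (A y) a) y h = (-1) *\<^sub>R (\<Sum>j\<in>Basis.
        ((\<Sum>i\<in>Basis. (inv (A y) a \<bullet> i) *\<^sub>R FD (\<lambda>y. A y i) y h) \<bullet> j) *\<^sub>R inv (A y) j)" if "y \<in> V" for y
      unfolding lin[OF that, of "inv (A y) a" h, symmetric] FD_eqI[OF D[OF that]] by simp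
  qed
  then show ?case
    using D by (auto simp: differentiable_def)
qed

text \<open>Bootstrapping: the derivative of \<open>g\<close> at \<open>y\<close> is \<open>inv (FD f (g y))\<close>, which is \<open>C\<^sup>k\<close> in \<open>y\<close> as soon as
  \<open>g\<close> is, and then \<open>g\<close> is \<open>C\<^sup>k\<^sup>+\<^sup>1\<close>.\<close>

lemma smooth_on_inverse:
  fixes f g :: "'a::euclidean_space \<Rightarrow> 'a"
  assumes "open U" "open V" "smooth_on U f" "continuous_on V g" "g ` V \<subseteq> U"
    and D: "\<And>y. y \<in> V \<Longrightarrow> (g has_derivative inv (FD f (g y))) (at y)"
    and bij: "\<And>y. y \<in> V \<Longrightarrow> bij (FD f (g y))"
  shows "smooth_on V g"
proof -
  have "Ck_on k V g" for k
  proof (induction k)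
    case 0
    then show ?case using assms(4) by simp
  next
    case (Suc k)
    have "Ck_on k V (\<lambda>y. FD f (g y) a)" for a
      using smooth_on_FD[OF assms(3)] unfolding smooth_on_def
      by (intro Ck_on_compose[OF assms(2,1,5) Suc]) blast
    then have "Ck_on k V (\<lambda>y. inv (FD f (g y)) a)" for a
      using assms(5) by (intro Ck_on_inverse_family[OF assms(2) _ bij])
        (auto intro: smooth_on_linear_FD[OF assms(3)])
    then have "Ck_on k V (\<lambda>y. FD g y a)" for a
      by (subst Ck_on_cong[OF assms(2)]) (auto simp: FD_eqI[OF D])
    then show ?case using D by (auto simp: differentiable_def)
  qed
  then show ?thesis by (simp add: smooth_on_def)
qed

theorem smooth_inverse_function:
  fixes f :: "'a::euclidean_space \<Rightarrow> 'a"
  assumes "open U" "x0 \<in> U" "smooth_on U f" "inj (FD f x0)"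
  obtains U' V g where "open U'" "U' \<subseteq> U" "x0 \<in> U'" "open V" "homeomorphism U' V f g" "smooth_on V g"
proof -
  define f' where "f' = (\<lambda>x. Blinfun (FD f x))"
  have f': "blinfun_apply (f' x) = FD f x" if "x \<in> U" for x
    using smooth_on_has_derivative[OF assms(3) that]
    by (auto simp: f'_def intro: bounded_linear_Blinfun_apply has_derivative_bounded_linear)
  have lin: "linear (FD f x0)" by (rule smooth_on_linear_FD[OF assms(3,2)])
  then obtain h where h: "linear h" "h \<circ> FD f x0 = id"
    using linear_injective_left_inverse assms(4) by blast
  have "continuous_on U f'"
    by (rule continuous_on_blinfun_componentwise)
      (simp add: f' smooth_on_continuous_on[OF smooth_on_FD[OF assms(3)]] cong: continuous_on_cong)
  moreover have "Blinfun h o\<^sub>L f' x0 = id_blinfun"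
  proof (rule blinfun_eqI)
    fix v
    have "blinfun_apply (Blinfun h) = h"
      using h(1) by (simp add: bounded_linear_Blinfun_apply linear_conv_bounded_linear)
    then show "blinfun_apply (Blinfun h o\<^sub>L f' x0) v = blinfun_apply id_blinfun v"
      using f'[OF assms(2)] fun_cong[OF h(2), of v] by simp
  qed
  ultimately obtain U' V g g' where *: "open U'" "U' \<subseteq> U" "x0 \<in> U'" "open V" "homeomorphism U' V f g"
    "\<And>y. y \<in> V \<Longrightarrow> (g has_derivative g' y) (at y)"
    "\<And>y. y \<in> V \<Longrightarrow> g' y = inv (blinfun_apply (f' (g y)))"
    "\<And>y. y \<in> V \<Longrightarrow> bij (blinfun_apply (f' (g y)))"
    using inverse_function_theorem[OF assms(1) _ _ assms(2), of f f' "Blinfun h"]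
      smooth_on_has_derivative[OF assms(3)] f' by metis
  have gV: "g y \<in> U" if "y \<in> V" for y
    using *(2,5) that by (auto simp: homeomorphism_def)
  have "smooth_on V g"
    using *(2,5-8) gV
    by (intro smooth_on_inverse[OF assms(1) *(4) assms(3)]) (simp_all add: homeomorphism_def f' image_subset_iff)
  then show ?thesis using * that by blast
qed

section \<open>Charts and tangent vectors\<close>

lemma atlas_inj: "smooth_atlas M \<Longrightarrow> c \<in> M \<Longrightarrow> inj_on (snd c) (fst c)"
  and atlas_open: "smooth_atlas M \<Longrightarrow> c \<in> M \<Longrightarrow> open (snd c ` fst c)"
  and atlas_overlap_open: "smooth_atlas M \<Longrightarrow> c \<in> M \<Longrightarrow> d \<in> M \<Longrightarrow> open (snd c ` (fst c \<inter> fst d))"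
  and atlas_transition_smooth: "smooth_atlas M \<Longrightarrow> c \<in> M \<Longrightarrow> d \<in> M \<Longrightarrow>
    smooth_on (snd c ` (fst c \<inter> fst d)) (snd d \<circ> chart_inv c)"
  by (auto simp: smooth_atlas_def)

lemma chart_inv_in: "x \<in> snd c ` fst c \<Longrightarrow> chart_inv c x \<in> fst c"
  by (simp add: chart_inv_def inv_into_into)

lemma chart_chart_inv: "x \<in> snd c ` fst c \<Longrightarrow> snd c (chart_inv c x) = x"
  by (simp add: chart_inv_def f_inv_into_f)

lemma chart_inv_chart: "inj_on (snd c) (fst c) \<Longrightarrow> p \<in> fst c \<Longrightarrow> chart_inv c (snd c p) = p"
  by (simp add: chart_inv_def)

lemma charts_atI: "c \<in> M \<Longrightarrow> p \<in> fst c \<Longrightarrow> c \<in> charts_at M p"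
  and charts_atD: "c \<in> charts_at M p \<Longrightarrow> c \<in> M \<and> p \<in> fst c"
  by (auto simp: charts_at_def)

lemma charts_at_mem:
  assumes "c \<in> charts_at M p"
  shows "c \<in> M" "p \<in> fst c" "snd c p \<in> snd c ` fst c"
  using charts_atD[OF assms] by auto

lemma charts_at_carrier: "c \<in> charts_at M p \<Longrightarrow> p \<in> carrier M"
  by (auto simp: charts_at_def carrier_def)

lemma chart_carrier: "c \<in> M \<Longrightarrow> p \<in> fst c \<Longrightarrow> p \<in> carrier M"
  by (auto simp: carrier_def)

lemma chart_at_in: "p \<in> carrier M \<Longrightarrow> chart_at M p \<in> charts_at M p"
  unfolding chart_at_def by (rule someI_ex) (auto simp: carrier_def charts_at_def)

lemma carrier_chartE:
  assumes "p \<in> carrier M"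
  obtains c where "c \<in> charts_at M p"
  using chart_at_in[OF assms] by (rule that)

lemma chart_inv_charts_at: "c \<in> M \<Longrightarrow> x \<in> snd c ` fst c \<Longrightarrow> c \<in> charts_at M (chart_inv c x)"
  by (simp add: charts_atI chart_inv_in)

lemma chart_inv_carrier: "c \<in> M \<Longrightarrow> x \<in> snd c ` fst c \<Longrightarrow> chart_inv c x \<in> carrier M"
  by (metis charts_at_carrier chart_inv_charts_at)

lemma chart_image_at:
  assumes "smooth_atlas M" "c \<in> charts_at M p"
  shows "snd c p \<in> snd c ` fst c" "chart_inv c (snd c p) = p"
  using assms atlas_inj[OF assms(1)] by (auto simp: charts_at_def chart_inv_chart)

lemma overlap_at:
  assumes "smooth_atlas M" "c \<in> charts_at M p" "d \<in> charts_at M p"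
  shows "open (snd c ` (fst c \<inter> fst d))" "snd c p \<in> snd c ` (fst c \<inter> fst d)"
    "smooth_on (snd c ` (fst c \<inter> fst d)) (snd d \<circ> chart_inv c)"
proof -
  have "c \<in> M" "d \<in> M" "p \<in> fst c" "p \<in> fst d"
    using assms by (auto simp: charts_at_def)
  then show "open (snd c ` (fst c \<inter> fst d))" "snd c p \<in> snd c ` (fst c \<inter> fst d)"
    "smooth_on (snd c ` (fst c \<inter> fst d)) (snd d \<circ> chart_inv c)"
    using atlas_overlap_open[OF assms(1)] atlas_transition_smooth[OF assms(1)] by blast+
qed

text \<open>The chain rule for \<open>h = (h in the chart d) \<circ> (transition from c to d)\<close>.  With \<open>h\<close> a coordinate map
  this is the cocycle condition for chart transitions; it also makes \<open>differential\<close> independent of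
  the chart.\<close>

lemma FD_change_chart:
  assumes M: "smooth_atlas M" and c: "c \<in> charts_at M p" and d: "d \<in> charts_at M p"
    and h: "(h \<circ> chart_inv d) differentiable at (snd d p)"
  shows "(h \<circ> chart_inv c) differentiable at (snd c p)"
    and "FD (h \<circ> chart_inv c) (snd c p) a =
           FD (h \<circ> chart_inv d) (snd d p) (FD (snd d \<circ> chart_inv c) (snd c p) a)"
proof -
  let ?S = "snd c ` (fst c \<inter> fst d)"
  have t: "(snd d \<circ> chart_inv c) differentiable at (snd c p)"
    by (rule smooth_on_differentiable[OF overlap_at(3,2)[OF M c d]])
  have inj: "inj_on (snd c) (fst c)" "inj_on (snd d) (fst d)"
    using c d atlas_inj[OF M] by (auto simp: charts_at_def)
  have tp: "(snd d \<circ> chart_inv c) (snd c p) = snd d p"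
    using c chart_image_at[OF M c] by simp
  have eq: "(h \<circ> chart_inv c) x = (h \<circ> chart_inv d) ((snd d \<circ> chart_inv c) x)" if "x \<in> ?S" for x
    using that inj by (auto simp: chart_inv_chart)
  have D: "((\<lambda>x. (h \<circ> chart_inv d) ((snd d \<circ> chart_inv c) x)) has_derivative
      (\<lambda>a. FD (h \<circ> chart_inv d) (snd d p) (FD (snd d \<circ> chart_inv c) (snd c p) a))) (at (snd c p))"
    by (rule has_derivative_compose[OF FD_works[OF t]], unfold tp) (rule FD_works[OF h])
  then have "((h \<circ> chart_inv c) has_derivative
      (\<lambda>a. FD (h \<circ> chart_inv d) (snd d p) (FD (snd d \<circ> chart_inv c) (snd c p) a))) (at (snd c p))"
    by (subst has_derivative_cong_open[OF overlap_at(1,2)[OF M c d] eq])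
  then show "(h \<circ> chart_inv c) differentiable at (snd c p)"
    and "FD (h \<circ> chart_inv c) (snd c p) a =
           FD (h \<circ> chart_inv d) (snd d p) (FD (snd d \<circ> chart_inv c) (snd c p) a)"
    by (auto simp: differentiable_def FD_eqI)
qed

lemma transition_cocycle:
  assumes "smooth_atlas M" "c \<in> charts_at M p" "d \<in> charts_at M p" "e \<in> charts_at M p"
  shows "FD (snd e \<circ> chart_inv d) (snd d p) (FD (snd d \<circ> chart_inv c) (snd c p) a) =
           FD (snd e \<circ> chart_inv c) (snd c p) a"
  by (rule FD_change_chart(2)[OF assms(1-3), symmetric])
    (rule smooth_on_differentiable[OF overlap_at(3,2)[OF assms(1,3,4)]])

lemma transition_self:
  assumes "smooth_atlas M" "c \<in> charts_at M p"
  shows "FD (snd c \<circ> chart_inv c) (snd c p) a = a"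
proof -
  have "FD (snd c \<circ> chart_inv c) (snd c p) = FD (\<lambda>x. x) (snd c p)"
    using assms atlas_open[OF assms(1)]
    by (intro FD_cong_open[where S = "snd c ` fst c"]) (auto simp: charts_at_def chart_chart_inv)
  then show ?thesis by simp
qed

lemma transition_linear:
  assumes "smooth_atlas M" "c \<in> charts_at M p" "d \<in> charts_at M p"
  shows "linear (FD (snd d \<circ> chart_inv c) (snd c p))"
  by (rule smooth_on_linear_FD[OF overlap_at(3,2)[OF assms]])

lemma tangent_change_chart:
  assumes "v \<in> tangent_space M p" "c \<in> charts_at M p" "d \<in> charts_at M p"
  shows "v d = FD (snd d \<circ> chart_inv c) (snd c p) (v c)"
proof -
  have "\<forall>c\<in>charts_at M p. \<forall>d\<in>charts_at M p. v d = FD (snd d \<circ> chart_inv c) (snd c p) (v c)"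
    using assms(1) unfolding tangent_space_def mem_Collect_eq by (rule conjunct1)
  from this[THEN bspec, OF assms(2), THEN bspec, OF assms(3)] show ?thesis .
qed

lemma tangent_off:
  assumes "v \<in> tangent_space M p" "c \<notin> charts_at M p"
  shows "v c = 0"
proof -
  have "\<forall>c. c \<notin> charts_at M p \<longrightarrow> v c = 0"
    using assms(1) unfolding tangent_space_def mem_Collect_eq by (rule conjunct2)
  from this[THEN spec, THEN mp, OF assms(2)] show ?thesis .
qed

lemma tangent_spaceI:
  assumes "\<And>c d. c \<in> charts_at M p \<Longrightarrow> d \<in> charts_at M p \<Longrightarrow>
      v d = FD (snd d \<circ> chart_inv c) (snd c p) (v c)"
    and "\<And>c. c \<notin> charts_at M p \<Longrightarrow> v c = 0"
  shows "v \<in> tangent_space M p"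
  unfolding tangent_space_def mem_Collect_eq
  by (intro conjI ballI allI impI) (erule (1) assms(1), erule assms(2))

lemma coord_vector_tangent:
  assumes "smooth_atlas M" "c \<in> charts_at M p"
  shows "coord_vector M c p a \<in> tangent_space M p"
  by (rule tangent_spaceI) (simp_all add: coord_vector_def transition_cocycle[OF assms])

lemma coord_vector_self:
  assumes "smooth_atlas M" "c \<in> charts_at M p"
  shows "coord_vector M c p a c = a"
  using assms transition_self[OF assms] by (simp add: coord_vector_def)

lemma coord_vector_other:
  "d \<in> charts_at M p \<Longrightarrow> coord_vector M c p a d = FD (snd d \<circ> chart_inv c) (snd c p) a"
  by (simp add: coord_vector_def)

text \<open>Computations with tangent vectors reduce to a single chart, which can be chosen freely at each
  point.\<close>

lemma tangent_eq_coord_vector: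
  assumes "v \<in> tangent_space M p" "c \<in> charts_at M p"
  shows "v = coord_vector M c p (v c)"
proof
  fix d
  show "v d = coord_vector M c p (v c) d"
  proof (cases "d \<in> charts_at M p")
    case True
    show ?thesis
      unfolding coord_vector_other[OF True] by (rule tangent_change_chart[OF assms True])
  next
    case False
    then show ?thesis
      using tangent_off[OF assms(1)] by (simp add: coord_vector_def)
  qed
qed

lemma tangent_eqI:
  assumes "v \<in> tangent_space M p" "w \<in> tangent_space M p" "c \<in> charts_at M p" "v c = w c"
  shows "v = w"
  using tangent_eq_coord_vector[OF assms(1,3)] tangent_eq_coord_vector[OF assms(2,3)] assms(4) by simp

lemma tangent_space_add:
  assumes M: "smooth_atlas M" and v: "v \<in> tangent_space M p" and w: "w \<in> tangent_space M p"
  shows "(\<lambda>c. v c + w c) \<in> tangent_space M p"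
proof (rule tangent_spaceI)
  fix c d assume cd: "c \<in> charts_at M p" "d \<in> charts_at M p"
  show "v d + w d = FD (snd d \<circ> chart_inv c) (snd c p) (v c + w c)"
    unfolding linear_add[OF transition_linear[OF M cd]]
    by (rule arg_cong2[where f = "(+)"]; rule tangent_change_chart; fact v w cd)
qed (simp add: tangent_off[OF v] tangent_off[OF w])

lemma tangent_space_scale:
  assumes M: "smooth_atlas M" and v: "v \<in> tangent_space M p"
  shows "(\<lambda>c. r *\<^sub>R v c) \<in> tangent_space M p"
proof (rule tangent_spaceI)
  fix c d assume cd: "c \<in> charts_at M p" "d \<in> charts_at M p"
  show "r *\<^sub>R v d = FD (snd d \<circ> chart_inv c) (snd c p) (r *\<^sub>R v c)"
    unfolding linear_cmul[OF transition_linear[OF M cd]]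
    by (rule arg_cong[where f = "(*\<^sub>R) r"]) (rule tangent_change_chart[OF v cd])
qed (simp add: tangent_off[OF v])

lemma tangent_space_zero:
  assumes M: "smooth_atlas M"
  shows "(\<lambda>c. 0) \<in> tangent_space M p"
  by (rule tangent_spaceI) (simp_all add: linear_0[OF transition_linear[OF M]])

lemma coord_vector_add:
  assumes "smooth_atlas M" "c \<in> charts_at M p"
  shows "coord_vector M c p (a + b) = (\<lambda>d. coord_vector M c p a d + coord_vector M c p b d)"
  using linear_add[OF transition_linear[OF assms]] by (auto simp: coord_vector_def fun_eq_iff)

lemma coord_vector_scale:
  assumes "smooth_atlas M" "c \<in> charts_at M p"
  shows "coord_vector M c p (r *\<^sub>R a) = (\<lambda>d. r *\<^sub>R coord_vector M c p a d)"
  using linear_cmul[OF transition_linear[OF assms]] by (auto simp: coord_vector_def fun_eq_iff)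

lemma linear_at_coord:
  assumes M: "smooth_atlas M" and c: "c \<in> charts_at M p" and lin: "linear_at M p \<alpha>"
  shows "linear (\<lambda>a. \<alpha> (coord_vector M c p a))"
  using lin coord_vector_tangent[OF M c]
  by (intro linearI) (auto simp: coord_vector_add[OF M c] coord_vector_scale[OF M c] linear_at_def)

text \<open>Since addition and scaling of tangent vectors are pointwise, linearity of a functional can be read
  off from its expression in one chart.\<close>

lemma linear_atI:
  assumes "linear g" "\<And>v. v \<in> tangent_space M p \<Longrightarrow> \<alpha> v = g (v c)" "smooth_atlas M"
  shows "linear_at M p \<alpha>"
  using assms tangent_space_add[OF assms(3)] tangent_space_scale[OF assms(3)]
  by (auto simp: linear_at_def linear_add linear_cmul)

lemma differential_eq:
  assumes "smooth_atlas M" "v \<in> tangent_space M p" "c \<in> charts_at M p"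
    and "(g \<circ> chart_inv c) differentiable at (snd c p)"
  shows "differential M g p v = FD (g \<circ> chart_inv c) (snd c p) (v c)"
proof -
  let ?c = "chart_at M p"
  have c: "?c \<in> charts_at M p" by (rule chart_at_in[OF charts_at_carrier[OF assms(3)]])
  have "FD (g \<circ> chart_inv ?c) (snd ?c p) (v ?c) =
      FD (g \<circ> chart_inv c) (snd c p) (FD (snd c \<circ> chart_inv ?c) (snd ?c p) (v ?c))"
    by (rule FD_change_chart(2)[OF assms(1) c assms(3,4)])
  also have "FD (snd c \<circ> chart_inv ?c) (snd ?c p) (v ?c) = v c"
    using tangent_change_chart[OF assms(2) c assms(3)] by simp
  finally show ?thesis unfolding differential_def Let_def .
qed

subsection \<open>Smooth maps in charts\<close>

lemma smooth_map_on_rep: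
  assumes "smooth_map_on M N W f" "c \<in> M" "d \<in> N"
  shows "open (snd c ` {p \<in> fst c \<inter> W. f p \<in> fst d})"
    "smooth_on (snd c ` {p \<in> fst c \<inter> W. f p \<in> fst d}) (snd d \<circ> f \<circ> chart_inv c)"
  using assms by (auto simp: smooth_map_on_def Let_def)

lemma smooth_map_on_at:
  assumes "smooth_map_on M N W f" "p \<in> W" "c \<in> charts_at M p" "d \<in> charts_at N (f p)"
  shows "(snd d \<circ> f \<circ> chart_inv c) differentiable at (snd c p)"
  using assms smooth_map_on_rep[OF assms(1), of c d]
  by (intro smooth_on_differentiable) (auto simp: charts_at_def)

lemma tangent_map_rep:
  assumes M: "smooth_atlas M" and f: "smooth_map_on M N W f" "p \<in> W" and v: "v \<in> tangent_space M p"
    and c: "c \<in> charts_at M p" and d: "d \<in> charts_at N (f p)"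
  shows "tangent_map M N f p v d = FD (snd d \<circ> f \<circ> chart_inv c) (snd c p) (v c)"
  using differential_eq[OF M v c smooth_map_on_at[OF f c d]] d by (simp add: tangent_map_def)

lemma tangent_map_tangent:
  assumes M: "smooth_atlas M" and N: "smooth_atlas N" and f: "smooth_map_on M N W f" "p \<in> W"
    and v: "v \<in> tangent_space M p"
  shows "tangent_map M N f p v \<in> tangent_space N (f p)"
proof -
  have "p \<in> carrier M" using f by (auto simp: smooth_map_on_def)
  then obtain c where c: "c \<in> charts_at M p" by (rule carrier_chartE)
  note cp = chart_image_at[OF M c]
  have "tangent_map M N f p v e = FD (snd e \<circ> chart_inv d) (snd d (f p)) (tangent_map M N f p v d)"
    if d: "d \<in> charts_at N (f p)" and e: "e \<in> charts_at N (f p)" for d e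
  proof -
    let ?V = "snd c ` {p \<in> fst c \<inter> W. f p \<in> fst d}" and ?t = "snd e \<circ> chart_inv d"
    have V: "open ?V" "snd c p \<in> ?V"
      using smooth_map_on_rep[OF f(1)] c d f(2) by (auto simp: charts_at_def)
    have inj: "inj_on (snd c) (fst c)" "inj_on (snd d) (fst d)"
      using c d atlas_inj[OF M] atlas_inj[OF N] by (auto simp: charts_at_def)
    have "FD (snd e \<circ> f \<circ> chart_inv c) (snd c p) = FD (\<lambda>x. ?t ((snd d \<circ> f \<circ> chart_inv c) x)) (snd c p)"
      using inj by (intro FD_cong_open[OF V]) (auto simp: chart_inv_chart)
    then have "FD (snd e \<circ> f \<circ> chart_inv c) (snd c p) (v c) =
        FD ?t (snd d (f p)) (FD (snd d \<circ> f \<circ> chart_inv c) (snd c p) (v c))"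
      using FD_compose[OF smooth_map_on_at[OF f c d], of ?t "v c"] cp
        smooth_on_differentiable[OF overlap_at(3,2)[OF N d e]] by simp
    then show ?thesis
      by (simp add: tangent_map_rep[OF M f v c d] tangent_map_rep[OF M f v c e])
  qed
  then show ?thesis
    by (rule tangent_spaceI) (simp_all add: tangent_map_def)
qed

text \<open>Smoothness may be checked in one pair of charts near each point, because chart transitions
  are smooth.\<close>

lemma smooth_map_onI:
  fixes M :: "('a, 'e::euclidean_space) chart set" and N :: "('b, 'f::euclidean_space) chart set"
  assumes M: "smooth_atlas M" and N: "smooth_atlas N"
    and W: "W \<subseteq> carrier M"
    and loc: "\<And>p. p \<in> W \<Longrightarrow> \<exists>c\<in>charts_at M p. \<exists>d\<in>charts_at N (f p). \<exists>V. open V \<and> snd c p \<in> V \<and>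
       V \<subseteq> snd c ` {q \<in> fst c \<inter> W. f q \<in> fst d} \<and> smooth_on V (snd d \<circ> f \<circ> chart_inv c)"
  shows "smooth_map_on M N W f"
proof -
  have local: "\<exists>T. open T \<and> x \<in> T \<and> T \<subseteq> snd c' ` {p \<in> fst c' \<inter> W. f p \<in> fst d'} \<and>
      smooth_on T (snd d' \<circ> f \<circ> chart_inv c')"
    if c': "c' \<in> M" and d': "d' \<in> N" and x: "x \<in> snd c' ` {p \<in> fst c' \<inter> W. f p \<in> fst d'}" for c' d' x
  proof -
    from x obtain p where p: "p \<in> fst c'" "p \<in> W" "f p \<in> fst d'" "x = snd c' p" by auto
    from loc[OF p(2)] obtain c d V where c: "c \<in> charts_at M p" and d: "d \<in> charts_at N (f p)"
      and V: "open V" "snd c p \<in> V" "V \<subseteq> snd c ` {q \<in> fst c \<inter> W. f q \<in> fst d}"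
        "smooth_on V (snd d \<circ> f \<circ> chart_inv c)" by blast
    have cM: "c \<in> M" "p \<in> fst c" and dN: "d \<in> N" "f p \<in> fst d" using c d by (auto simp: charts_at_def)
    note inj = atlas_inj[OF M c'] atlas_inj[OF M cM(1)] atlas_inj[OF N d'] atlas_inj[OF N dN(1)]
    define \<tau> where "\<tau> = snd c \<circ> chart_inv c'"
    define \<psi> where "\<psi> = snd d \<circ> f \<circ> chart_inv c"
    define \<sigma> where "\<sigma> = snd d' \<circ> chart_inv d"
    let ?S = "snd c' ` (fst c' \<inter> fst c)" and ?R = "snd d ` (fst d \<inter> fst d')"
    have S: "open ?S" "smooth_on ?S \<tau>" and R: "open ?R" "smooth_on ?R \<sigma>"
      unfolding \<tau>_def \<sigma>_def
      by (intro atlas_overlap_open[OF M] atlas_transition_smooth[OF M] atlas_overlap_open[OF N]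
          atlas_transition_smooth[OF N] c' cM d' dN)+
    \<comment> \<open>In the given charts the map is \<open>\<sigma> \<circ> \<psi> \<circ> \<tau>\<close> wherever this composition makes sense; \<open>V1\<close> and
      \<open>V2\<close> are the preimages on which it does.\<close>
    define V1 where "V1 = ?S \<inter> \<tau> -` V"
    have V1: "open V1" "smooth_on V1 \<tau>" "\<tau> ` V1 \<subseteq> V" unfolding V1_def
      using continuous_open_preimage[OF smooth_on_continuous_on[OF S(2)] S(1) V(1)]
        smooth_on_subset[OF S(2)] by auto
    have \<psi>\<tau>: "smooth_on V1 (\<lambda>y. \<psi> (\<tau> y))"
      unfolding \<psi>_def by (rule smooth_on_compose[OF V1(1) V(1) V1(3,2) V(4)])
    define V2 where "V2 = V1 \<inter> (\<lambda>y. \<psi> (\<tau> y)) -` ?R"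
    have V2: "open V2" "smooth_on V2 (\<lambda>y. \<psi> (\<tau> y))" "(\<lambda>y. \<psi> (\<tau> y)) ` V2 \<subseteq> ?R" unfolding V2_def
      using continuous_open_preimage[OF smooth_on_continuous_on[OF \<psi>\<tau>] V1(1) R(1)]
        smooth_on_subset[OF \<psi>\<tau>] by auto
    have sm: "smooth_on V2 (\<lambda>y. \<sigma> (\<psi> (\<tau> y)))"
      by (rule smooth_on_compose[OF V2(1) R(1) V2(3,2) R(2)])
    have key: "\<exists>q. q \<in> fst c' \<and> q \<in> W \<and> f q \<in> fst d' \<and> y = snd c' q \<and>
        \<sigma> (\<psi> (\<tau> y)) = (snd d' \<circ> f \<circ> chart_inv c') y" if "y \<in> V2" for y
    proof -
      from that obtain q where q: "q \<in> fst c'" "q \<in> fst c" "y = snd c' q" "\<tau> y \<in> V" "\<psi> (\<tau> y) \<in> ?R"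
        by (auto simp: V1_def V2_def)
      have ty: "\<tau> y = snd c q" using q inj by (simp add: \<tau>_def chart_inv_chart)
      then have "snd c q \<in> snd c ` {q \<in> fst c \<inter> W. f q \<in> fst d}"
        using q(4) V(3) by auto
      then obtain q' where q': "q' \<in> fst c" "q' \<in> W" "f q' \<in> fst d" "snd c q = snd c q'" by auto
      have "q = q'" by (rule inj_onD[OF inj(2) q'(4) q(2) q'(1)])
      then have q2: "q \<in> W" "f q \<in> fst d" using q' by simp_all
      have py: "\<psi> (\<tau> y) = snd d (f q)" using ty q inj by (simp add: \<psi>_def chart_inv_chart)
      then have "f q \<in> fst d'" using q q2 inj_onD[OF inj(4)] by auto
      moreover have "\<sigma> (\<psi> (\<tau> y)) = (snd d' \<circ> f \<circ> chart_inv c') y"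
        using py q q2 inj by (simp add: \<sigma>_def chart_inv_chart)
      ultimately show ?thesis using q q2 by blast
    qed
    have "x \<in> V2"
      using p cM dN V(2) inj by (auto simp: V1_def V2_def \<tau>_def \<psi>_def chart_inv_chart)
    moreover have "V2 \<subseteq> snd c' ` {p \<in> fst c' \<inter> W. f p \<in> fst d'}"
      using key by blast
    moreover have "smooth_on V2 (snd d' \<circ> f \<circ> chart_inv c')"
      using sm key by (subst smooth_on_cong[OF V2(1), where g = "\<lambda>y. \<sigma> (\<psi> (\<tau> y))"]) fastforce+
    ultimately show ?thesis using V2(1) by blast
  qed
  have "open (snd c ` {p \<in> fst c \<inter> W. f p \<in> fst d})" if "c \<in> M" "d \<in> N" for c d
    by (subst open_subopen, rule ballI, drule local[OF that]) blast
  moreover have "smooth_on (snd c ` {p \<in> fst c \<inter> W. f p \<in> fst d}) (snd d \<circ> f \<circ> chart_inv c)"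
    if "c \<in> M" "d \<in> N" for c d
    by (rule smooth_on_local, drule local[OF that]) blast
  moreover have "f ` W \<subseteq> carrier N"
    by (rule image_subsetI, drule loc, elim bexE, rule charts_at_carrier)
  ultimately show ?thesis
    using W by (auto simp: smooth_map_on_def Let_def)
qed

subsection \<open>Product manifolds\<close>

abbreviation prod_chart :: "('a, 'e) chart \<Rightarrow> ('b, 'f) chart \<Rightarrow> ('a \<times> 'b, 'e \<times> 'f) chart" where
  "prod_chart c d \<equiv> (fst c \<times> fst d, map_prod (snd c) (snd d))"

lemma prod_manifold_iff: "k \<in> M \<times>\<^sub>M N \<longleftrightarrow> (\<exists>c\<in>M. \<exists>d\<in>N. k = prod_chart c d)"
  unfolding prod_manifold_def by blast

lemma carrier_prod: "carrier (M \<times>\<^sub>M N) = carrier M \<times> carrier N"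
proof (rule set_eqI)
  fix x :: "'a \<times> 'b"
  have "x \<in> carrier (M \<times>\<^sub>M N) \<longleftrightarrow> (\<exists>c\<in>M. \<exists>d\<in>N. x \<in> fst (prod_chart c d))"
    unfolding carrier_def UN_iff Bex_def prod_manifold_iff by blast
  then show "x \<in> carrier (M \<times>\<^sub>M N) \<longleftrightarrow> x \<in> carrier M \<times> carrier N"
    by (auto simp: carrier_def)
qed

lemma charts_at_prod:
  "k \<in> charts_at (M \<times>\<^sub>M N) p \<longleftrightarrow>
     (\<exists>c\<in>charts_at M (fst p). \<exists>d\<in>charts_at N (snd p). k = prod_chart c d)"
proof -
  have "k \<in> charts_at (M \<times>\<^sub>M N) p \<longleftrightarrow> (\<exists>c\<in>M. \<exists>d\<in>N. k = prod_chart c d \<and> p \<in> fst k)"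
    unfolding charts_at_def prod_manifold_iff by blast
  also have "\<dots> \<longleftrightarrow> (\<exists>c\<in>M. \<exists>d\<in>N. k = prod_chart c d \<and> fst p \<in> fst c \<and> snd p \<in> fst d)"
    by (intro bex_cong refl) (auto simp: mem_Times_iff)
  finally show ?thesis unfolding charts_at_def by blast
qed

lemma chart_inv_prod:
  assumes "inj_on (snd c) (fst c)" "inj_on (snd d) (fst d)" "x \<in> snd c ` fst c" "y \<in> snd d ` fst d"
  shows "chart_inv (prod_chart c d) (x, y) = (chart_inv c x, chart_inv d y)"
proof -
  have inj: "inj_on (map_prod (snd c) (snd d)) (fst c \<times> fst d)"
    using assms(1,2) by (rule map_prod_inj_on)
  have "inv_into (fst c \<times> fst d) (map_prod (snd c) (snd d))
      (map_prod (snd c) (snd d) (chart_inv c x, chart_inv d y)) = (chart_inv c x, chart_inv d y)"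
    using assms by (intro inv_into_f_f[OF inj]) (auto simp: chart_inv_in)
  then show ?thesis
    using assms by (simp add: chart_inv_def[of "prod_chart c d"] chart_chart_inv)
qed

lemma map_prod_image_Int:
  "map_prod f g ` ((A \<times> B) \<inter> (C \<times> D)) = f ` (A \<inter> C) \<times> g ` (B \<inter> D)"
  by (auto simp: Times_Int_Times map_prod_surj_on[OF refl refl])

lemma smooth_on_fst: "smooth_on S fst" and smooth_on_snd: "smooth_on S snd"
  by (auto intro: smooth_on_linear bounded_linear_fst bounded_linear_snd)

lemma smooth_on_map_prod:
  fixes f :: "'a::euclidean_space \<Rightarrow> 'c::euclidean_space"
    and g :: "'b::euclidean_space \<Rightarrow> 'd::euclidean_space"
  assumes "open S" "open T" "smooth_on S f" "smooth_on T g"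
  shows "smooth_on (S \<times> T) (map_prod f g)"
proof -
  have "open (S \<times> T)" using assms by (intro open_Times)
  then have "smooth_on (S \<times> T) (\<lambda>x. (f (fst x), g (snd x)))"
    using assms
    by (intro smooth_on_Pair smooth_on_compose[where f = fst and T = S and g = f]
        smooth_on_compose[where f = snd and T = T and g = g] smooth_on_fst smooth_on_snd) auto
  moreover have "(\<lambda>x. (f (fst x), g (snd x))) = map_prod f g" by auto
  ultimately show ?thesis by simp
qed

lemma smooth_atlas_prod:
  fixes M :: "('a, 'e::euclidean_space) chart set" and N :: "('b, 'f::euclidean_space) chart set"
  assumes M: "smooth_atlas M" and N: "smooth_atlas N"
  shows "smooth_atlas (M \<times>\<^sub>M N)"
  unfolding smooth_atlas_def
proof (intro conjI ballI)
  fix k assume "k \<in> M \<times>\<^sub>M N"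
  then obtain c d where k: "k = prod_chart c d" "c \<in> M" "d \<in> N" by (auto simp: prod_manifold_iff)
  show "inj_on (snd k) (fst k)"
    using k atlas_inj[OF M] atlas_inj[OF N] by (simp add: map_prod_inj_on)
  show "open (snd k ` fst k)"
    using k atlas_open[OF M] atlas_open[OF N] by (simp add: map_prod_surj_on[OF refl refl] open_Times)
  fix k' assume "k' \<in> M \<times>\<^sub>M N"
  then obtain c' d' where k': "k' = prod_chart c' d'" "c' \<in> M" "d' \<in> N" by (auto simp: prod_manifold_iff)
  have ov: "snd k ` (fst k \<inter> fst k') = snd c ` (fst c \<inter> fst c') \<times> snd d ` (fst d \<inter> fst d')"
    using k k' by (simp add: map_prod_image_Int)
  note op = atlas_overlap_open[OF M k(2) k'(2)] atlas_overlap_open[OF N k(3) k'(3)]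
  show op': "open (snd k ` (fst k \<inter> fst k'))"
    unfolding ov using op by (intro open_Times)
  have "smooth_on (snd k ` (fst k \<inter> fst k')) (map_prod (snd c' \<circ> chart_inv c) (snd d' \<circ> chart_inv d))"
    unfolding ov using op k k' M N by (intro smooth_on_map_prod atlas_transition_smooth)
  moreover have "(snd k' \<circ> chart_inv k) x = map_prod (snd c' \<circ> chart_inv c) (snd d' \<circ> chart_inv d) x"
    if "x \<in> snd k ` (fst k \<inter> fst k')" for x
    using that k k' atlas_inj[OF M k(2)] atlas_inj[OF N k(3)]
    by (auto simp: ov chart_inv_prod)
  ultimately show "smooth_on (snd k ` (fst k \<inter> fst k')) (snd k' \<circ> chart_inv k)"
    using smooth_on_cong[OF op'] by blast
qed

lemma prod_chart_image: "snd (prod_chart c d) ` fst (prod_chart c d) = snd c ` fst c \<times> snd d ` fst d"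
  by (simp add: map_prod_surj_on[OF refl refl])

lemma smooth_map_fst:
  assumes M: "smooth_atlas M" and N: "smooth_atlas N"
  shows "smooth_map (M \<times>\<^sub>M N) M fst"
proof (rule smooth_map_onI[OF smooth_atlas_prod[OF M N] M])
  fix p assume "p \<in> carrier (M \<times>\<^sub>M N)"
  then have "fst p \<in> carrier M" "snd p \<in> carrier N" by (auto simp: carrier_prod)
  then obtain c d where cd: "c \<in> charts_at M (fst p)" "d \<in> charts_at N (snd p)"
    by (meson carrier_chartE)
  let ?k = "prod_chart c d"
  have inj: "inj_on (snd c) (fst c)" "inj_on (snd d) (fst d)" and op: "open (snd ?k ` fst ?k)"
    using cd atlas_inj[OF M, of c] atlas_inj[OF N, of d] atlas_open[OF M, of c] atlas_open[OF N, of d]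
    unfolding prod_chart_image by (auto simp: charts_at_def intro!: open_Times)
  have "smooth_on (snd ?k ` fst ?k) (snd c \<circ> fst \<circ> chart_inv ?k)"
    using inj by (subst smooth_on_cong[OF op, where g = fst])
      (auto simp: chart_inv_prod chart_chart_inv intro: smooth_on_fst)
  moreover have "snd ?k ` fst ?k \<subseteq> snd ?k ` {q \<in> fst ?k \<inter> carrier (M \<times>\<^sub>M N). fst q \<in> fst c}"
  proof -
    have "fst c \<subseteq> carrier M" "fst d \<subseteq> carrier N"
      using cd by (auto dest!: charts_atD intro: chart_carrier)
    then show ?thesis by (auto simp: carrier_prod)
  qed
  moreover have k: "?k \<in> charts_at (M \<times>\<^sub>M N) p" using cd by (auto simp: charts_at_prod)
  ultimately show "\<exists>c\<in>charts_at (M \<times>\<^sub>M N) p. \<exists>d\<in>charts_at M (fst p). \<exists>V. open V \<and> snd c p \<in> V \<and>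
       V \<subseteq> snd c ` {q \<in> fst c \<inter> carrier (M \<times>\<^sub>M N). fst q \<in> fst d} \<and> smooth_on V (snd d \<circ> fst \<circ> chart_inv c)"
    by (intro bexI[OF _ k] bexI[OF _ cd(1)] exI[of _ "snd ?k ` fst ?k"] conjI op
        chart_image_at(1)[OF smooth_atlas_prod[OF M N] k])
qed auto

lemma smooth_map_snd:
  assumes M: "smooth_atlas M" and N: "smooth_atlas N"
  shows "smooth_map (M \<times>\<^sub>M N) N snd"
proof (rule smooth_map_onI[OF smooth_atlas_prod[OF M N] N])
  fix p assume "p \<in> carrier (M \<times>\<^sub>M N)"
  then have "fst p \<in> carrier M" "snd p \<in> carrier N" by (auto simp: carrier_prod)
  then obtain c d where cd: "c \<in> charts_at M (fst p)" "d \<in> charts_at N (snd p)"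
    by (meson carrier_chartE)
  let ?k = "prod_chart c d"
  have inj: "inj_on (snd c) (fst c)" "inj_on (snd d) (fst d)" and op: "open (snd ?k ` fst ?k)"
    using cd atlas_inj[OF M, of c] atlas_inj[OF N, of d] atlas_open[OF M, of c] atlas_open[OF N, of d]
    unfolding prod_chart_image by (auto simp: charts_at_def intro!: open_Times)
  have "smooth_on (snd ?k ` fst ?k) (snd d \<circ> snd \<circ> chart_inv ?k)"
    using inj by (subst smooth_on_cong[OF op, where g = snd])
      (auto simp: chart_inv_prod chart_chart_inv intro: smooth_on_snd)
  moreover have "snd ?k ` fst ?k \<subseteq> snd ?k ` {q \<in> fst ?k \<inter> carrier (M \<times>\<^sub>M N). snd q \<in> fst d}"
  proof -
    have "fst c \<subseteq> carrier M" "fst d \<subseteq> carrier N"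
      using cd by (auto dest!: charts_atD intro: chart_carrier)
    then show ?thesis by (auto simp: carrier_prod)
  qed
  moreover have k: "?k \<in> charts_at (M \<times>\<^sub>M N) p" using cd by (auto simp: charts_at_prod)
  ultimately show "\<exists>c\<in>charts_at (M \<times>\<^sub>M N) p. \<exists>d\<in>charts_at N (snd p). \<exists>V. open V \<and> snd c p \<in> V \<and>
       V \<subseteq> snd c ` {q \<in> fst c \<inter> carrier (M \<times>\<^sub>M N). snd q \<in> fst d} \<and> smooth_on V (snd d \<circ> snd \<circ> chart_inv c)"
    by (intro bexI[OF _ k] bexI[OF _ cd(2)] exI[of _ "snd ?k ` fst ?k"] conjI op
        chart_image_at(1)[OF smooth_atlas_prod[OF M N] k])
qed auto

section \<open>Exterior derivatives in coordinates\<close>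

text \<open>Here \<open>A a x\<close> is the value at \<open>x\<close> of a 1-form on the constant vector field \<open>a\<close>, and \<open>B a b x\<close> is
  that of a 2-form on two constant vector fields.  These are the expressions that \<open>ext_deriv1\<close> and
  \<open>ext_deriv2\<close> evaluate in a chart.\<close>

definition local_d1 :: "('e::euclidean_space \<Rightarrow> 'e \<Rightarrow> real) \<Rightarrow> 'e \<Rightarrow> 'e \<Rightarrow> 'e \<Rightarrow> real" where
  "local_d1 A x u v = FD (A v) x u - FD (A u) x v"

definition local_d2 ::
  "('e::euclidean_space \<Rightarrow> 'e \<Rightarrow> 'e \<Rightarrow> real) \<Rightarrow> 'e \<Rightarrow> 'e \<Rightarrow> 'e \<Rightarrow> 'e \<Rightarrow> real" where
  "local_d2 B x u v w = FD (B v w) x u - FD (B u w) x v + FD (B u v) x w"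

lemma local_d2_cong:
  assumes "open U" "x \<in> U" "\<And>a b y. y \<in> U \<Longrightarrow> B a b y = B' a b y"
  shows "local_d2 B x u v w = local_d2 B' x u v w"
proof -
  have "FD (B a b) x = FD (B' a b) x" for a b
    by (rule FD_cong_open[OF assms(1,2)]) (rule assms(3))
  then show ?thesis by (simp add: local_d2_def)
qed

lemma FD_add:
  "smooth_on S f \<Longrightarrow> smooth_on S g \<Longrightarrow> x \<in> S \<Longrightarrow> FD (\<lambda>y. f y + g y) x h = FD f x h + FD g x h"
  using FD_eqI[OF has_derivative_add[OF smooth_on_has_derivative smooth_on_has_derivative]] by metis

lemma FD_diff:
  "smooth_on S f \<Longrightarrow> smooth_on S g \<Longrightarrow> x \<in> S \<Longrightarrow> FD (\<lambda>y. f y - g y) x h = FD f x h - FD g x h"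
  using FD_eqI[OF has_derivative_diff[OF smooth_on_has_derivative smooth_on_has_derivative]] by metis

lemma FD_minus: "smooth_on S f \<Longrightarrow> x \<in> S \<Longrightarrow> FD (\<lambda>y. - f y) x h = - FD f x h"
  using FD_eqI[OF has_derivative_minus[OF smooth_on_has_derivative]] by metis

lemma FD_cmult:
  fixes f :: "'a::real_normed_vector \<Rightarrow> real"
  shows "smooth_on S f \<Longrightarrow> x \<in> S \<Longrightarrow> FD (\<lambda>y. r * f y) x h = r * FD f x h"
  using FD_eqI[OF has_derivative_mult_right[OF smooth_on_has_derivative]] by metis

lemma local_d2_diff:
  assumes "\<And>a b. smooth_on S (B a b)" "\<And>a b. smooth_on S (C a b)" "x \<in> S"
  shows "local_d2 (\<lambda>a b y. B a b y - C a b y) x u v w = local_d2 B x u v w - local_d2 C x u v w"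
  by (simp add: local_d2_def FD_diff[OF assms(1,2,3)])

lemma local_d2_minus:
  assumes "\<And>a b. smooth_on S (B a b)" "x \<in> S"
  shows "local_d2 (\<lambda>a b y. - B a b y) x u v w = - local_d2 B x u v w"
  by (simp add: local_d2_def FD_minus[OF assms])

lemma linear_family_FD:
  fixes A :: "'b::real_vector \<Rightarrow> 'a::euclidean_space \<Rightarrow> real"
  assumes "open S" "x \<in> S" "\<And>y. y \<in> S \<Longrightarrow> linear (\<lambda>b. A b y)" "\<And>b. smooth_on S (A b)"
  shows "linear (\<lambda>b. FD (A b) x h)"
proof (rule linearI)
  show "FD (A (b + b')) x h = FD (A b) x h + FD (A b') x h" for b b'
    using FD_cong_open[OF assms(1,2), of "A (b + b')" "\<lambda>y. A b y + A b' y"]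
      linear_add[OF assms(3)] FD_add[OF assms(4,4,2)] by simp
  show "FD (A (r *\<^sub>R b)) x h = r *\<^sub>R FD (A b) x h" for r b
    using FD_cong_open[OF assms(1,2), of "A (r *\<^sub>R b)" "\<lambda>y. r * A b y"]
      linear_cmul[OF assms(3)] FD_cmult[OF assms(4,2)] by simp
qed

text \<open>Leibniz rule for a family of covectors \<open>A\<close>, pulled back along \<open>\<psi>\<close> and evaluated on a vector field
  \<open>s\<close> along \<open>\<psi>\<close>.  The pullback formulas below use it with \<open>s\<close> the image of a constant field under
  the derivative of \<open>\<psi>\<close>.\<close>

lemma FD_linear_family:
  fixes A :: "'b::euclidean_space \<Rightarrow> 'c::euclidean_space \<Rightarrow> real" and \<psi> :: "'a::euclidean_space \<Rightarrow> 'c"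
  assumes U: "open U" "x \<in> U" and V: "open V" and \<psi>: "smooth_on U \<psi>" "\<psi> ` U \<subseteq> V"
    and A: "\<And>b. smooth_on V (A b)" "\<And>y. y \<in> V \<Longrightarrow> linear (\<lambda>b. A b y)"
    and s: "smooth_on U s"
  shows "FD (\<lambda>y. A (s y) (\<psi> y)) x h = A (FD s x h) (\<psi> x) + FD (A (s x)) (\<psi> x) (FD \<psi> x h)"
proof -
  have px: "\<psi> x \<in> V" using U \<psi> by auto
  have "A (s y) (\<psi> y) = (\<Sum>i\<in>Basis. (s y \<bullet> i) *\<^sub>R A i (\<psi> y))" if "y \<in> U" for y
    using \<psi>(2) that by (intro linear_basis_sum[OF A(2)]) auto
  then have "FD (\<lambda>y. A (s y) (\<psi> y)) x = FD (\<lambda>y. \<Sum>i\<in>Basis. (s y \<bullet> i) *\<^sub>R A i (\<psi> y)) x"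
    by (rule FD_cong_open[OF U])
  also have "\<dots> = (\<lambda>h. \<Sum>i\<in>Basis. (s x \<bullet> i) *\<^sub>R FD (A i) (\<psi> x) (FD \<psi> x h) + (FD s x h \<bullet> i) *\<^sub>R A i (\<psi> x))"
    by (intro FD_eqI has_derivative_sum has_derivative_scaleR
        bounded_linear.has_derivative[OF bounded_linear_inner_left] smooth_on_has_derivative[OF s U(2)]
        has_derivative_compose[OF smooth_on_has_derivative[OF \<psi>(1) U(2)] smooth_on_has_derivative[OF A(1) px]])
  finally have "FD (\<lambda>y. A (s y) (\<psi> y)) x h =
      (\<Sum>i\<in>Basis. (s x \<bullet> i) *\<^sub>R FD (A i) (\<psi> x) (FD \<psi> x h)) + (\<Sum>i\<in>Basis. (FD s x h \<bullet> i) *\<^sub>R A i (\<psi> x))"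
    by (simp add: sum.distrib)
  moreover have "FD (A (s x)) (\<psi> x) (FD \<psi> x h) = (\<Sum>i\<in>Basis. (s x \<bullet> i) *\<^sub>R FD (A i) (\<psi> x) (FD \<psi> x h))"
    by (rule linear_basis_sum[OF linear_family_FD[OF V px A(2,1)]])
  moreover have "A (FD s x h) (\<psi> x) = (\<Sum>i\<in>Basis. (FD s x h \<bullet> i) *\<^sub>R A i (\<psi> x))"
    by (rule linear_basis_sum[OF A(2)[OF px]])
  ultimately show ?thesis by simp
qed

text \<open>Naturality: differentiating the coefficients of the pullback produces extra terms with the
  second derivative of \<open>\<psi>\<close>, and these cancel by symmetry.\<close>

lemma local_d1_pullback:
  fixes \<psi> :: "'a::euclidean_space \<Rightarrow> 'c::euclidean_space"
  assumes U: "open U" "x \<in> U" and V: "open V" and \<psi>: "smooth_on U \<psi>" "\<psi> ` U \<subseteq> V"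
    and A: "\<And>b. smooth_on V (A b)" "\<And>y. y \<in> V \<Longrightarrow> linear (\<lambda>b. A b y)"
    and E: "\<And>a y. y \<in> U \<Longrightarrow> E a y = A (FD \<psi> y a) (\<psi> y)"
  shows "local_d1 E x u v = local_d1 A (\<psi> x) (FD \<psi> x u) (FD \<psi> x v)"
proof -
  have "FD (E a) x h = A (FD (\<lambda>y. FD \<psi> y a) x h) (\<psi> x) + FD (A (FD \<psi> x a)) (\<psi> x) (FD \<psi> x h)" for a h
    using FD_linear_family[OF U V \<psi> A smooth_on_FD[OF \<psi>(1)], of a h] FD_cong_open[OF U E] by simp
  then show ?thesis
    using second_derivative_symmetric[OF U \<psi>(1), of u v] by (simp add: local_d1_def)
qed

lemma local_d2_pullback:
  fixes \<psi> :: "'a::euclidean_space \<Rightarrow> 'c::euclidean_space"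
  assumes U: "open U" "x \<in> U" and V: "open V" and \<psi>: "smooth_on U \<psi>" "\<psi> ` U \<subseteq> V"
    and B: "\<And>a b. smooth_on V (B a b)" "\<And>b y. y \<in> V \<Longrightarrow> linear (\<lambda>a. B a b y)"
      "\<And>a y. y \<in> V \<Longrightarrow> linear (\<lambda>b. B a b y)" and alt: "\<And>a y. y \<in> V \<Longrightarrow> B a a y = 0"
    and E: "\<And>a b y. y \<in> U \<Longrightarrow> E a b y = B (FD \<psi> y a) (FD \<psi> y b) (\<psi> y)"
  shows "local_d2 E x u v w = local_d2 B (\<psi> x) (FD \<psi> x u) (FD \<psi> x v) (FD \<psi> x w)"
proof -
  have px: "\<psi> x \<in> V" using U \<psi> by auto
  have D: "FD (E a b) x h = B (FD (\<lambda>y. FD \<psi> y a) x h) (FD \<psi> x b) (\<psi> x) +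
      B (FD \<psi> x a) (FD (\<lambda>y. FD \<psi> y b) x h) (\<psi> x) +
      FD (B (FD \<psi> x a) (FD \<psi> x b)) (\<psi> x) (FD \<psi> x h)" for a b h
  proof -
    \<comment> \<open>The Leibniz rule is applied to one argument of \<open>B\<close> at a time: \<open>?C\<close> is the family of covectors that
      remains when the second argument has been filled in.\<close>
    let ?C = "\<lambda>c y. B c (FD \<psi> y b) (\<psi> y)"
    have comp: "smooth_on U (\<lambda>y. B c d (\<psi> y))" for c d
      by (rule smooth_on_compose[OF U(1) V \<psi>(2,1) B(1)])
    have C: "smooth_on U (?C c)" for c
      using \<psi>(2) by (intro smooth_on_linear_family[OF U(1) _ comp smooth_on_FD[OF \<psi>(1)]] B(3)) auto
    have "FD (E a b) x h = FD (\<lambda>y. ?C (FD \<psi> y a) y) x h"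
      by (subst FD_cong_open[OF U E], assumption) (rule refl)
    also have "FD (\<lambda>y. ?C (FD \<psi> y a) y) x h =
        ?C (FD (\<lambda>y. FD \<psi> y a) x h) x + FD (?C (FD \<psi> x a)) x (FD (\<lambda>y. y) x h)"
      using \<psi>(2)
      by (intro FD_linear_family[OF U U(1) smooth_on_linear[OF bounded_linear_ident] _ C _
            smooth_on_FD[OF \<psi>(1)]] B(2)) auto
    also have "FD (?C (FD \<psi> x a)) x (FD (\<lambda>y. y) x h) = B (FD \<psi> x a) (FD (\<lambda>y. FD \<psi> y b) x h) (\<psi> x) +
        FD (B (FD \<psi> x a) (FD \<psi> x b)) (\<psi> x) (FD \<psi> x h)"
      using FD_linear_family[OF U V \<psi> B(1,3) smooth_on_FD[OF \<psi>(1)]] by simp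
    finally show ?thesis by simp
  qed
  have skew: "B a b (\<psi> x) = - B b a (\<psi> x)" for a b
    using alt[OF px, of "a + b"] alt[OF px, of a] alt[OF px, of b]
    by (simp add: linear_add[OF B(2)[OF px]] linear_add[OF B(3)[OF px]])
  show ?thesis
    unfolding local_d2_def D
    using second_derivative_symmetric[OF U \<psi>(1), of u v] second_derivative_symmetric[OF U \<psi>(1), of u w]
      second_derivative_symmetric[OF U \<psi>(1), of v w]
      skew[of "FD (\<lambda>y. FD \<psi> y u) x w" "FD \<psi> x v"] skew[of "FD (\<lambda>y. FD \<psi> y v) x w" "FD \<psi> x u"]
    by simp
qed

text \<open>This is \<open>d \<circ> d = 0\<close>: the six second derivatives cancel in pairs.\<close>

lemma local_d2_local_d1:
  assumes U: "open U" "x \<in> U" and A: "\<And>b. smooth_on U (A b)"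
  shows "local_d2 (\<lambda>a b y. local_d1 A y a b) x u v w = 0"
  unfolding local_d2_def local_d1_def
  using second_derivative_symmetric[OF U A]
  by (simp add: FD_diff[OF smooth_on_FD[OF A] smooth_on_FD[OF A] U(2)])

section \<open>Forms on manifolds\<close>

lemma form1_coord:
  assumes "v \<in> tangent_space M p" "c \<in> charts_at M p" "smooth_atlas M"
  shows "\<alpha> p v = coord_form1 M c \<alpha> (v c) (snd c p)"
  using tangent_eq_coord_vector[OF assms(1,2)] chart_image_at[OF assms(3,2)]
  by (simp add: coord_form1_def)

lemma form2_coord:
  assumes "u \<in> tangent_space M p" "v \<in> tangent_space M p" "c \<in> charts_at M p" "smooth_atlas M"
  shows "\<beta> p u v = coord_form2 M c \<beta> (u c) (v c) (snd c p)"
  using tangent_eq_coord_vector[OF assms(1,3)] tangent_eq_coord_vector[OF assms(2,3)]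
    chart_image_at[OF assms(4,3)]
  by (simp add: coord_form2_def)

lemma one_form_coord:
  assumes M: "smooth_atlas M" and "one_form M \<alpha>" "c \<in> M"
  shows "smooth_on (snd c ` fst c) (coord_form1 M c \<alpha> a)"
    and "x \<in> snd c ` fst c \<Longrightarrow> linear (\<lambda>a. coord_form1 M c \<alpha> a x)"
  using assms chart_inv_carrier[OF assms(3)] linear_at_coord[OF M chart_inv_charts_at[OF assms(3)]]
  by (auto simp: one_form_def coord_form1_def)

lemma two_form_coord:
  assumes M: "smooth_atlas M" and \<beta>: "two_form M \<beta>" and c: "c \<in> M"
  shows "smooth_on (snd c ` fst c) (coord_form2 M c \<beta> a b)"
    and "x \<in> snd c ` fst c \<Longrightarrow> linear (\<lambda>a. coord_form2 M c \<beta> a b x)"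
    and "x \<in> snd c ` fst c \<Longrightarrow> linear (\<lambda>b. coord_form2 M c \<beta> a b x)"
    and "x \<in> snd c ` fst c \<Longrightarrow> coord_form2 M c \<beta> a a x = 0"
proof -
  show "smooth_on (snd c ` fst c) (coord_form2 M c \<beta> a b)"
    using \<beta> c by (simp add: two_form_def)
  assume x: "x \<in> snd c ` fst c"
  let ?p = "chart_inv c x"
  note cx = chart_inv_charts_at[OF c x]
  have t: "coord_vector M c ?p a \<in> tangent_space M ?p" for a
    by (rule coord_vector_tangent[OF M cx])
  have "linear_at M ?p (\<beta> ?p u)" "linear_at M ?p (\<lambda>v. \<beta> ?p v u)" "\<beta> ?p u u = 0"
    if "u \<in> tangent_space M ?p" for u
    using \<beta> chart_inv_carrier[OF c x] that by (auto simp: two_form_def)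
  from this[OF t]
  show "linear (\<lambda>a. coord_form2 M c \<beta> a b x)" "linear (\<lambda>b. coord_form2 M c \<beta> a b x)"
    "coord_form2 M c \<beta> a a x = 0"
    using linear_at_coord[OF M cx] by (auto simp: coord_form2_def)
qed

lemma two_formI:
  assumes M: "smooth_atlas M"
    and "\<And>c a b. c \<in> M \<Longrightarrow> smooth_on (snd c ` fst c) (coord_form2 M c \<beta> a b)"
    and B: "\<And>c b x. c \<in> M \<Longrightarrow> x \<in> snd c ` fst c \<Longrightarrow> linear (\<lambda>a. coord_form2 M c \<beta> a b x)"
      "\<And>c a x. c \<in> M \<Longrightarrow> x \<in> snd c ` fst c \<Longrightarrow> linear (\<lambda>b. coord_form2 M c \<beta> a b x)"
      "\<And>c a x. c \<in> M \<Longrightarrow> x \<in> snd c ` fst c \<Longrightarrow> coord_form2 M c \<beta> a a x = 0"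
  shows "two_form M \<beta>"
proof -
  have "linear_at M p (\<beta> p u) \<and> linear_at M p (\<lambda>v. \<beta> p v u) \<and> \<beta> p u u = 0"
    if p: "p \<in> carrier M" and u: "u \<in> tangent_space M p" for p u
  proof -
    obtain c where c: "c \<in> charts_at M p" using p by (rule carrier_chartE)
    note c' = charts_at_mem(1,3)[OF c]
    have "linear_at M p (\<beta> p u)"
      by (rule linear_atI[OF B(2)[OF c', of "u c"] form2_coord[OF u _ c M] M])
    moreover have "linear_at M p (\<lambda>v. \<beta> p v u)"
      by (rule linear_atI[OF B(1)[OF c', of "u c"] form2_coord[OF _ u c M] M])
    ultimately show ?thesis
      using B(3)[OF c'] form2_coord[OF u u c M, of \<beta>] by simp
  qed
  then show ?thesis using assms(2) by (simp add: two_form_def)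
qed

lemma coord_form1_change:
  assumes M: "smooth_atlas M" and c: "c \<in> M" and d: "d \<in> M" and x: "x \<in> snd c ` (fst c \<inter> fst d)"
  shows "coord_form1 M c \<alpha> a x =
    coord_form1 M d \<alpha> (FD (snd d \<circ> chart_inv c) x a) ((snd d \<circ> chart_inv c) x)"
proof -
  let ?p = "chart_inv c x"
  have x': "x \<in> snd c ` fst c" using x by auto
  have cp: "c \<in> charts_at M ?p" by (rule chart_inv_charts_at[OF c x'])
  have dp: "d \<in> charts_at M ?p"
    using x d atlas_inj[OF M c] by (auto simp: charts_at_def chart_inv_chart)
  show ?thesis
    unfolding coord_form1_def[of M c]
    using form1_coord[OF coord_vector_tangent[OF M cp] dp M, of \<alpha>] coord_vector_other[OF dp, of c]
      chart_chart_inv[OF x'] by simp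
qed

text \<open>Naturality of \<open>d\<close> under the transition from the chart chosen at \<open>p\<close> to \<open>c\<close>.  This is what allows
  \<open>d\<alpha>\<close> to be differentiated: its definition picks a chart at each point separately, but its
  coefficients in \<open>c\<close> are given by one formula on the whole domain of \<open>c\<close>.\<close>

lemma ext_deriv1_chart:
  assumes M: "smooth_atlas M" and \<alpha>: "one_form M \<alpha>" and c: "c \<in> charts_at M p"
    and v: "v \<in> tangent_space M p" and w: "w \<in> tangent_space M p"
  shows "ext_deriv1 M \<alpha> p v w = local_d1 (coord_form1 M c \<alpha>) (snd c p) (v c) (w c)"
proof -
  let ?k = "chart_at M p"
  have k: "?k \<in> charts_at M p" by (rule chart_at_in[OF charts_at_carrier[OF c]])
  note kM = charts_at_mem(1)[OF k] charts_at_mem(1)[OF c]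
  let ?\<psi> = "snd c \<circ> chart_inv ?k"
  have "?\<psi> ` (snd ?k ` (fst ?k \<inter> fst c)) \<subseteq> snd c ` fst c"
    using atlas_inj[OF M kM(1)] by (auto simp: chart_inv_chart)
  then have "local_d1 (coord_form1 M ?k \<alpha>) (snd ?k p) (v ?k) (w ?k) =
      local_d1 (coord_form1 M c \<alpha>) (?\<psi> (snd ?k p)) (FD ?\<psi> (snd ?k p) (v ?k)) (FD ?\<psi> (snd ?k p) (w ?k))"
    by (intro local_d1_pullback[OF overlap_at(1,2)[OF M k c] atlas_open[OF M kM(2)]
          overlap_at(3)[OF M k c]] one_form_coord[OF M \<alpha> kM(2)] coord_form1_change[OF M kM])
  then show ?thesis
    using tangent_change_chart[OF v k c] tangent_change_chart[OF w k c] chart_image_at(2)[OF M k]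
    by (simp add: ext_deriv1_def Let_def local_d1_def)
qed

lemma coord_ext_deriv1:
  assumes M: "smooth_atlas M" and \<alpha>: "one_form M \<alpha>" and c: "c \<in> M" and x: "x \<in> snd c ` fst c"
  shows "coord_form2 M c (ext_deriv1 M \<alpha>) a b x = local_d1 (coord_form1 M c \<alpha>) x a b"
proof -
  note cp = chart_inv_charts_at[OF c x]
  show ?thesis
    unfolding coord_form2_def
      ext_deriv1_chart[OF M \<alpha> cp coord_vector_tangent[OF M cp] coord_vector_tangent[OF M cp]]
    by (simp add: coord_vector_self[OF M cp] chart_chart_inv[OF x])
qed

lemma ext_deriv2_eq_local_d2:
  "ext_deriv2 M \<beta> p u v w = local_d2 (coord_form2 M (chart_at M p) \<beta>) (snd (chart_at M p) p)
     (u (chart_at M p)) (v (chart_at M p)) (w (chart_at M p))"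
  by (simp add: ext_deriv2_def local_d2_def Let_def)

definition closed_two_form :: "('a, 'e::euclidean_space) chart set \<Rightarrow> ('a, 'e) form2 \<Rightarrow> bool" where
  "closed_two_form M \<beta> \<longleftrightarrow> (\<forall>p\<in>carrier M. \<forall>u\<in>tangent_space M p. \<forall>v\<in>tangent_space M p.
     \<forall>w\<in>tangent_space M p. ext_deriv2 M \<beta> p u v w = 0)"

text \<open>The coefficients of a form are its values on tangent vectors at nearby points, so agreement on all
  tangent vectors is enough.\<close>

lemma ext_deriv2_cong:
  assumes M: "smooth_atlas M" and p: "p \<in> carrier M"
    and eq: "\<And>p u v. p \<in> carrier M \<Longrightarrow> u \<in> tangent_space M p \<Longrightarrow> v \<in> tangent_space M p \<Longrightarrow> \<beta> p u v = \<gamma> p u v"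
  shows "ext_deriv2 M \<beta> p u v w = ext_deriv2 M \<gamma> p u v w"
proof -
  let ?c = "chart_at M p"
  have c: "?c \<in> charts_at M p" by (rule chart_at_in[OF p])
  note cM = charts_at_mem(1,3)[OF c]
  have "coord_form2 M ?c \<beta> a b x = coord_form2 M ?c \<gamma> a b x" if "x \<in> snd ?c ` fst ?c" for a b x
    unfolding coord_form2_def
    by (intro eq chart_inv_carrier[OF cM(1) that] coord_vector_tangent[OF M]
        chart_inv_charts_at[OF cM(1) that])
  then show ?thesis
    unfolding ext_deriv2_eq_local_d2 by (rule local_d2_cong[OF atlas_open[OF M cM(1)] cM(2)])
qed

lemma two_form_ext_deriv1:
  assumes M: "smooth_atlas M" and \<alpha>: "one_form M \<alpha>"
  shows "two_form M (ext_deriv1 M \<alpha>)"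
proof (rule two_formI[OF M])
  fix c a b assume c: "c \<in> M"
  note op = atlas_open[OF M c] and A = one_form_coord[OF M \<alpha> c]
  show "smooth_on (snd c ` fst c) (coord_form2 M c (ext_deriv1 M \<alpha>) a b)"
    by (rule smooth_on_cong[THEN iffD2, OF op coord_ext_deriv1[OF M \<alpha> c]], assumption, unfold local_d1_def)
      (intro smooth_on_diff[OF op] smooth_on_FD A)
  fix x assume x: "x \<in> snd c ` fst c"
  have "linear (\<lambda>b. FD (coord_form1 M c \<alpha> b) x a)" for a
    by (rule linear_family_FD[OF op x A(2,1)])
  moreover have "linear (FD (coord_form1 M c \<alpha> b) x)" for b
    by (rule smooth_on_linear_FD[OF A(1) x])
  ultimately show "linear (\<lambda>a. coord_form2 M c (ext_deriv1 M \<alpha>) a b x)"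
    "linear (\<lambda>b. coord_form2 M c (ext_deriv1 M \<alpha>) a b x)"
    unfolding coord_ext_deriv1[OF M \<alpha> c x] local_d1_def by (auto intro!: linear_compose_sub)
  show "coord_form2 M c (ext_deriv1 M \<alpha>) a a x = 0"
    unfolding coord_ext_deriv1[OF M \<alpha> c x] local_d1_def by simp
qed

lemma closed_ext_deriv1:
  assumes M: "smooth_atlas M" and \<alpha>: "one_form M \<alpha>"
  shows "closed_two_form M (ext_deriv1 M \<alpha>)"
  unfolding closed_two_form_def
proof (intro ballI)
  fix p u v w assume p: "p \<in> carrier M"
  let ?c = "chart_at M p"
  note c = charts_at_mem(1,3)[OF chart_at_in[OF p]]
  note op = atlas_open[OF M c(1)]
  have "local_d2 (coord_form2 M ?c (ext_deriv1 M \<alpha>)) (snd ?c p) (u ?c) (v ?c) (w ?c) =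
      local_d2 (\<lambda>a b x. local_d1 (coord_form1 M ?c \<alpha>) x a b) (snd ?c p) (u ?c) (v ?c) (w ?c)"
    by (rule local_d2_cong[OF op c(2)]) (rule coord_ext_deriv1[OF M \<alpha> c(1)])
  also have "\<dots> = 0"
    by (rule local_d2_local_d1[OF op c(2) one_form_coord(1)[OF M \<alpha> c(1)]])
  finally show "ext_deriv2 M (ext_deriv1 M \<alpha>) p u v w = 0"
    unfolding ext_deriv2_eq_local_d2 .
qed

lemma coord_form2_diff:
  "coord_form2 M c (\<lambda>p v w. \<beta> p v w - \<gamma> p v w) = (\<lambda>a b x. coord_form2 M c \<beta> a b x - coord_form2 M c \<gamma> a b x)"
  and coord_form2_minus:
  "coord_form2 M c (\<lambda>p v w. - \<beta> p v w) = (\<lambda>a b x. - coord_form2 M c \<beta> a b x)"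
  by (simp_all add: coord_form2_def fun_eq_iff)

lemma ext_deriv2_diff:
  assumes M: "smooth_atlas M" and p: "p \<in> carrier M" and \<beta>: "two_form M \<beta>" and \<gamma>: "two_form M \<gamma>"
  shows "ext_deriv2 M (\<lambda>p v w. \<beta> p v w - \<gamma> p v w) p u v w = ext_deriv2 M \<beta> p u v w - ext_deriv2 M \<gamma> p u v w"
proof -
  note c = charts_at_mem(1,3)[OF chart_at_in[OF p]]
  show ?thesis
    unfolding ext_deriv2_eq_local_d2 coord_form2_diff
    by (rule local_d2_diff[OF two_form_coord(1)[OF M \<beta> c(1)] two_form_coord(1)[OF M \<gamma> c(1)] c(2)])
qed

lemma ext_deriv2_minus:
  assumes M: "smooth_atlas M" and p: "p \<in> carrier M" and \<beta>: "two_form M \<beta>"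
  shows "ext_deriv2 M (\<lambda>p v w. - \<beta> p v w) p u v w = - ext_deriv2 M \<beta> p u v w"
proof -
  note c = charts_at_mem(1,3)[OF chart_at_in[OF p]]
  show ?thesis
    unfolding ext_deriv2_eq_local_d2 coord_form2_minus
    by (rule local_d2_minus[OF two_form_coord(1)[OF M \<beta> c(1)] c(2)])
qed

lemma two_form_diff:
  assumes M: "smooth_atlas M" and \<beta>: "two_form M \<beta>" and \<gamma>: "two_form M \<gamma>"
  shows "two_form M (\<lambda>p v w. \<beta> p v w - \<gamma> p v w)"
  by (rule two_formI[OF M]; unfold coord_form2_diff)
    (auto intro!: smooth_on_diff linear_compose_sub atlas_open[OF M]
      two_form_coord[OF M \<beta>] two_form_coord[OF M \<gamma>] simp: two_form_coord(4)[OF M \<beta>] two_form_coord(4)[OF M \<gamma>])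

lemma two_form_minus:
  assumes M: "smooth_atlas M" and \<beta>: "two_form M \<beta>"
  shows "two_form M (\<lambda>p v w. - \<beta> p v w)"
  by (rule two_formI[OF M]; unfold coord_form2_minus)
    (auto intro!: smooth_on_minus linear_compose_neg atlas_open[OF M] two_form_coord[OF M \<beta>]
      simp: two_form_coord(4)[OF M \<beta>])

subsection \<open>Pullbacks of 2-forms\<close>

lemma smooth_map_carrier: "smooth_map M N F \<Longrightarrow> p \<in> carrier M \<Longrightarrow> F p \<in> carrier N"
  by (auto simp: smooth_map_on_def)

lemma coord_pullback2:
  assumes M: "smooth_atlas M" and N: "smooth_atlas N" and F: "smooth_map M N F"
    and c: "c \<in> M" and d: "d \<in> N" and x: "x \<in> snd c ` {p \<in> fst c \<inter> carrier M. F p \<in> fst d}"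
  shows "coord_form2 M c (pullback2 M N F \<beta>) a b x =
    coord_form2 N d \<beta> (FD (snd d \<circ> F \<circ> chart_inv c) x a) (FD (snd d \<circ> F \<circ> chart_inv c) x b)
      ((snd d \<circ> F \<circ> chart_inv c) x)"
proof -
  let ?p = "chart_inv c x"
  have x': "x \<in> snd c ` fst c" using x by auto
  have cp: "c \<in> charts_at M ?p" by (rule chart_inv_charts_at[OF c x'])
  have p: "?p \<in> carrier M" by (rule charts_at_carrier[OF cp])
  have dp: "d \<in> charts_at N (F ?p)"
    using x d atlas_inj[OF M c] by (auto simp: charts_at_def chart_inv_chart)
  note t = coord_vector_tangent[OF M cp]
  note T = tangent_map_tangent[OF M N F p t]
  show ?thesis
    unfolding coord_form2_def[of M c] pullback2_def form2_coord[OF T T dp N]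
      tangent_map_rep[OF M F p t cp dp] coord_vector_self[OF M cp] chart_chart_inv[OF x'] o_def ..
qed

lemma two_form_pullback2:
  assumes M: "smooth_atlas M" and N: "smooth_atlas N" and F: "smooth_map M N F" and \<beta>: "two_form N \<beta>"
  shows "two_form M (pullback2 M N F \<beta>)"
proof (rule two_formI[OF M])
  fix c a b assume c: "c \<in> M"
  have ex: "\<exists>d\<in>N. x \<in> snd c ` {p \<in> fst c \<inter> carrier M. F p \<in> fst d}" if x: "x \<in> snd c ` fst c" for x
  proof -
    obtain p where p: "p \<in> fst c" "x = snd c p" using x by blast
    then have pM: "p \<in> carrier M" using chart_carrier[OF c] by blast
    obtain d where "d \<in> charts_at N (F p)" using smooth_map_carrier[OF F pM] by (rule carrier_chartE)
    then show ?thesis using p pM by (intro bexI[of _ d]) (auto dest: charts_at_mem)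
  qed
  show "smooth_on (snd c ` fst c) (coord_form2 M c (pullback2 M N F \<beta>) a b)"
  proof (rule smooth_on_local)
    fix x assume "x \<in> snd c ` fst c"
    then obtain d where d: "d \<in> N" "x \<in> snd c ` {p \<in> fst c \<inter> carrier M. F p \<in> fst d}"
      using ex by blast
    let ?V = "snd c ` {p \<in> fst c \<inter> carrier M. F p \<in> fst d}" and ?F = "snd d \<circ> F \<circ> chart_inv c"
    note V = smooth_map_on_rep[OF F c d(1)]
    have im: "?F ` ?V \<subseteq> snd d ` fst d" using atlas_inj[OF M c] by (auto simp: chart_inv_chart)
    have im': "?F x \<in> snd d ` fst d" if "x \<in> ?V" for x
      by (rule subsetD[OF im imageI[OF that]])
    have 1: "smooth_on ?V (\<lambda>x. coord_form2 N d \<beta> a b (?F x))" for a b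
      by (rule smooth_on_compose[OF V(1) atlas_open[OF N d(1)] im V(2) two_form_coord(1)[OF N \<beta> d(1)]])
    have 2: "smooth_on ?V (\<lambda>x. coord_form2 N d \<beta> a (FD ?F x b) (?F x))" for a b
      by (rule smooth_on_linear_family[where A = "\<lambda>x b. coord_form2 N d \<beta> a b (?F x)",
            OF V(1) two_form_coord(3)[OF N \<beta> d(1) im'] 1 smooth_on_FD[OF V(2)]])
    have "smooth_on ?V (\<lambda>x. coord_form2 N d \<beta> (FD ?F x a) (FD ?F x b) (?F x))"
      by (rule smooth_on_linear_family[where A = "\<lambda>x a. coord_form2 N d \<beta> a (FD ?F x b) (?F x)",
            OF V(1) two_form_coord(2)[OF N \<beta> d(1) im'] 2 smooth_on_FD[OF V(2)]])
    then have "smooth_on ?V (coord_form2 M c (pullback2 M N F \<beta>) a b)"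
      by (rule smooth_on_cong[THEN iffD2, OF V(1) coord_pullback2[OF M N F c d(1)], rotated])
    then show "\<exists>T. open T \<and> x \<in> T \<and> smooth_on T (coord_form2 M c (pullback2 M N F \<beta>) a b)"
      using V(1) d(2) by blast
  qed
  fix x assume "x \<in> snd c ` fst c"
  then obtain d where d: "d \<in> N" "x \<in> snd c ` {p \<in> fst c \<inter> carrier M. F p \<in> fst d}"
    using ex by blast
  let ?F = "snd d \<circ> F \<circ> chart_inv c"
  have im: "?F x \<in> snd d ` fst d" using d atlas_inj[OF M c] by (auto simp: chart_inv_chart)
  have lin: "linear (FD ?F x)"
    by (rule smooth_on_linear_FD[OF smooth_map_on_rep(2)[OF F c d(1)] d(2)])
  note B = two_form_coord[OF N \<beta> d(1)]
  show "linear (\<lambda>a. coord_form2 M c (pullback2 M N F \<beta>) a b x)"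
    unfolding coord_pullback2[OF M N F c d]
    using linear_compose[OF lin B(2)[OF im]] by (simp add: o_def)
  show "linear (\<lambda>b. coord_form2 M c (pullback2 M N F \<beta>) a b x)"
    unfolding coord_pullback2[OF M N F c d]
    using linear_compose[OF lin B(3)[OF im]] by (simp add: o_def)
  show "coord_form2 M c (pullback2 M N F \<beta>) a a x = 0"
    unfolding coord_pullback2[OF M N F c d] by (rule B(4)[OF im])
qed

text \<open>Evaluated in the charts that \<open>ext_deriv2\<close> selects at \<open>p\<close> and at \<open>F p\<close>, this is the naturality
  formula for the local representative of \<open>F\<close>.\<close>

lemma ext_deriv2_pullback2:
  assumes M: "smooth_atlas M" and N: "smooth_atlas N" and F: "smooth_map M N F" and \<beta>: "two_form N \<beta>"
    and p: "p \<in> carrier M" and t: "u \<in> tangent_space M p" "v \<in> tangent_space M p" "w \<in> tangent_space M p"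
  shows "ext_deriv2 M (pullback2 M N F \<beta>) p u v w = ext_deriv2 N \<beta> (F p)
    (tangent_map M N F p u) (tangent_map M N F p v) (tangent_map M N F p w)"
proof -
  let ?c = "chart_at M p" and ?d = "chart_at N (F p)"
  have c: "?c \<in> charts_at M p" and d: "?d \<in> charts_at N (F p)"
    by (rule chart_at_in[OF p], rule chart_at_in[OF smooth_map_carrier[OF F p]])
  note cM = charts_at_mem(1,2)[OF c] and dN = charts_at_mem(1,2)[OF d]
  let ?V = "snd ?c ` {p \<in> fst ?c \<inter> carrier M. F p \<in> fst ?d}" and ?F = "snd ?d \<circ> F \<circ> chart_inv ?c"
  note V = smooth_map_on_rep[OF F cM(1) dN(1)]
  have x: "snd ?c p \<in> ?V" using cM dN p by blast
  have im: "?F ` ?V \<subseteq> snd ?d ` fst ?d" using atlas_inj[OF M cM(1)] by (auto simp: chart_inv_chart)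
  have "local_d2 (coord_form2 M ?c (pullback2 M N F \<beta>)) (snd ?c p) (u ?c) (v ?c) (w ?c) =
      local_d2 (coord_form2 N ?d \<beta>) (?F (snd ?c p)) (FD ?F (snd ?c p) (u ?c))
        (FD ?F (snd ?c p) (v ?c)) (FD ?F (snd ?c p) (w ?c))"
    by (intro local_d2_pullback[OF V(1) x atlas_open[OF N dN(1)] V(2) im]
        two_form_coord[OF N \<beta> dN(1)] coord_pullback2[OF M N F cM(1) dN(1)])
  then show ?thesis
    unfolding ext_deriv2_eq_local_d2 tangent_map_rep[OF M F p t(1) c d]
      tangent_map_rep[OF M F p t(2) c d] tangent_map_rep[OF M F p t(3) c d]
    by (simp add: chart_image_at(2)[OF M c])
qed

lemma closed_pullback2:
  assumes M: "smooth_atlas M" and N: "smooth_atlas N" and F: "smooth_map M N F" and \<beta>: "two_form N \<beta>"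
    and cl: "closed_two_form N \<beta>"
  shows "closed_two_form M (pullback2 M N F \<beta>)"
  unfolding closed_two_form_def
proof (intro ballI)
  fix p u v w
  assume p: "p \<in> carrier M" and t: "u \<in> tangent_space M p" "v \<in> tangent_space M p" "w \<in> tangent_space M p"
  show "ext_deriv2 M (pullback2 M N F \<beta>) p u v w = 0"
    unfolding ext_deriv2_pullback2[OF M N F \<beta> p t]
    using cl smooth_map_carrier[OF F p] tangent_map_tangent[OF M N F p] t
    by (simp add: closed_two_form_def)
qed

section \<open>Local diffeomorphisms and pullbacks of symplectic forms\<close>

lemma openin_chart_inv_image:
  assumes M: "smooth_atlas M" and c: "c \<in> M" and U: "open U" "U \<subseteq> snd c ` fst c"
  shows "openin (atlas_topology M) (chart_inv c ` U)"
  unfolding openin_atlas_topology[OF M]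
proof (intro conjI ballI)
  show "chart_inv c ` U \<subseteq> carrier M"
    using U(2) chart_inv_carrier[OF c] by auto
  fix e assume e: "e \<in> M"
  let ?S = "snd e ` (fst e \<inter> fst c)" and ?\<tau> = "snd c \<circ> chart_inv e"
  have inj: "inj_on (snd e) (fst e)" "inj_on (snd c) (fst c)" using atlas_inj[OF M] e c by auto
  have "snd e ` (chart_inv c ` U \<inter> fst e) = ?S \<inter> ?\<tau> -` U"
  proof (intro equalityI subsetI)
    fix y assume "y \<in> snd e ` (chart_inv c ` U \<inter> fst e)"
    then obtain x where x: "x \<in> U" "chart_inv c x \<in> fst e" "y = snd e (chart_inv c x)" by auto
    have x': "x \<in> snd c ` fst c" by (rule subsetD[OF U(2) x(1)])
    show "y \<in> ?S \<inter> ?\<tau> -` U"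
      using x chart_inv_in[OF x'] chart_chart_inv[OF x'] inj by (simp add: chart_inv_chart)
  next
    fix y assume y: "y \<in> ?S \<inter> ?\<tau> -` U"
    then obtain q where q: "q \<in> fst e" "q \<in> fst c" "y = snd e q" by auto
    then have "snd c q \<in> U" using y inj by (simp add: chart_inv_chart)
    then show "y \<in> snd e ` (chart_inv c ` U \<inter> fst e)"
      using q inj by (intro image_eqI[of _ _ q] IntI image_eqI[of _ _ "snd c q"]) (auto simp: chart_inv_chart)
  qed
  moreover have "open (?S \<inter> ?\<tau> -` U)"
    using continuous_open_preimage[OF smooth_on_continuous_on[OF atlas_transition_smooth[OF M e c]]
        atlas_overlap_open[OF M e c] U(1)] .
  ultimately show "open (snd e ` (chart_inv c ` U \<inter> fst e))" by simp
qed

text \<open>Differentiating \<open>F\<^sup>-\<^sup>1 \<circ> F = id\<close> exhibits a left inverse of the derivative.\<close>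

lemma local_diffeo_derivative_inj:
  assumes M: "smooth_atlas M" and N: "smooth_atlas N" and F: "local_diffeo M N F"
    and c: "c \<in> charts_at M p" and d: "d \<in> charts_at N (F p)"
  shows "inj (FD (snd d \<circ> F \<circ> chart_inv c) (snd c p))"
proof -
  from F charts_at_carrier[OF c] obtain W where W: "p \<in> W" "inj_on F W"
    "smooth_map_on M N W F" "smooth_map_on N M (F ` W) (inv_into W F)"
    unfolding local_diffeo_def by meson
  let ?G = "inv_into W F"
  let ?F' = "snd d \<circ> F \<circ> chart_inv c" and ?G' = "snd c \<circ> ?G \<circ> chart_inv d"
  let ?V = "snd c ` {q \<in> fst c \<inter> W. F q \<in> fst d}"
  note cM = charts_at_mem[OF c] and dN = charts_at_mem[OF d]
  note inj = atlas_inj[OF M cM(1)] atlas_inj[OF N dN(1)]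
  have G: "?G (F q) = q" if "q \<in> W" for q using W(2) that by simp
  have V: "open ?V" by (rule smooth_map_on_rep(1)[OF W(3) cM(1) dN(1)])
  have x: "snd c p \<in> ?V" using W(1) cM dN by blast
  have "c \<in> charts_at M (?G (F p))" using c G[OF W(1)] by simp
  then have G': "?G' differentiable at (snd d (F p))"
    by (rule smooth_map_on_at[OF W(4) imageI[OF W(1)] d])
  have Fp: "?F' (snd c p) = snd d (F p)" using chart_image_at(2)[OF M c] by simp
  have "?G' (?F' y) = y" if "y \<in> ?V" for y
    using that inj G by (auto simp: chart_inv_chart)
  then have "FD (\<lambda>y. ?G' (?F' y)) (snd c p) = FD (\<lambda>y. y) (snd c p)"
    by (rule FD_cong_open[OF V x])
  moreover have "FD (\<lambda>y. ?G' (?F' y)) (snd c p) a = FD ?G' (snd d (F p)) (FD ?F' (snd c p) a)" for a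
    using FD_compose[OF smooth_map_on_at[OF W(3,1) c d], of ?G' a] G' unfolding Fp by simp
  ultimately have "FD ?G' (snd d (F p)) (FD ?F' (snd c p) a) = a" for a by simp
  then show ?thesis by (rule inj_on_inverseI)
qed

text \<open>The inverse function theorem, applied to a local representative of \<open>F\<close> and transported back to the
  manifolds.\<close>

lemma local_diffeoI:
  fixes M :: "('a, 'e::euclidean_space) chart set" and N :: "('b, 'e) chart set"
  assumes M: "smooth_atlas M" and N: "smooth_atlas N" and F: "smooth_map M N F"
    and inj: "\<And>p c d. c \<in> charts_at M p \<Longrightarrow> d \<in> charts_at N (F p) \<Longrightarrow>
       inj (FD (snd d \<circ> F \<circ> chart_inv c) (snd c p))"
  shows "local_diffeo M N F"
  unfolding local_diffeo_def
proof
  fix p assume p: "p \<in> carrier M"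
  obtain c where c: "c \<in> charts_at M p" using p by (rule carrier_chartE)
  obtain d where d: "d \<in> charts_at N (F p)" using smooth_map_carrier[OF F p] by (rule carrier_chartE)
  note cM = charts_at_mem[OF c] and dN = charts_at_mem[OF d]
  note injc = atlas_inj[OF M cM(1)] and injd = atlas_inj[OF N dN(1)]
  let ?f = "snd d \<circ> F \<circ> chart_inv c" and ?V = "snd c ` {q \<in> fst c \<inter> carrier M. F q \<in> fst d}"
  note V = smooth_map_on_rep[OF F cM(1) dN(1)]
  have x: "snd c p \<in> ?V" using p cM dN by blast
  obtain U' V' g where *: "open U'" "U' \<subseteq> ?V" "snd c p \<in> U'" "open V'" "homeomorphism U' V' ?f g"
    "smooth_on V' g"
    by (rule smooth_inverse_function[OF V(1) x V(2) inj[OF c d]])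
  have gf: "g (?f x) = x" if "x \<in> U'" for x using *(5) that by (simp add: homeomorphism_def)
  have fg: "?f (g y) = y" if "y \<in> V'" for y using *(5) that by (simp add: homeomorphism_def)
  have fU: "?f ` U' = V'" and gV: "g ` V' = U'" using *(5) by (simp_all add: homeomorphism_def)
  let ?W = "chart_inv c ` U'" and ?p = "chart_inv c"
  have pt: "?p x \<in> fst c \<and> ?p x \<in> carrier M \<and> F (?p x) \<in> fst d \<and> snd c (?p x) = x \<and>
      chart_inv d (?f x) = F (?p x)" if x: "x \<in> U'" for x
  proof -
    obtain q where q: "q \<in> fst c" "q \<in> carrier M" "F q \<in> fst d" "x = snd c q"
      using subsetD[OF *(2) x] by blast
    then show ?thesis using injc injd by (simp add: chart_inv_chart)
  qed
  have FW: "F ` ?W = chart_inv d ` V'"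
    unfolding fU[symmetric] image_image using pt by (intro image_cong) auto
  have injW: "inj_on F ?W"
  proof (rule inj_onI)
    fix q q' assume "q \<in> ?W" "q' \<in> ?W" and eq: "F q = F q'"
    then obtain x x' where x: "x \<in> U'" "q = ?p x" "x' \<in> U'" "q' = ?p x'" by blast
    then have "?f x = ?f x'" using eq by simp
    then have "x = x'" using gf[OF x(1)] gf[OF x(3)] by simp
    then show "q = q'" using x by simp
  qed
  let ?G = "inv_into ?W F"
  have GF: "?G (F (?p x)) = ?p x" if "x \<in> U'" for x using injW that by simp
  have G: "?G (chart_inv d y) = ?p (g y)" if y: "y \<in> V'" for y
  proof -
    have gy: "g y \<in> U'" using gV y by blast
    have "chart_inv d y = F (?p (g y))" using pt[OF gy] fg[OF y] by simp
    then show ?thesis using GF[OF gy] by simp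
  qed
  have V'd: "V' \<subseteq> snd d ` fst d"
    unfolding fU[symmetric] using pt by auto
  have "p \<in> ?W" using *(3) chart_image_at(2)[OF M c] by (metis imageI)
  moreover have "openin (atlas_topology M) ?W"
    using *(2) by (intro openin_chart_inv_image[OF M cM(1) *(1)]) blast
  moreover have "openin (atlas_topology N) (F ` ?W)"
    unfolding FW by (rule openin_chart_inv_image[OF N dN(1) *(4) V'd])
  moreover have "smooth_map_on M N ?W F"
  proof (rule smooth_map_onI[OF M N])
    show "?W \<subseteq> carrier M" using pt by auto
    fix q assume "q \<in> ?W"
    then obtain x where x: "x \<in> U'" "q = ?p x" by blast
    have cq: "c \<in> charts_at M q" and dq: "d \<in> charts_at N (F q)" and xq: "snd c q \<in> U'"
      using pt[OF x(1)] x cM(1) dN(1) by (auto intro: charts_atI)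
    have "U' \<subseteq> snd c ` {q \<in> fst c \<inter> ?W. F q \<in> fst d}"
    proof
      fix y assume "y \<in> U'"
      then show "y \<in> snd c ` {q \<in> fst c \<inter> ?W. F q \<in> fst d}"
        using pt[of y] by (intro image_eqI[of _ _ "?p y"]) auto
    qed
    then show "\<exists>c\<in>charts_at M q. \<exists>d\<in>charts_at N (F q). \<exists>V. open V \<and> snd c q \<in> V \<and>
        V \<subseteq> snd c ` {q \<in> fst c \<inter> ?W. F q \<in> fst d} \<and> smooth_on V (snd d \<circ> F \<circ> chart_inv c)"
      by (intro bexI[OF _ cq] bexI[OF _ dq] exI[of _ U'] conjI *(1) xq smooth_on_subset[OF V(2) *(2)])
  qed
  moreover have "smooth_map_on N M (F ` ?W) ?G"
  proof (rule smooth_map_onI[OF N M])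
    show "F ` ?W \<subseteq> carrier N" using pt smooth_map_carrier[OF F] by auto
    fix q assume "q \<in> F ` ?W"
    then obtain y where y: "y \<in> V'" "q = chart_inv d y" unfolding FW by blast
    have gy: "g y \<in> U'" using gV y(1) by blast
    have yd: "y \<in> snd d ` fst d" by (rule subsetD[OF V'd y(1)])
    have dq: "d \<in> charts_at N q" unfolding y(2) by (rule chart_inv_charts_at[OF dN(1) yd])
    have cq: "c \<in> charts_at M (?G q)"
      unfolding y(2) G[OF y(1)] using pt[OF gy] cM(1) by (auto intro: charts_atI)
    have yq: "snd d q \<in> V'" unfolding y(2) using chart_chart_inv[OF yd] y(1) by simp
    have sub: "V' \<subseteq> snd d ` {q \<in> fst d \<inter> F ` ?W. ?G q \<in> fst c}"
    proof
      fix z assume z: "z \<in> V'"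
      then have gz: "g z \<in> U'" using gV by blast
      have zd: "z \<in> snd d ` fst d" by (rule subsetD[OF V'd z])
      show "z \<in> snd d ` {q \<in> fst d \<inter> F ` ?W. ?G q \<in> fst c}"
        using chart_inv_in[OF zd] chart_chart_inv[OF zd] pt[OF gz] z G[OF z]
        by (intro image_eqI[of _ _ "chart_inv d z"]) (auto simp: FW)
    qed
    have "(snd c \<circ> ?G \<circ> chart_inv d) z = g z" if z: "z \<in> V'" for z
    proof -
      have "g z \<in> U'" using gV z by blast
      from pt[OF this] G[OF z] show ?thesis by simp
    qed
    from smooth_on_cong[THEN iffD2, OF *(4) this *(6)]
    have "smooth_on V' (snd c \<circ> ?G \<circ> chart_inv d)" .
    then show "\<exists>c\<in>charts_at N q. \<exists>d\<in>charts_at M (?G q). \<exists>V. open V \<and> snd c q \<in> V \<and>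
        V \<subseteq> snd c ` {q \<in> fst c \<inter> F ` ?W. ?G q \<in> fst d} \<and> smooth_on V (snd d \<circ> ?G \<circ> chart_inv c)"
      by (intro bexI[OF _ dq] bexI[OF _ cq] exI[of _ V'] conjI *(4) yq sub)
  qed
  ultimately show "\<exists>W. p \<in> W \<and> openin (atlas_topology M) W \<and> openin (atlas_topology N) (F ` W) \<and>
      inj_on F W \<and> smooth_map_on M N W F \<and> smooth_map_on N M (F ` W) (inv_into W F)"
    using injW by blast
qed

lemma linear_at_zero:
  assumes "smooth_atlas M" "linear_at M p \<alpha>"
  shows "\<alpha> (\<lambda>_. 0) = 0"
proof -
  have "\<forall>r. \<forall>v\<in>tangent_space M p. \<alpha> (\<lambda>c. r *\<^sub>R v c) = r * \<alpha> v"
    using assms(2) unfolding linear_at_def by (rule conjunct2)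
  from this[THEN spec[of _ 0], THEN bspec, OF tangent_space_zero[OF assms(1)]] show ?thesis by simp
qed

lemma two_form_zero:
  assumes "smooth_atlas M" "two_form M \<beta>" "p \<in> carrier M" "v \<in> tangent_space M p"
  shows "\<beta> p (\<lambda>_. 0) v = 0" "\<beta> p v (\<lambda>_. 0) = 0"
proof -
  have "linear_at M p (\<lambda>u. \<beta> p u v)" "linear_at M p (\<beta> p v)"
    using assms(2-4) by (simp_all add: two_form_def)
  from this[THEN linear_at_zero[OF assms(1)]] show "\<beta> p (\<lambda>_. 0) v = 0" "\<beta> p v (\<lambda>_. 0) = 0" .
qed

lemma symplectic_iff:
  "symplectic M \<omega> \<longleftrightarrow> two_form M \<omega> \<and> closed_two_form M \<omega> \<and>
     (\<forall>p\<in>carrier M. \<forall>v\<in>tangent_space M p. (\<forall>w\<in>tangent_space M p. \<omega> p v w = 0) \<longrightarrow> v = (\<lambda>_. 0))"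
  unfolding symplectic_def closed_two_form_def ..

text \<open>A vector in the kernel of the tangent map is in the kernel of the pullback; conversely, when the
  tangent map is bijective, the two forms have corresponding kernels.  The charts of both manifolds
  take values in the same space, which is how equality of dimensions is expressed.\<close>

theorem symplectic_pullback_iff:
  fixes M :: "('a, 'e::euclidean_space) chart set" and N :: "('b, 'e) chart set"
  assumes M: "smooth_atlas M" and N: "smooth_atlas N" and F: "smooth_map M N F"
    and \<Omega>: "symplectic N \<Omega>"
  shows "symplectic M (pullback2 M N F \<Omega>) \<longleftrightarrow> local_diffeo M N F"
proof
  have \<Omega>2: "two_form N \<Omega>" "closed_two_form N \<Omega>" using \<Omega> by (simp_all add: symplectic_iff)
  have nondeg: "v = (\<lambda>_. 0)"
    if "q \<in> carrier N" "v \<in> tangent_space N q" "\<And>w. w \<in> tangent_space N q \<Longrightarrow> \<Omega> q v w = 0" for q v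
    using \<Omega> that by (simp add: symplectic_iff)
  have linF: "linear (FD (snd d \<circ> F \<circ> chart_inv c) (snd c p))"
    if c: "c \<in> charts_at M p" and d: "d \<in> charts_at N (F p)" for c d p
    by (rule linear_frechet_derivative[OF smooth_map_on_at[OF F charts_at_carrier[OF c] c d]])
  {
    assume S: "symplectic M (pullback2 M N F \<Omega>)"
    show "local_diffeo M N F"
    proof (rule local_diffeoI[OF M N F])
      fix p c d assume c: "c \<in> charts_at M p" and d: "d \<in> charts_at N (F p)"
      have p: "p \<in> carrier M" by (rule charts_at_carrier[OF c])
      note Fp = smooth_map_carrier[OF F p]
      let ?D = "FD (snd d \<circ> F \<circ> chart_inv c) (snd c p)"
      have "a = 0" if a: "?D a = 0" for a
      proof -
        let ?v = "coord_vector M c p a"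
        have v: "?v \<in> tangent_space M p" by (rule coord_vector_tangent[OF M c])
        have "tangent_map M N F p ?v d = 0"
          unfolding tangent_map_rep[OF M F p v c d] coord_vector_self[OF M c] by (rule a)
        then have T: "tangent_map M N F p ?v = (\<lambda>_. 0)"
          by (intro tangent_eqI[OF tangent_map_tangent[OF M N F p v] tangent_space_zero[OF N] d])
        have "pullback2 M N F \<Omega> p ?v w = 0" if w: "w \<in> tangent_space M p" for w
          unfolding pullback2_def T
          by (rule two_form_zero(1)[OF N \<Omega>2(1) Fp tangent_map_tangent[OF M N F p w]])
        then have "?v = (\<lambda>_. 0)"
          using S p v by (simp add: symplectic_iff)
        then show ?thesis using coord_vector_self[OF M c, of a] by simp
      qed
      then show "inj ?D" by (simp add: linear_injective_0[OF linF[OF c d]])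
    qed
  next
    assume L: "local_diffeo M N F"
    have "v = (\<lambda>_. 0)" if p: "p \<in> carrier M" and v: "v \<in> tangent_space M p"
      and null: "\<forall>w\<in>tangent_space M p. pullback2 M N F \<Omega> p v w = 0" for p v
    proof -
      obtain c where c: "c \<in> charts_at M p" using p by (rule carrier_chartE)
      note Fp = smooth_map_carrier[OF F p]
      obtain d where d: "d \<in> charts_at N (F p)" using Fp by (rule carrier_chartE)
      let ?D = "FD (snd d \<circ> F \<circ> chart_inv c) (snd c p)"
      have inj: "inj ?D" by (rule local_diffeo_derivative_inj[OF M N L c d])
      then have surj: "surj ?D" by (rule linear_inj_imp_surj[OF linF[OF c d]])
      \<comment> \<open>Every vector at \<open>F p\<close> is the image of a vector at \<open>p\<close>, so the image of \<open>v\<close> is in the kernel of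
        the form at \<open>F p\<close>.\<close>
      have "\<Omega> (F p) (tangent_map M N F p v) w = 0" if w: "w \<in> tangent_space N (F p)" for w
      proof -
        obtain a where a: "w d = ?D a" using surj by (rule surjE)
        have t: "coord_vector M c p a \<in> tangent_space M p" by (rule coord_vector_tangent[OF M c])
        have "tangent_map M N F p (coord_vector M c p a) d = w d"
          unfolding tangent_map_rep[OF M F p t c d] coord_vector_self[OF M c] a ..
        then have "tangent_map M N F p (coord_vector M c p a) = w"
          by (rule tangent_eqI[OF tangent_map_tangent[OF M N F p t] w d])
        then show ?thesis using null t by (auto simp: pullback2_def)
      qed
      then have "tangent_map M N F p v = (\<lambda>_. 0)"
        by (rule nondeg[OF Fp tangent_map_tangent[OF M N F p v]])
      then have "?D (v c) = ?D 0"
        using tangent_map_rep[OF M F p v c d] linear_0[OF linF[OF c d]] by simp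
      then have "v c = 0" using inj by (simp only: inj_eq)
      then show ?thesis by (intro tangent_eqI[OF v tangent_space_zero[OF M] c])
    qed
    then show "symplectic M (pullback2 M N F \<Omega>)"
      unfolding symplectic_iff
      using two_form_pullback2[OF M N F \<Omega>2(1)] closed_pullback2[OF M N F \<Omega>2] by blast
  }
qed

section \<open>The cotangent bundle\<close>

lemma cotangent_spaceD:
  assumes "\<alpha> \<in> cotangent_space M p"
  shows "linear_at M p \<alpha>" "v \<notin> tangent_space M p \<Longrightarrow> \<alpha> v = 0"
  using assms by (auto simp: cotangent_space_def)

lemma restrict_covec_cotangent:
  assumes M: "smooth_atlas M" and "linear_at M p \<alpha>"
  shows "restrict_covec M p \<alpha> \<in> cotangent_space M p"
  using assms(2) tangent_space_add[OF M] tangent_space_scale[OF M]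
  by (simp add: cotangent_space_def restrict_covec_def linear_at_def)

lemma fst_cotangent_chart: "fst (cotangent_chart M c) = (SIGMA p:fst c. cotangent_space M p)"
  and snd_cotangent_chart:
  "snd (cotangent_chart M c) (p, \<alpha>) = (snd c p, \<Sum>b\<in>Basis. \<alpha> (coord_vector M c p b) *\<^sub>R b)"
  by (simp_all add: cotangent_chart_def)

text \<open>The fibre coordinate \<open>y\<close> of a covector is its gradient: it pairs with coordinate
  representatives of tangent vectors.\<close>

lemma covec_eq_inner:
  assumes M: "smooth_atlas M" and c: "c \<in> charts_at M p" and \<alpha>: "linear_at M p \<alpha>"
    and v: "v \<in> tangent_space M p"
  shows "\<alpha> v = snd (snd (cotangent_chart M c) (p, \<alpha>)) \<bullet> v c"
proof -
  have "\<alpha> v = \<alpha> (coord_vector M c p (v c))"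
    using tangent_eq_coord_vector[OF v c] by simp
  also have "\<dots> = (\<Sum>b\<in>Basis. (v c \<bullet> b) *\<^sub>R \<alpha> (coord_vector M c p b))"
    by (rule linear_basis_sum[OF linear_at_coord[OF M c \<alpha>]])
  finally show ?thesis
    by (simp add: snd_cotangent_chart inner_sum_left inner_sum_right inner_commute mult.commute)
qed

lemma cotangent_chart_restrict_covec:
  assumes M: "smooth_atlas M" and c: "c \<in> charts_at M p"
  shows "snd (cotangent_chart M c) (p, restrict_covec M p (\<lambda>v. y \<bullet> v c)) = (snd c p, y)"
  by (simp add: snd_cotangent_chart restrict_covec_def coord_vector_tangent[OF M c]
      coord_vector_self[OF M c] euclidean_representation)

lemma linear_at_inner:
  assumes M: "smooth_atlas M"
  shows "linear_at M p (\<lambda>v. y \<bullet> v c)"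
  by (rule linear_atI[OF bounded_linear.linear[OF bounded_linear_inner_right] refl M])

lemma cotangent_chart_inj:
  assumes M: "smooth_atlas M" and c: "c \<in> M"
  shows "inj_on (snd (cotangent_chart M c)) (fst (cotangent_chart M c))"
proof (rule inj_onI)
  fix z z' assume z: "z \<in> fst (cotangent_chart M c)" "z' \<in> fst (cotangent_chart M c)"
    and eq: "snd (cotangent_chart M c) z = snd (cotangent_chart M c) z'"
  obtain p \<alpha> p' \<alpha>' where pz: "z = (p, \<alpha>)" "z' = (p', \<alpha>')" by (cases z, cases z')
  have p: "p \<in> fst c" "p' \<in> fst c" "\<alpha> \<in> cotangent_space M p" "\<alpha>' \<in> cotangent_space M p'"
    using z unfolding pz fst_cotangent_chart by auto
  have "snd c p = snd c p'" using eq unfolding pz snd_cotangent_chart by simp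
  then have pp: "p = p'" using atlas_inj[OF M c] p by (simp add: inj_on_eq_iff)
  have "\<alpha> v = \<alpha>' v" for v
  proof (cases "v \<in> tangent_space M p")
    case True
    have cp: "c \<in> charts_at M p" using c p(1) by (rule charts_atI)
    show ?thesis
      using covec_eq_inner[OF M cp cotangent_spaceD(1)[OF p(3)] True]
        covec_eq_inner[OF M cp cotangent_spaceD(1)[OF p(4)[folded pp]] True] eq
      unfolding pz pp by simp
  next
    case False
    then show ?thesis
      using cotangent_spaceD(2)[OF p(3)] cotangent_spaceD(2)[OF p(4)] pp by simp
  qed
  then show "z = z'" using pz pp by auto
qed

lemma cotangent_chart_point:
  assumes M: "smooth_atlas M" and c: "c \<in> M" and x: "x \<in> snd c ` fst c"
  shows "(chart_inv c x, restrict_covec M (chart_inv c x) (\<lambda>v. y \<bullet> v c)) \<in> fst (cotangent_chart M c)"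
    and "snd (cotangent_chart M c) (chart_inv c x, restrict_covec M (chart_inv c x) (\<lambda>v. y \<bullet> v c)) = (x, y)"
  using chart_inv_in[OF x] restrict_covec_cotangent[OF M linear_at_inner[OF M]]
    cotangent_chart_restrict_covec[OF M chart_inv_charts_at[OF c x]] chart_chart_inv[OF x]
  by (simp_all add: fst_cotangent_chart)

lemma cotangent_chart_image:
  assumes M: "smooth_atlas M" and c: "c \<in> M"
  shows "snd (cotangent_chart M c) ` (fst (cotangent_chart M c) \<inter> fst (cotangent_chart M d)) =
    snd c ` (fst c \<inter> fst d) \<times> UNIV" (is "?L = ?R")
proof (intro equalityI subsetI)
  fix z assume "z \<in> ?L"
  then show "z \<in> ?R" by (auto simp: fst_cotangent_chart snd_cotangent_chart)
next
  fix z assume "z \<in> ?R"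
  then obtain q y where q: "q \<in> fst c" "q \<in> fst d" "z = (snd c q, y)" by auto
  have x: "snd c q \<in> snd c ` fst c" using q by auto
  have "chart_inv c (snd c q) = q" using chart_inv_chart[OF atlas_inj[OF M c] q(1)] .
  then show "z \<in> ?L"
    using cotangent_chart_point[OF M c x, of y] q
    by (intro image_eqI[of _ _ "(q, restrict_covec M q (\<lambda>v. y \<bullet> v c))"]) (auto simp: fst_cotangent_chart)
qed

lemma cotangent_chart_image_self:
  assumes "smooth_atlas M" "c \<in> M"
  shows "snd (cotangent_chart M c) ` fst (cotangent_chart M c) = snd c ` fst c \<times> UNIV"
  using cotangent_chart_image[OF assms, of c] by simp

lemma chart_inv_cotangent:
  assumes M: "smooth_atlas M" and c: "c \<in> M" and x: "x \<in> snd c ` fst c"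
  shows "chart_inv (cotangent_chart M c) (x, y) =
    (chart_inv c x, restrict_covec M (chart_inv c x) (\<lambda>v. y \<bullet> v c))"
  using chart_inv_chart[OF cotangent_chart_inj[OF M c] cotangent_chart_point(1)[OF M c x, of y]]
    cotangent_chart_point(2)[OF M c x, of y] by simp

text \<open>The base coordinates change by the transition \<open>\<tau>\<close>, the fibre coordinates by the transpose of the
  derivative of the inverse transition.\<close>

lemma cotangent_transition:
  assumes M: "smooth_atlas M" and c: "c \<in> M" and d: "d \<in> M" and x: "x \<in> snd c ` (fst c \<inter> fst d)"
  shows "(snd (cotangent_chart M d) \<circ> chart_inv (cotangent_chart M c)) (x, y) =
    ((snd d \<circ> chart_inv c) x,
     \<Sum>b\<in>Basis. (y \<bullet> FD (snd c \<circ> chart_inv d) ((snd d \<circ> chart_inv c) x) b) *\<^sub>R b)"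
proof -
  have x': "x \<in> snd c ` fst c" using x by auto
  let ?p = "chart_inv c x"
  have cp: "c \<in> charts_at M ?p" by (rule chart_inv_charts_at[OF c x'])
  have dp: "d \<in> charts_at M ?p"
    using x d chart_inv_chart[OF atlas_inj[OF M c]] by (auto intro!: charts_atI)
  have "restrict_covec M ?p (\<lambda>v. y \<bullet> v c) (coord_vector M d ?p b) =
      y \<bullet> FD (snd c \<circ> chart_inv d) (snd d ?p) b" for b
    using coord_vector_tangent[OF M dp] coord_vector_other[OF cp] by (simp add: restrict_covec_def)
  then show ?thesis
    by (simp add: chart_inv_cotangent[OF M c x'] snd_cotangent_chart)
qed

lemma smooth_atlas_cotangent:
  assumes M: "smooth_atlas M"
  shows "smooth_atlas (cotangent_bundle M)"
proof -
  have inj: "inj_on (snd (cotangent_chart M c)) (fst (cotangent_chart M c))" if "c \<in> M" for c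
    by (rule cotangent_chart_inj[OF M that])
  have op: "open (snd c ` (fst c \<inter> fst d) \<times> (UNIV :: 'b set))" if "c \<in> M" "d \<in> M" for c d
    using atlas_overlap_open[OF M that] by (intro open_Times) auto
  have sm: "smooth_on (snd c ` (fst c \<inter> fst d) \<times> UNIV)
      (snd (cotangent_chart M d) \<circ> chart_inv (cotangent_chart M c))" if c: "c \<in> M" and d: "d \<in> M" for c d
  proof -
    let ?S = "snd c ` (fst c \<inter> fst d)" and ?R = "snd d ` (fst d \<inter> fst c)"
    let ?U = "?S \<times> (UNIV :: 'b set)"
    let ?\<tau> = "snd d \<circ> chart_inv c" and ?\<sigma> = "snd c \<circ> chart_inv d"
    note \<tau> = atlas_transition_smooth[OF M c d] and \<sigma> = atlas_transition_smooth[OF M d c]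
    have im: "?\<tau> ` ?S \<subseteq> ?R" using atlas_inj[OF M c] by (auto simp: chart_inv_chart)
    have t: "smooth_on ?U (\<lambda>z. ?\<tau> (fst z))"
      by (rule smooth_on_compose[OF op[OF c d] atlas_overlap_open[OF M c d] _ smooth_on_fst \<tau>]) auto
    have s: "smooth_on ?U (\<lambda>z. FD ?\<sigma> (?\<tau> (fst z)) b)" for b
      using im
      by (intro smooth_on_compose[OF op[OF c d] atlas_overlap_open[OF M d c] _ t smooth_on_FD[OF \<sigma>]]) auto
    have sm: "smooth_on ?U (\<lambda>z. (?\<tau> (fst z), \<Sum>b\<in>Basis. (snd z \<bullet> FD ?\<sigma> (?\<tau> (fst z)) b) *\<^sub>R b))"
      by (intro smooth_on_Pair t smooth_on_sum smooth_on_scaleR smooth_on_inner smooth_on_snd s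
          smooth_on_const op[OF c d])
    have eq: "(snd (cotangent_chart M d) \<circ> chart_inv (cotangent_chart M c)) z =
        (?\<tau> (fst z), \<Sum>b\<in>Basis. (snd z \<bullet> FD ?\<sigma> (?\<tau> (fst z)) b) *\<^sub>R b)" if z: "z \<in> ?U" for z
    proof -
      have "fst z \<in> ?S" using z by auto
      from cotangent_transition[OF M c d this, of "snd z"] show ?thesis by simp
    qed
    show ?thesis
      by (rule smooth_on_cong[THEN iffD2, OF op[OF c d] eq sm])
  qed
  have "inj_on (snd k) (fst k) \<and> open (snd k ` fst k)" if "k \<in> cotangent_bundle M" for k
  proof -
    obtain c where c: "k = cotangent_chart M c" "c \<in> M" using \<open>k \<in> cotangent_bundle M\<close>
      unfolding cotangent_bundle_def by (rule imageE)
    show ?thesis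
      unfolding c(1) cotangent_chart_image_self[OF M c(2)]
      using inj[OF c(2)] op[OF c(2) c(2)] by simp
  qed
  moreover have "open (snd k ` (fst k \<inter> fst k')) \<and> smooth_on (snd k ` (fst k \<inter> fst k')) (snd k' \<circ> chart_inv k)"
    if k: "k \<in> cotangent_bundle M" and k': "k' \<in> cotangent_bundle M" for k k'
  proof -
    obtain c where c: "k = cotangent_chart M c" "c \<in> M" using k
      unfolding cotangent_bundle_def by (rule imageE)
    obtain d where d: "k' = cotangent_chart M d" "d \<in> M" using k'
      unfolding cotangent_bundle_def by (rule imageE)
    show ?thesis
      unfolding c(1) d(1) cotangent_chart_image[OF M c(2)]
      using op[OF c(2) d(2)] sm[OF c(2) d(2)] by simp
  qed
  ultimately show ?thesis unfolding smooth_atlas_def by blast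
qed

lemma charts_at_cotangent:
  assumes "snd z \<in> cotangent_space M (fst z)" "c \<in> charts_at M (fst z)"
  shows "cotangent_chart M c \<in> charts_at (cotangent_bundle M) z"
proof (rule charts_atI)
  show "cotangent_chart M c \<in> cotangent_bundle M"
    using charts_at_mem(1)[OF assms(2)] by (simp add: cotangent_bundle_def)
  have "(fst z, snd z) \<in> (SIGMA p:fst c. cotangent_space M p)"
    using charts_at_mem(2)[OF assms(2)] assms(1) by (rule SigmaI)
  then show "z \<in> fst (cotangent_chart M c)" by (simp add: fst_cotangent_chart)
qed

lemma charts_at_cotangentE:
  assumes "z \<in> carrier (cotangent_bundle M)"
  obtains c where "c \<in> charts_at M (fst z)" "cotangent_chart M c \<in> charts_at (cotangent_bundle M) z"
    "snd z \<in> cotangent_space M (fst z)"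
proof -
  from assms obtain k where k: "k \<in> charts_at (cotangent_bundle M) z" by (rule carrier_chartE)
  then obtain c where c: "c \<in> M" "k = cotangent_chart M c"
    using charts_at_mem(1)[OF k] unfolding cotangent_bundle_def by blast
  have "z \<in> (SIGMA p:fst c. cotangent_space M p)"
    using charts_at_mem(2)[OF k] unfolding c(2) fst_cotangent_chart .
  then have "fst z \<in> fst c" "snd z \<in> cotangent_space M (fst z)" by auto
  then show ?thesis using that[of c] k c by (simp add: charts_atI)
qed

lemma fst_cotangent_rep:
  assumes M: "smooth_atlas M" and c: "c \<in> M" and z: "z \<in> snd c ` fst c \<times> UNIV"
  shows "(snd c \<circ> fst \<circ> chart_inv (cotangent_chart M c)) z = fst z"
proof -
  have "fst z \<in> snd c ` fst c" using z by auto
  then show ?thesis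
    using chart_inv_cotangent[OF M c, of "fst z" "snd z"] chart_chart_inv[of "fst z" c] by simp
qed

lemma open_cotangent_image:
  assumes M: "smooth_atlas M" and c: "c \<in> M"
  shows "open (snd c ` fst c \<times> (UNIV :: 'e::euclidean_space set))"
  using atlas_open[OF M c] by (intro open_Times) auto

lemma smooth_map_cotangent_fst:
  assumes M: "smooth_atlas M"
  shows "smooth_map (cotangent_bundle M) M fst"
proof (rule smooth_map_onI[OF smooth_atlas_cotangent[OF M] M])
  fix z assume z: "z \<in> carrier (cotangent_bundle M)"
  obtain c where c: "c \<in> charts_at M (fst z)" and k: "cotangent_chart M c \<in> charts_at (cotangent_bundle M) z"
    using z by (rule charts_at_cotangentE)
  let ?k = "cotangent_chart M c"
  note cM = charts_at_mem(1)[OF c]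
  note im = cotangent_chart_image_self[OF M cM]
  have op: "open (snd ?k ` fst ?k)" unfolding im by (rule open_cotangent_image[OF M cM])
  have "smooth_on (snd ?k ` fst ?k) (snd c \<circ> fst \<circ> chart_inv ?k)"
    by (rule smooth_on_cong[THEN iffD2, OF op _ smooth_on_fst], unfold im) (rule fst_cotangent_rep[OF M cM])
  moreover have "fst ?k \<subseteq> carrier (cotangent_bundle M)"
    using charts_at_mem(1)[OF k] by (auto intro: chart_carrier)
  then have "snd ?k ` fst ?k \<subseteq> snd ?k ` {q \<in> fst ?k \<inter> carrier (cotangent_bundle M). fst q \<in> fst c}"
    by (intro image_mono) (auto simp: fst_cotangent_chart)
  ultimately show "\<exists>c\<in>charts_at (cotangent_bundle M) z. \<exists>d\<in>charts_at M (fst z). \<exists>V. open V \<and> snd c z \<in> V \<and>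
      V \<subseteq> snd c ` {q \<in> fst c \<inter> carrier (cotangent_bundle M). fst q \<in> fst d} \<and>
      smooth_on V (snd d \<circ> fst \<circ> chart_inv c)"
    by (intro bexI[OF _ k] bexI[OF _ c] exI[of _ "snd ?k ` fst ?k"] conjI op
        charts_at_mem(3)[OF k])
qed auto

lemma tangent_map_cotangent_fst:
  assumes M: "smooth_atlas M" and c: "c \<in> charts_at M (fst z)"
    and k: "cotangent_chart M c \<in> charts_at (cotangent_bundle M) z"
    and v: "v \<in> tangent_space (cotangent_bundle M) z"
  shows "tangent_map (cotangent_bundle M) M fst z v c = fst (v (cotangent_chart M c))"
proof -
  let ?k = "cotangent_chart M c"
  note cM = charts_at_mem(1)[OF c]
  note im = cotangent_chart_image_self[OF M cM]
  have z: "snd ?k z \<in> snd c ` fst c \<times> UNIV" using charts_at_mem(3)[OF k] unfolding im .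
  have "FD (snd c \<circ> fst \<circ> chart_inv ?k) (snd ?k z) = FD fst (snd ?k z)"
    by (rule FD_cong_open[OF open_cotangent_image[OF M cM] z]) (rule fst_cotangent_rep[OF M cM])
  also have "\<dots> = fst"
    by (intro FD_eqI bounded_linear_imp_has_derivative bounded_linear_fst)
  finally show ?thesis
    using tangent_map_rep[OF smooth_atlas_cotangent[OF M] smooth_map_cotangent_fst[OF M]
        charts_at_carrier[OF k] v k c] by simp
qed

subsection \<open>Canonical forms\<close>

text \<open>In a bundle chart \<open>\<theta>\<^sub>Q = y \<cdot> dx\<close>, whatever the chart of the base; in particular its exterior
  derivative has constant coefficients.\<close>

lemma canonical_one_form_rep:
  assumes M: "smooth_atlas M" and c: "c \<in> charts_at M (fst z)"
    and z: "snd z \<in> cotangent_space M (fst z)"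
    and v: "v \<in> tangent_space (cotangent_bundle M) z"
  shows "canonical_one_form M z v =
    snd (snd (cotangent_chart M c) z) \<bullet> fst (v (cotangent_chart M c))"
proof -
  have k: "cotangent_chart M c \<in> charts_at (cotangent_bundle M) z"
    by (rule charts_at_cotangent[OF z c])
  note t = tangent_map_tangent[OF smooth_atlas_cotangent[OF M] M smooth_map_cotangent_fst[OF M]
      charts_at_carrier[OF k] v]
  show ?thesis
    unfolding canonical_one_form_def covec_eq_inner[OF M c cotangent_spaceD(1)[OF z] t]
      tangent_map_cotangent_fst[OF M c k v] by simp
qed

lemma coord_canonical_one_form:
  assumes M: "smooth_atlas M" and c: "c \<in> M" and z: "z \<in> snd c ` fst c \<times> UNIV"
  shows "coord_form1 (cotangent_bundle M) (cotangent_chart M c) (canonical_one_form M) a z = snd z \<bullet> fst a"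
proof -
  let ?k = "cotangent_chart M c" and ?B = "cotangent_bundle M"
  let ?z = "chart_inv ?k z"
  have k: "?k \<in> ?B" using c by (auto simp: cotangent_bundle_def)
  have zk: "z \<in> snd ?k ` fst ?k" unfolding cotangent_chart_image_self[OF M c] by (rule z)
  have kz: "?k \<in> charts_at ?B ?z" by (rule chart_inv_charts_at[OF k zk])
  have "?z \<in> (SIGMA p:fst c. cotangent_space M p)"
    using chart_inv_in[OF zk] unfolding fst_cotangent_chart .
  then have 1: "fst ?z \<in> fst c" "snd ?z \<in> cotangent_space M (fst ?z)" by auto
  show ?thesis
    unfolding coord_form1_def
      canonical_one_form_rep[OF M charts_atI[OF c 1(1)] 1(2) coord_vector_tangent[OF smooth_atlas_cotangent[OF M] kz]]
      coord_vector_self[OF smooth_atlas_cotangent[OF M] kz] chart_chart_inv[OF zk] ..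
qed

lemma one_form_canonical:
  assumes M: "smooth_atlas M"
  shows "one_form (cotangent_bundle M) (canonical_one_form M)"
  unfolding one_form_def
proof (intro conjI ballI allI)
  fix z assume "z \<in> carrier (cotangent_bundle M)"
  then obtain c where c: "c \<in> charts_at M (fst z)" "snd z \<in> cotangent_space M (fst z)"
    by (rule charts_at_cotangentE)
  have "linear (\<lambda>a. snd (snd (cotangent_chart M c) z) \<bullet> fst (a :: 'b \<times> 'b))"
    using bounded_linear_compose[OF bounded_linear_inner_right bounded_linear_fst] bounded_linear.linear
    by blast
  then show "linear_at (cotangent_bundle M) z (canonical_one_form M z)"
    using canonical_one_form_rep[OF M c] by (rule linear_atI[OF _ _ smooth_atlas_cotangent[OF M]])
next
  fix k a assume "k \<in> cotangent_bundle M"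
  then obtain c where c: "k = cotangent_chart M c" "c \<in> M"
    unfolding cotangent_bundle_def by (rule imageE)
  note op = open_cotangent_image[OF M c(2)]
  show "smooth_on (snd k ` fst k) (coord_form1 (cotangent_bundle M) k (canonical_one_form M) a)"
    unfolding c(1) cotangent_chart_image_self[OF M c(2)]
    by (rule smooth_on_cong[THEN iffD2, OF op coord_canonical_one_form[OF M c(2)]])
      (auto intro!: smooth_on_inner smooth_on_snd smooth_on_const op)
qed

lemma canonical_symplectic_form_rep:
  assumes M: "smooth_atlas M" and c: "c \<in> charts_at M (fst z)"
    and z: "snd z \<in> cotangent_space M (fst z)"
    and v: "v \<in> tangent_space (cotangent_bundle M) z" and w: "w \<in> tangent_space (cotangent_bundle M) z"
  shows "canonical_symplectic_form M z v w =
    fst (v (cotangent_chart M c)) \<bullet> snd (w (cotangent_chart M c)) -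
    snd (v (cotangent_chart M c)) \<bullet> fst (w (cotangent_chart M c))"
proof -
  let ?k = "cotangent_chart M c" and ?B = "cotangent_bundle M"
  have k: "?k \<in> charts_at ?B z" by (rule charts_at_cotangent[OF z c])
  note cM = charts_at_mem(1)[OF c]
  have zk: "snd ?k z \<in> snd c ` fst c \<times> UNIV"
    using charts_at_mem(3)[OF k] unfolding cotangent_chart_image_self[OF M cM] .
  have "FD (coord_form1 ?B ?k (canonical_one_form M) a) (snd ?k z) = FD (\<lambda>z. snd z \<bullet> fst a) (snd ?k z)" for a
    by (rule FD_cong_open[OF open_cotangent_image[OF M cM] zk]) (rule coord_canonical_one_form[OF M cM])
  moreover have "FD (\<lambda>z. snd z \<bullet> fst a) x = (\<lambda>u. snd u \<bullet> fst a)" for a x :: "'b \<times> 'b"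
    by (intro FD_eqI bounded_linear_imp_has_derivative
        bounded_linear_compose[OF bounded_linear_inner_left bounded_linear_snd])
  ultimately have "local_d1 (coord_form1 ?B ?k (canonical_one_form M)) (snd ?k z) (v ?k) (w ?k) =
      snd (v ?k) \<bullet> fst (w ?k) - snd (w ?k) \<bullet> fst (v ?k)"
    by (simp add: local_d1_def)
  then show ?thesis
    unfolding canonical_symplectic_form_def
      ext_deriv1_chart[OF smooth_atlas_cotangent[OF M] one_form_canonical[OF M] k v w]
    by (simp add: inner_commute)
qed

text \<open>In a bundle chart the form is \<open>dx \<and> dy\<close> minus a term in \<open>dx \<and> dx\<close>.  Pairing a vector with vertical
  vectors \<open>(0, b)\<close>, on which \<open>\<pi>\<^sup>*\<beta>\<close> vanishes, gives the base component; once that component is 0, the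
  vector is itself vertical and pairing it with \<open>(a, 0)\<close> gives the fibre component.\<close>

theorem symplectic_magnetic_form:
  assumes M: "smooth_atlas M" and \<beta>: "two_form M \<beta>" and cl: "closed_two_form M \<beta>"
  shows "symplectic (cotangent_bundle M) (magnetic_form M \<beta>)"
proof -
  let ?B = "cotangent_bundle M" and ?\<theta> = "canonical_one_form M"
  note B = smooth_atlas_cotangent[OF M] and \<pi> = smooth_map_cotangent_fst[OF M]
  note \<theta> = one_form_canonical[OF M]
  note \<omega>2 = two_form_minus[OF B two_form_ext_deriv1[OF B \<theta>]] and p2 = two_form_pullback2[OF B M \<pi> \<beta>]
  have eq: "magnetic_form M \<beta> = (\<lambda>z v w. - ext_deriv1 ?B ?\<theta> z v w - pullback2 ?B M fst \<beta> z v w)"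
    by (intro ext) (simp add: magnetic_form_def canonical_symplectic_form_def)
  have two: "two_form ?B (magnetic_form M \<beta>)"
    unfolding eq by (rule two_form_diff[OF B \<omega>2 p2])
  have closed: "closed_two_form ?B (magnetic_form M \<beta>)"
    unfolding closed_two_form_def
  proof (intro ballI)
    fix z u v w
    assume z: "z \<in> carrier ?B" and t: "u \<in> tangent_space ?B z" "v \<in> tangent_space ?B z" "w \<in> tangent_space ?B z"
    show "ext_deriv2 ?B (magnetic_form M \<beta>) z u v w = 0"
      unfolding eq ext_deriv2_diff[OF B z \<omega>2 p2] ext_deriv2_minus[OF B z two_form_ext_deriv1[OF B \<theta>]]
      using closed_ext_deriv1[OF B \<theta>] closed_pullback2[OF B M \<pi> \<beta> cl] z t
      by (simp add: closed_two_form_def)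
  qed
  have nondeg: "v = (\<lambda>_. 0)"
    if z: "z \<in> carrier ?B" and v: "v \<in> tangent_space ?B z"
      and null: "\<forall>w\<in>tangent_space ?B z. magnetic_form M \<beta> z v w = 0" for z v
  proof -
    obtain c where c: "c \<in> charts_at M (fst z)" and k: "cotangent_chart M c \<in> charts_at ?B z"
      and \<alpha>: "snd z \<in> cotangent_space M (fst z)" using z by (rule charts_at_cotangentE)
    let ?k = "cotangent_chart M c"
    note fz = smooth_map_carrier[OF \<pi> z]
    note T = tangent_map_tangent[OF B M \<pi> z]
    have T0: "tangent_map ?B M fst z u = (\<lambda>_. 0)" if u: "u \<in> tangent_space ?B z" "fst (u ?k) = 0" for u
      using tangent_map_cotangent_fst[OF M c k u(1)] u(2)
      by (intro tangent_eqI[OF T[OF u(1)] tangent_space_zero[OF M] c]) simp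
    have w: "coord_vector ?B ?k z a \<in> tangent_space ?B z" "coord_vector ?B ?k z a ?k = a" for a
      by (rule coord_vector_tangent[OF B k], rule coord_vector_self[OF B k])
    have "fst (v ?k) \<bullet> b = 0" for b
    proof -
      let ?w = "coord_vector ?B ?k z (0, b)"
      have "pullback2 ?B M fst \<beta> z v ?w = 0"
        unfolding pullback2_def using T0[OF w(1), of "(0, b)"] w(2)[of "(0, b)"]
          two_form_zero(2)[OF M \<beta> fz T[OF v]] by simp
      then show ?thesis
        using bspec[OF null w(1)[of "(0, b)"]] canonical_symplectic_form_rep[OF M c \<alpha> v w(1)[of "(0, b)"]]
          w(2)[of "(0, b)"] by (simp add: magnetic_form_def)
    qed
    from this[of "fst (v ?k)"] have 1: "fst (v ?k) = 0" by simp
    have "snd (v ?k) \<bullet> a = 0" for a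
    proof -
      let ?w = "coord_vector ?B ?k z (a, 0)"
      have "pullback2 ?B M fst \<beta> z v ?w = 0"
        unfolding pullback2_def T0[OF v 1] by (rule two_form_zero(1)[OF M \<beta> fz T[OF w(1)]])
      then show ?thesis
        using bspec[OF null w(1)[of "(a, 0)"]] canonical_symplectic_form_rep[OF M c \<alpha> v w(1)[of "(a, 0)"]]
          w(2)[of "(a, 0)"] by (simp add: magnetic_form_def)
    qed
    from this[of "snd (v ?k)"] have "snd (v ?k) = 0" by simp
    with 1 have "v ?k = 0" by (simp add: prod_eq_iff)
    then show ?thesis by (intro tangent_eqI[OF v tangent_space_zero[OF B] k])
  qed
  show ?thesis unfolding symplectic_iff using two closed nondeg by blast
qed

section \<open>Tangent vectors of products\<close>

lemma coord_prod_projections: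
  assumes M: "smooth_atlas M" and N: "smooth_atlas N" and "c \<in> M" "d \<in> N"
    and x: "x \<in> snd c ` fst c \<times> snd d ` fst d"
  shows "(snd c \<circ> fst \<circ> chart_inv (prod_chart c d)) x = fst x"
    and "(snd d \<circ> snd \<circ> chart_inv (prod_chart c d)) x = snd x"
  using x atlas_inj[OF M assms(3)] atlas_inj[OF N assms(4)]
  by (auto simp: chart_inv_prod chart_chart_inv)

lemma tangent_map_prod_projections:
  assumes M: "smooth_atlas M" and N: "smooth_atlas N"
    and c: "c \<in> charts_at M (fst p)" and d: "d \<in> charts_at N (snd p)"
    and v: "v \<in> tangent_space (M \<times>\<^sub>M N) p"
  shows "tangent_map (M \<times>\<^sub>M N) M fst p v c = fst (v (prod_chart c d))"
    and "tangent_map (M \<times>\<^sub>M N) N snd p v d = snd (v (prod_chart c d))"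
proof -
  let ?k = "prod_chart c d"
  note P = smooth_atlas_prod[OF M N]
  have k: "?k \<in> charts_at (M \<times>\<^sub>M N) p" using c d by (auto simp: charts_at_prod)
  note cM = charts_at_mem(1)[OF c] and dN = charts_at_mem(1)[OF d]
  have im: "snd ?k ` fst ?k = snd c ` fst c \<times> snd d ` fst d" by (rule prod_chart_image)
  have op: "open (snd c ` fst c \<times> snd d ` fst d)"
    using atlas_open[OF M cM] atlas_open[OF N dN] by (rule open_Times)
  have x: "snd ?k p \<in> snd c ` fst c \<times> snd d ` fst d"
    using charts_at_mem(3)[OF k] unfolding im .
  have "FD (snd c \<circ> fst \<circ> chart_inv ?k) (snd ?k p) = FD fst (snd ?k p)"
    by (rule FD_cong_open[OF op x]) (rule coord_prod_projections(1)[OF M N cM dN])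
  also have "\<dots> = fst" by (intro FD_eqI bounded_linear_imp_has_derivative bounded_linear_fst)
  finally show "tangent_map (M \<times>\<^sub>M N) M fst p v c = fst (v ?k)"
    using tangent_map_rep[OF P smooth_map_fst[OF M N] charts_at_carrier[OF k] v k c] by simp
  have "FD (snd d \<circ> snd \<circ> chart_inv ?k) (snd ?k p) = FD snd (snd ?k p)"
    by (rule FD_cong_open[OF op x]) (rule coord_prod_projections(2)[OF M N cM dN])
  also have "\<dots> = snd" by (intro FD_eqI bounded_linear_imp_has_derivative bounded_linear_snd)
  finally show "tangent_map (M \<times>\<^sub>M N) N snd p v d = snd (v ?k)"
    using tangent_map_rep[OF P smooth_map_snd[OF M N] charts_at_carrier[OF k] v k d] by simp
qed

text \<open>These two inclusions make up \<open>tangent_pair\<close>, so their smoothness is what identifies the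
  representative of a pair of vectors.\<close>

lemma smooth_map_slices:
  assumes M: "smooth_atlas M" and N: "smooth_atlas N"
  shows "q \<in> carrier N \<Longrightarrow> smooth_map M (M \<times>\<^sub>M N) (\<lambda>x. (x, q))"
    and "q' \<in> carrier M \<Longrightarrow> smooth_map N (M \<times>\<^sub>M N) (\<lambda>y. (q', y))"
proof -
  note P = smooth_atlas_prod[OF M N]
  {
    assume q: "q \<in> carrier N"
    show "smooth_map M (M \<times>\<^sub>M N) (\<lambda>x. (x, q))"
    proof (rule smooth_map_onI[OF M P])
      fix p assume p: "p \<in> carrier M"
      obtain c where c: "c \<in> charts_at M p" using p by (rule carrier_chartE)
      obtain d where d: "d \<in> charts_at N q" using q by (rule carrier_chartE)
      note cM = charts_at_mem[OF c] and dN = charts_at_mem[OF d]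
      have k: "prod_chart c d \<in> charts_at (M \<times>\<^sub>M N) (p, q)" using c d by (auto simp: charts_at_prod)
      have "fst c \<subseteq> carrier M" using cM(1) by (auto intro: chart_carrier)
      then have "snd c ` fst c \<subseteq> snd c ` {x \<in> fst c \<inter> carrier M. (x, q) \<in> fst (prod_chart c d)}"
        using dN(2) by (intro image_mono) auto
      moreover have "smooth_on (snd c ` fst c) (snd (prod_chart c d) \<circ> (\<lambda>x. (x, q)) \<circ> chart_inv c)"
        by (rule smooth_on_cong[THEN iffD2, OF atlas_open[OF M cM(1)], where g1 = "\<lambda>x. (x, snd d q)"])
          (auto simp: chart_chart_inv intro!: smooth_on_Pair[OF atlas_open[OF M cM(1)]
            smooth_on_linear[OF bounded_linear_ident] smooth_on_const])
      ultimately show "\<exists>c\<in>charts_at M p. \<exists>d\<in>charts_at (M \<times>\<^sub>M N) (p, q). \<exists>V. open V \<and> snd c p \<in> V \<and>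
          V \<subseteq> snd c ` {x \<in> fst c \<inter> carrier M. (x, q) \<in> fst d} \<and>
          smooth_on V (snd d \<circ> (\<lambda>x. (x, q)) \<circ> chart_inv c)"
        by (intro bexI[OF _ c] bexI[OF _ k] exI[of _ "snd c ` fst c"] conjI atlas_open[OF M cM(1)] cM(3))
    qed auto
  next
    assume q: "q' \<in> carrier M"
    show "smooth_map N (M \<times>\<^sub>M N) (\<lambda>y. (q', y))"
    proof (rule smooth_map_onI[OF N P])
      fix p assume p: "p \<in> carrier N"
      obtain d where d: "d \<in> charts_at N p" using p by (rule carrier_chartE)
      obtain c where c: "c \<in> charts_at M q'" using q by (rule carrier_chartE)
      note cM = charts_at_mem[OF c] and dN = charts_at_mem[OF d]
      have k: "prod_chart c d \<in> charts_at (M \<times>\<^sub>M N) (q', p)" using c d by (auto simp: charts_at_prod)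
      have "fst d \<subseteq> carrier N" using dN(1) by (auto intro: chart_carrier)
      then have "snd d ` fst d \<subseteq> snd d ` {y \<in> fst d \<inter> carrier N. (q', y) \<in> fst (prod_chart c d)}"
        using cM(2) by (intro image_mono) auto
      moreover have "smooth_on (snd d ` fst d) (snd (prod_chart c d) \<circ> (\<lambda>y. (q', y)) \<circ> chart_inv d)"
        by (rule smooth_on_cong[THEN iffD2, OF atlas_open[OF N dN(1)], where g1 = "\<lambda>y. (snd c q', y)"])
          (auto simp: chart_chart_inv intro!: smooth_on_Pair[OF atlas_open[OF N dN(1)] smooth_on_const
            smooth_on_linear[OF bounded_linear_ident]])
      ultimately show "\<exists>c\<in>charts_at N p. \<exists>d\<in>charts_at (M \<times>\<^sub>M N) (q', p). \<exists>V. open V \<and> snd c p \<in> V \<and>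
          V \<subseteq> snd c ` {y \<in> fst c \<inter> carrier N. (q', y) \<in> fst d} \<and>
          smooth_on V (snd d \<circ> (\<lambda>y. (q', y)) \<circ> chart_inv c)"
        by (intro bexI[OF _ d] bexI[OF _ k] exI[of _ "snd d ` fst d"] conjI atlas_open[OF N dN(1)] dN(3))
    qed auto
  }
qed

lemma tangent_pair_rep:
  assumes M: "smooth_atlas M" and N: "smooth_atlas N"
    and c: "c \<in> charts_at M (fst p)" and d: "d \<in> charts_at N (snd p)"
    and v: "v \<in> tangent_space M (fst p)" and w: "w \<in> tangent_space N (snd p)"
  shows "tangent_pair M N p v w \<in> tangent_space (M \<times>\<^sub>M N) p"
    and "tangent_pair M N p v w (prod_chart c d) = (v c, w d)"
proof -
  let ?P = "M \<times>\<^sub>M N" and ?k = "prod_chart c d"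
  note P = smooth_atlas_prod[OF M N]
  note p1 = charts_at_carrier[OF c] and p2 = charts_at_carrier[OF d]
  note cM = charts_at_mem[OF c] and dN = charts_at_mem[OF d]
  note s1 = smooth_map_slices(1)[OF M N p2] and s2 = smooth_map_slices(2)[OF M N p1]
  have k: "?k \<in> charts_at ?P (fst p, snd p)" using c d by (auto simp: charts_at_prod)
  have t1: "tangent_map M ?P (\<lambda>x. (x, snd p)) (fst p) v \<in> tangent_space ?P p"
    using tangent_map_tangent[OF M P s1 p1 v] by simp
  have t2: "tangent_map N ?P (\<lambda>y. (fst p, y)) (snd p) w \<in> tangent_space ?P p"
    using tangent_map_tangent[OF N P s2 p2 w] by simp
  show "tangent_pair M N p v w \<in> tangent_space ?P p"
    using tangent_space_add[OF P t1 t2] by (simp add: tangent_pair_def[abs_def])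
  have "FD (snd ?k \<circ> (\<lambda>x. (x, snd p)) \<circ> chart_inv c) (snd c (fst p)) =
      FD (\<lambda>x. (x, snd d (snd p))) (snd c (fst p))"
    by (rule FD_cong_open[OF atlas_open[OF M cM(1)] cM(3)]) (simp add: chart_chart_inv)
  also have "\<dots> = (\<lambda>a. (a, 0))"
    by (intro FD_eqI has_derivative_Pair has_derivative_ident has_derivative_const)
  finally have 1: "tangent_map M ?P (\<lambda>x. (x, snd p)) (fst p) v ?k = (v c, 0)"
    using tangent_map_rep[OF M s1 p1 v c k] by simp
  have "FD (snd ?k \<circ> (\<lambda>y. (fst p, y)) \<circ> chart_inv d) (snd d (snd p)) =
      FD (\<lambda>y. (snd c (fst p), y)) (snd d (snd p))"
    by (rule FD_cong_open[OF atlas_open[OF N dN(1)] dN(3)]) (simp add: chart_chart_inv)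
  also have "\<dots> = (\<lambda>a. (0, a))"
    by (intro FD_eqI has_derivative_Pair has_derivative_ident has_derivative_const)
  finally have 2: "tangent_map N ?P (\<lambda>y. (fst p, y)) (snd p) w ?k = (0, w d)"
    using tangent_map_rep[OF N s2 p2 w d k] by simp
  show "tangent_pair M N p v w ?k = (v c, w d)"
    by (simp add: tangent_pair_def 1 2)
qed

section \<open>Routh potentials are closed\<close>

text \<open>Applying \<open>d\<close> to the Routh condition gives \<open>pr\<^sub>2\<^sup>*d\<beta> = pr\<^sub>1\<^sup>*d\<beta>\<close>.  Vectors of the form \<open>(0, a)\<close> are
  killed by the first projection and mapped to \<open>a\<close> by the second.\<close>

theorem closed_Routh_potential:
  assumes Q: "smooth_atlas Q" and f: "one_form (Q \<times>\<^sub>M Q) f" and R: "Routh_type Q f \<beta>"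
  shows "closed_two_form Q \<beta>"
  unfolding closed_two_form_def
proof (intro ballI)
  fix q u v w
  assume q: "q \<in> carrier Q" and t: "u \<in> tangent_space Q q" "v \<in> tangent_space Q q" "w \<in> tangent_space Q q"
  \<comment> \<open>Any point with second component \<open>q\<close> would do.\<close>
  let ?P = "Q \<times>\<^sub>M Q" and ?p = "(q, q)"
  note P = smooth_atlas_prod[OF Q Q]
  have \<beta>: "two_form Q \<beta>" using R by (simp add: Routh_type_def)
  note p1 = smooth_map_fst[OF Q Q] and p2 = smooth_map_snd[OF Q Q]
  note \<beta>1 = two_form_pullback2[OF P Q p1 \<beta>] and \<beta>2 = two_form_pullback2[OF P Q p2 \<beta>]
  have p: "?p \<in> carrier ?P" using q by (simp add: carrier_prod)
  obtain c where "c \<in> charts_at Q q" using q by (rule carrier_chartE)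
  then have c: "c \<in> charts_at Q (fst ?p)" "c \<in> charts_at Q (snd ?p)" by simp_all
  let ?V = "tangent_pair Q Q ?p (\<lambda>_. 0)"
  have V: "?V a \<in> tangent_space ?P ?p" "tangent_map ?P Q fst ?p (?V a) = (\<lambda>_. 0)"
    "tangent_map ?P Q snd ?p (?V a) = a" if a: "a \<in> tangent_space Q q" for a
  proof -
    have a': "a \<in> tangent_space Q (snd ?p)" using a by simp
    note * = tangent_pair_rep[OF Q Q c tangent_space_zero[OF Q] a']
    show 1: "?V a \<in> tangent_space ?P ?p" by (rule *(1))
    note T = tangent_map_prod_projections[OF Q Q c 1, unfolded *(2)]
    show "tangent_map ?P Q fst ?p (?V a) = (\<lambda>_. 0)"
      using tangent_eqI[OF tangent_map_tangent[OF P Q p1 p 1] tangent_space_zero[OF Q] c(1)] T(1) by simp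
    show "tangent_map ?P Q snd ?p (?V a) = a"
      using tangent_eqI[OF tangent_map_tangent[OF P Q p2 p 1] a' c(2)] T(2) by simp
  qed
  have "ext_deriv2 Q \<beta> q u v w - ext_deriv2 Q \<beta> q (\<lambda>_. 0) (\<lambda>_. 0) (\<lambda>_. 0) =
      ext_deriv2 ?P (pullback2 ?P Q snd \<beta>) ?p (?V u) (?V v) (?V w) -
      ext_deriv2 ?P (pullback2 ?P Q fst \<beta>) ?p (?V u) (?V v) (?V w)"
    unfolding ext_deriv2_pullback2[OF P Q p1 \<beta> p V(1)[OF t(1)] V(1)[OF t(2)] V(1)[OF t(3)]]
      ext_deriv2_pullback2[OF P Q p2 \<beta> p V(1)[OF t(1)] V(1)[OF t(2)] V(1)[OF t(3)]]
    by (simp add: V t)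
  also have "\<dots> = ext_deriv2 ?P (\<lambda>p v w. pullback2 ?P Q snd \<beta> p v w - pullback2 ?P Q fst \<beta> p v w)
      ?p (?V u) (?V v) (?V w)"
    by (rule ext_deriv2_diff[OF P p \<beta>2 \<beta>1, symmetric])
  also have "\<dots> = ext_deriv2 ?P (\<lambda>p v w. - ext_deriv1 ?P f p v w) ?p (?V u) (?V v) (?V w)"
    using R by (intro ext_deriv2_cong[OF P p]) (simp add: Routh_type_def)
  also have "\<dots> = 0"
    using ext_deriv2_minus[OF P p two_form_ext_deriv1[OF P f]] closed_ext_deriv1[OF P f] p V(1) t
    by (simp add: closed_two_form_def)
  finally have *: "ext_deriv2 Q \<beta> q u v w = ext_deriv2 Q \<beta> q (\<lambda>_. 0) (\<lambda>_. 0) (\<lambda>_. 0)" by simp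
  note k = charts_at_mem(1,3)[OF chart_at_in[OF q]]
  have "ext_deriv2 Q \<beta> q (\<lambda>_. 0) (\<lambda>_. 0) (\<lambda>_. 0) = 0"
    unfolding ext_deriv2_eq_local_d2 local_d2_def
    by (simp add: linear_0[OF smooth_on_linear_FD[OF two_form_coord(1)[OF Q \<beta> k(1)] k(2)]])
  with * show "ext_deriv2 Q \<beta> q u v w = 0" by simp
qed

section \<open>Forced discrete Legendre transforms are smooth\<close>

text \<open>Both Legendre transforms have this form, with \<open>\<pi>\<close> one of the projections.  In a bundle chart the
  fibre coordinates of the covector are its values \<open>g x b\<close> on the coordinate vectors.\<close>

lemma smooth_map_covector_field:
  fixes P :: "('a, 'e::euclidean_space) chart set" and Q :: "('b, 'f::euclidean_space) chart set"
  assumes P: "smooth_atlas P" and Q: "smooth_atlas Q" and \<pi>: "smooth_map P Q \<pi>"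
    and loc: "\<And>p. p \<in> carrier P \<Longrightarrow> \<exists>k\<in>charts_at P p. \<exists>c\<in>charts_at Q (\<pi> p). \<pi> ` fst k \<subseteq> fst c \<and>
      (\<exists>g. (\<forall>x\<in>snd k ` fst k. linear (g x)) \<and> (\<forall>b. smooth_on (snd k ` fst k) (\<lambda>x. g x b)) \<and>
        (\<forall>q\<in>fst k. \<forall>v\<in>tangent_space Q (\<pi> q). A q v = g (snd k q) (v c)))"
  shows "smooth_map P (cotangent_bundle Q) (\<lambda>p. (\<pi> p, restrict_covec Q (\<pi> p) (A p)))"
proof (rule smooth_map_onI[OF P smooth_atlas_cotangent[OF Q]])
  let ?F = "\<lambda>p. (\<pi> p, restrict_covec Q (\<pi> p) (A p))"
  fix p assume p: "p \<in> carrier P"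
  from loc[OF p] obtain k c g where k: "k \<in> charts_at P p" and c: "c \<in> charts_at Q (\<pi> p)"
    and sub: "\<pi> ` fst k \<subseteq> fst c" and lin: "\<forall>x\<in>snd k ` fst k. linear (g x)"
    and sm: "\<forall>b. smooth_on (snd k ` fst k) (\<lambda>x. g x b)"
    and A: "\<forall>q\<in>fst k. \<forall>v\<in>tangent_space Q (\<pi> q). A q v = g (snd k q) (v c)"
    by (elim bexE conjE exE) (rule that)
  note kP = charts_at_mem[OF k] and cQ = charts_at_mem[OF c]
  let ?V = "snd k ` fst k" and ?c = "cotangent_chart Q c"
  have op: "open ?V" by (rule atlas_open[OF P kP(1)])
  have cov: "restrict_covec Q (\<pi> q) (A q) \<in> cotangent_space Q (\<pi> q)" if q: "q \<in> fst k" for q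
  proof (rule restrict_covec_cotangent[OF Q])
    have "linear (g (snd k q))" using lin q by blast
    then show "linear_at Q (\<pi> q) (A q)"
      using A q by (intro linear_atI[OF _ _ Q, where c = c and g = "g (snd k q)"]) auto
  qed
  have Fk: "?F q \<in> fst ?c" if "q \<in> fst k" for q
    using cov[OF that] sub that unfolding fst_cotangent_chart by blast
  have rep: "(snd ?c \<circ> ?F \<circ> chart_inv k) x = ((snd c \<circ> \<pi> \<circ> chart_inv k) x, \<Sum>b\<in>Basis. g x b *\<^sub>R b)"
    if x: "x \<in> ?V" for x
  proof -
    let ?q = "chart_inv k x"
    have q: "?q \<in> fst k" "snd k ?q = x" by (rule chart_inv_in[OF x], rule chart_chart_inv[OF x])
    then have cq: "c \<in> charts_at Q (\<pi> ?q)" using sub cQ(1) by (auto intro: charts_atI)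
    have "A ?q (coord_vector Q c (\<pi> ?q) b) = g x b" for b
      using A q coord_vector_tangent[OF Q cq] coord_vector_self[OF Q cq] by simp
    then show ?thesis
      by (simp add: snd_cotangent_chart restrict_covec_def coord_vector_tangent[OF Q cq])
  qed
  have kc: "fst k \<subseteq> carrier P" using kP(1) by (auto intro: chart_carrier)
  then have "{q \<in> fst k \<inter> carrier P. \<pi> q \<in> fst c} = fst k" using sub by auto
  then have "smooth_on ?V (snd c \<circ> \<pi> \<circ> chart_inv k)"
    using smooth_map_on_rep(2)[OF \<pi> kP(1) cQ(1)] by simp
  then have "smooth_on ?V (\<lambda>x. ((snd c \<circ> \<pi> \<circ> chart_inv k) x, \<Sum>b\<in>Basis. g x b *\<^sub>R b))"
    using sm by (intro smooth_on_Pair smooth_on_sum smooth_on_scaleR smooth_on_const op) blast+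
  from smooth_on_cong[THEN iffD2, OF op rep this]
  have "smooth_on ?V (snd ?c \<circ> ?F \<circ> chart_inv k)" .
  moreover have "?V \<subseteq> snd k ` {q \<in> fst k \<inter> carrier P. ?F q \<in> fst ?c}"
    using kc Fk by (intro image_mono) blast
  moreover have "?c \<in> charts_at (cotangent_bundle Q) (?F p)"
    using charts_at_cotangent[of "?F p" Q c] cov[OF kP(2)] c by simp
  ultimately show "\<exists>c\<in>charts_at P p. \<exists>d\<in>charts_at (cotangent_bundle Q) (?F p). \<exists>V. open V \<and> snd c p \<in> V \<and>
      V \<subseteq> snd c ` {q \<in> fst c \<inter> carrier P. ?F q \<in> fst d} \<and> smooth_on V (snd d \<circ> ?F \<circ> chart_inv c)"
    using k op kP(3) by blast
qed auto

lemma smooth_real_function_coord: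
  assumes "smooth_atlas M" and L: "smooth_map M real_line L" and k: "k \<in> M"
  shows "smooth_on (snd k ` fst k) (L \<circ> chart_inv k)"
proof -
  have "(UNIV, id) \<in> real_line" by (simp add: real_line_def)
  from smooth_map_on_rep(2)[OF L k this]
  have "smooth_on (snd k ` (fst k \<inter> carrier M)) (L \<circ> chart_inv k)"
    by (simp add: Int_def)
  moreover have "fst k \<inter> carrier M = fst k" using k by (auto intro: chart_carrier)
  ultimately show ?thesis by simp
qed

text \<open>The Legendre transforms are restrictions of the 1-form \<open>dL + f\<close> on the product: to vectors \<open>(0, w)\<close>
  for the plus version and, up to sign, to vectors \<open>(v, 0)\<close> for the minus version.\<close>

lemma momentum_coord:
  assumes Q: "smooth_atlas Q" and L: "smooth_map (Q \<times>\<^sub>M Q) real_line L" and f: "one_form (Q \<times>\<^sub>M Q) f"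
    and c: "c \<in> charts_at Q (fst p)" and d: "d \<in> charts_at Q (snd p)"
    and v: "v \<in> tangent_space Q (fst p)" and w: "w \<in> tangent_space Q (snd p)"
  shows "differential (Q \<times>\<^sub>M Q) L p (tangent_pair Q Q p v w) + f p (tangent_pair Q Q p v w) =
    FD (L \<circ> chart_inv (prod_chart c d)) (snd (prod_chart c d) p) (v c, w d) +
    coord_form1 (Q \<times>\<^sub>M Q) (prod_chart c d) f (v c, w d) (snd (prod_chart c d) p)"
proof -
  let ?P = "Q \<times>\<^sub>M Q" and ?k = "prod_chart c d"
  note P = smooth_atlas_prod[OF Q Q]
  have k: "?k \<in> charts_at ?P p" using c d by (auto simp: charts_at_prod)
  note t = tangent_pair_rep[OF Q Q c d v w]
  have "(L \<circ> chart_inv ?k) differentiable at (snd ?k p)"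
    by (rule smooth_on_differentiable[OF smooth_real_function_coord[OF P L charts_at_mem(1)[OF k]]
          charts_at_mem(3)[OF k]])
  note D = differential_eq[OF P t(1) k this]
  show ?thesis
    unfolding D form1_coord[OF t(1) k P, where \<alpha> = f] t(2) by simp
qed

lemma smooth_momentum_coord:
  assumes M: "smooth_atlas M" and L: "smooth_map M real_line L" and f: "one_form M f" and k: "k \<in> M"
    and h: "bounded_linear h"
  shows "x \<in> snd k ` fst k \<Longrightarrow> linear (\<lambda>a. FD (L \<circ> chart_inv k) x (h a) + coord_form1 M k f (h a) x)"
    and "smooth_on (snd k ` fst k) (\<lambda>x. FD (L \<circ> chart_inv k) x (h a) + coord_form1 M k f (h a) x)"
proof -
  note sL = smooth_real_function_coord[OF M L k]
  show "smooth_on (snd k ` fst k) (\<lambda>x. FD (L \<circ> chart_inv k) x (h a) + coord_form1 M k f (h a) x)"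
    by (intro smooth_on_add atlas_open[OF M k] smooth_on_FD sL one_form_coord(1)[OF M f k])
  assume x: "x \<in> snd k ` fst k"
  show "linear (\<lambda>a. FD (L \<circ> chart_inv k) x (h a) + coord_form1 M k f (h a) x)"
    using linear_compose[OF bounded_linear.linear[OF h] smooth_on_linear_FD[OF sL x]]
      linear_compose[OF bounded_linear.linear[OF h] one_form_coord(2)[OF M f k x]]
    by (intro linear_compose_add) (simp_all add: o_def)
qed

lemma smooth_Legendre_plus:
  fixes Q :: "('q, 'e::euclidean_space) chart set"
  assumes Q: "smooth_atlas Q" and L: "smooth_map (Q \<times>\<^sub>M Q) real_line L" and f: "one_form (Q \<times>\<^sub>M Q) f"
  shows "smooth_map (Q \<times>\<^sub>M Q) (cotangent_bundle Q) (Legendre_plus Q L f)"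
  unfolding Legendre_plus_def[abs_def]
proof (rule smooth_map_covector_field[OF smooth_atlas_prod[OF Q Q] Q smooth_map_snd[OF Q Q]])
  let ?P = "Q \<times>\<^sub>M Q"
  fix p assume "p \<in> carrier ?P"
  then have p: "fst p \<in> carrier Q" "snd p \<in> carrier Q" by (auto simp: carrier_prod)
  obtain c where c: "c \<in> charts_at Q (fst p)" using p(1) by (rule carrier_chartE)
  obtain d where d: "d \<in> charts_at Q (snd p)" using p(2) by (rule carrier_chartE)
  let ?k = "prod_chart c d"
  have k: "?k \<in> charts_at ?P p" using c d by (auto simp: charts_at_prod)
  let ?g = "\<lambda>x a. FD (L \<circ> chart_inv ?k) x (0, a) + coord_form1 ?P ?k f (0, a) x"
  have h: "bounded_linear (\<lambda>a::'e. (0::'e, a))"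
    by (intro bounded_linear_Pair bounded_linear_zero bounded_linear_ident)
  note g = smooth_momentum_coord[OF smooth_atlas_prod[OF Q Q] L f charts_at_mem(1)[OF k] h]
  have "D2 Q L q v + force_plus Q f q v = ?g (snd ?k q) (v d)"
    if q: "q \<in> fst ?k" and v: "v \<in> tangent_space Q (snd q)" for q v
  proof -
    have "c \<in> charts_at Q (fst q)" "d \<in> charts_at Q (snd q)"
      using q charts_at_mem(1)[OF c] charts_at_mem(1)[OF d] by (auto intro: charts_atI)
    from momentum_coord[OF Q L f this tangent_space_zero[OF Q] v] show ?thesis
      by (simp add: D2_def force_plus_def)
  qed
  then show "\<exists>k\<in>charts_at ?P p. \<exists>c\<in>charts_at Q (snd p). snd ` fst k \<subseteq> fst c \<and>
      (\<exists>g. (\<forall>x\<in>snd k ` fst k. linear (g x)) \<and> (\<forall>b. smooth_on (snd k ` fst k) (\<lambda>x. g x b)) \<and>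
        (\<forall>q\<in>fst k. \<forall>v\<in>tangent_space Q (snd q). D2 Q L q v + force_plus Q f q v = g (snd k q) (v c)))"
    by (intro bexI[OF _ k] bexI[OF _ d] conjI exI[of _ ?g] ballI allI g) auto
qed

lemma smooth_Legendre_minus:
  fixes Q :: "('q, 'e::euclidean_space) chart set"
  assumes Q: "smooth_atlas Q" and L: "smooth_map (Q \<times>\<^sub>M Q) real_line L" and f: "one_form (Q \<times>\<^sub>M Q) f"
  shows "smooth_map (Q \<times>\<^sub>M Q) (cotangent_bundle Q) (Legendre_minus Q L f)"
  unfolding Legendre_minus_def[abs_def]
proof (rule smooth_map_covector_field[OF smooth_atlas_prod[OF Q Q] Q smooth_map_fst[OF Q Q]])
  let ?P = "Q \<times>\<^sub>M Q"
  fix p assume "p \<in> carrier ?P"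
  then have p: "fst p \<in> carrier Q" "snd p \<in> carrier Q" by (auto simp: carrier_prod)
  obtain c where c: "c \<in> charts_at Q (fst p)" using p(1) by (rule carrier_chartE)
  obtain d where d: "d \<in> charts_at Q (snd p)" using p(2) by (rule carrier_chartE)
  let ?k = "prod_chart c d"
  have k: "?k \<in> charts_at ?P p" using c d by (auto simp: charts_at_prod)
  let ?g = "\<lambda>x a. FD (L \<circ> chart_inv ?k) x (a, 0) + coord_form1 ?P ?k f (a, 0) x"
  have h: "bounded_linear (\<lambda>a::'e. (a, 0::'e))"
    by (intro bounded_linear_Pair bounded_linear_zero bounded_linear_ident)
  note g = smooth_momentum_coord[OF smooth_atlas_prod[OF Q Q] L f charts_at_mem(1)[OF k] h]
  note op = atlas_open[OF smooth_atlas_prod[OF Q Q] charts_at_mem(1)[OF k]]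
  have "- D1 Q L q v - force_minus Q f q v = - ?g (snd ?k q) (v c)"
    if q: "q \<in> fst ?k" and v: "v \<in> tangent_space Q (fst q)" for q v
  proof -
    have "c \<in> charts_at Q (fst q)" "d \<in> charts_at Q (snd q)"
      using q charts_at_mem(1)[OF c] charts_at_mem(1)[OF d] by (auto intro: charts_atI)
    from momentum_coord[OF Q L f this v tangent_space_zero[OF Q]] show ?thesis
      by (simp add: D1_def force_minus_def)
  qed
  then show "\<exists>k\<in>charts_at ?P p. \<exists>c\<in>charts_at Q (fst p). fst ` fst k \<subseteq> fst c \<and>
      (\<exists>g. (\<forall>x\<in>snd k ` fst k. linear (g x)) \<and> (\<forall>b. smooth_on (snd k ` fst k) (\<lambda>x. g x b)) \<and>
        (\<forall>q\<in>fst k. \<forall>v\<in>tangent_space Q (fst q). - D1 Q L q v - force_minus Q f q v = g (snd k q) (v c)))"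
    by (intro bexI[OF _ k] bexI[OF _ c] conjI exI[of _ "\<lambda>x a. - ?g x a"] ballI allI
        linear_compose_neg smooth_on_minus g op) auto
qed

theorem proposition2p27:
  fixes Q :: "('q, 'e::euclidean_space) chart set"
    and L :: "'q \<times> 'q \<Rightarrow> real"
    and f :: "('q \<times> 'q, 'e \<times> 'e) form1"
    and \<beta> :: "('q, 'e) form2"
  assumes "forced_discrete_system Q L f"
    and "Routh_type Q f \<beta>"
  shows "regular Q L f \<longleftrightarrow>
           symplectic (Q \<times>\<^sub>M Q) (omega_plus Q L f \<beta>) \<and>
           symplectic (Q \<times>\<^sub>M Q) (omega_minus Q L f \<beta>)"
proof -
  have Q: "smooth_atlas Q" and L: "smooth_map (Q \<times>\<^sub>M Q) real_line L" and f: "one_form (Q \<times>\<^sub>M Q) f"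
    using assms(1) by (simp_all add: forced_discrete_system_def smooth_manifold_def)
  have "two_form Q \<beta>" using assms(2) by (simp add: Routh_type_def)
  then have \<Omega>: "symplectic (cotangent_bundle Q) (magnetic_form Q \<beta>)"
    using closed_Routh_potential[OF Q f assms(2)] by (rule symplectic_magnetic_form[OF Q])
  note iff = symplectic_pullback_iff[OF smooth_atlas_prod[OF Q Q] smooth_atlas_cotangent[OF Q] _ \<Omega>]
  show ?thesis
    unfolding regular_def omega_plus_def omega_minus_def
      iff[OF smooth_Legendre_plus[OF Q L f]] iff[OF smooth_Legendre_minus[OF Q L f]] ..
qed

end
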